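(* Let $1/2\le\sigma\le 1$ and suppose the adjacent time-step ratios satisfy $0<\gamma_{n+1}\le\gamma_{**}(\sigma)$ for $n=1,\dots,N-1$. Then the VBDF-2 scheme with parameter $\sigma$ (defined in the context), for either $H=L^2$ (i.e. $G_H=-I$) or $H=H^{-1}$ (i.e. $G_H=\Delta$), is unconditionally energy stable (no restriction on the time-step sizes other than the ratio condition) in the sense that every solution $(\phi^n,r^n)_n$ of the scheme satisfies $$E_H^{n+1}-E_H^{n}\le 0,\qquad n=1,\dots,N-1,$$ where the discrete modified energy is $$E_H^{n}:=\begin{cases}\dfrac{(2\sigma-1)\gamma_{n+1}^{3/2}}{2+2\gamma_{n+1}}\dfrac{\|\phi^n-\phi^{n-1}\|^2}{\tau_n}+E^n_{Mod}, & H=L^2,\\[3mm] \dfrac{(2\sigma-1)\gamma_{n+1}^{3/2}}{2+2\gamma_{n+1}}\dfrac{\|\nabla^{-1}(\phi^n-\phi^{n-1})\|^2}{\tau_n}+E^n_{Mod}, & H=H^{-1},\end{cases}$$ with $E^n_{Mod}=\frac{\varepsilon^2}{2}\|\nabla\phi^n\|^2+\frac{\lambda}{2}\|\phi^n\|^2+|r^n|^2$.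
   Context: Setting. $\Omega\subset\mathbb{R}^d$, $d\in\{1,2,3\}$, is a bounded domain with smooth boundary (or a periodic box); $(\cdot,\cdot)$ and $\|\cdot\|$ are the $L^2(\Omega)$ inner product and norm. The gradient flow is $$\phi_t=G_H\mu,\qquad \mu=-\varepsilon^2\Delta\phi+F'(\phi),$$ with $\varepsilon>0$, $F$ a nonlinear potential, $G_H=-I$ for $H=L^2$ and $G_H=\Delta$ for $H=H^{-1}$. Boundary conditions are periodic, or homogeneous Neumann: $\partial_{\mathbf n}\phi=0$ on $\partial\Omega$ if $G_H=-I$, and $\partial_{\mathbf n}\phi=\partial_{\mathbf n}\Delta\phi=0$ on $\partial\Omega$ if $G_H=\Delta$. All functions produced by the scheme are assumed regular enough for it to make sense and satisfy these boundary conditions. For mean-zero $v$, $\|\nabla^{-1}v\|^2:=(v,(-\Delta)^{-1}v)$, where $(-\Delta)^{-1}v$ is the mean-zero solution $w$ of $-\Delta w=v$ with the given (periodic or Neumann) boundary condition. Scalar auxiliary variable. Fix $\lambda\ge 0$, put $g(\phi)=F(\phi)-\frac{\lambda}{2}|\phi|^2$ and $E_1(\phi)=\int_\Omega g(\phi)\,dx+C_0$, where $C_0>0$ is a constant such that $E_1(\phi)>0$. Write $E_1^n=E_1(\phi^n)$. $V\in C^2(\mathbb{R})$ is a real function with $V(1)=1$ and $V'(1)=-1$. Time mesh. $0=t_0<t_1<\dots<t_N$, $\tau_n=t_n-t_{n-1}$, $\gamma_{n+1}=\tau_{n+1}/\tau_n$. When $\gamma_{N+1}$ occurs in a formula it is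 taken to be any fixed number satisfying the same bounds as the other ratios. VBDF-2 scheme with parameter $\sigma\in[1/2,1]$. Given $\phi^{n-1},\phi^n,r^n$ ($n\ge1$), $(\phi^{n+1},r^{n+1})$ satisfies $$F_2^{n+\sigma}\phi=G_H\mu^{n+\sigma},$$ $$\mu^{n+\sigma}=-\varepsilon^2\Delta\phi^{n+\sigma}+\lambda\phi^{n+\sigma}+\frac{r^{n+1}}{\sqrt{E_1^n}}V(\xi^{n+1})g'(\phi^{*,n+\sigma}),$$ $$\frac{r^{n+1}-r^n}{\tau_{n+1}}=\frac{V(\xi^{n+1})}{2\sqrt{E_1^n}}\int_\Omega g'(\phi^{*,n+\sigma})\frac{\phi^{n+1}-\phi^n}{\tau_{n+1}}\,dx,\qquad \xi^{n+1}=\frac{r^{n+1}}{\sqrt{E_1^n}},$$ where $\phi^{n+\sigma}=\sigma\phi^{n+1}+(1-\sigma)\phi^n$, $\phi^{*,n+\sigma}=\phi^n+\sigma\gamma_{n+1}(\phi^n-\phi^{n-1})$ and $$F_2^{n+\sigma}\phi=\frac{1}{\tau_{n+1}}\Big[\frac{1+2\sigma\gamma_{n+1}}{1+\gamma_{n+1}}\phi^{n+1}-(1+(2\sigma-1)\gamma_{n+1})\phi^n+\frac{(2\sigma-1)\gamma_{n+1}^2}{1+\gamma_{n+1}}\phi^{n-1}\Big].$$ The first step is computed from $\phi^0$ and $r^0=\sqrt{E_1(\phi^0)}$ by the first-order scheme $$\frac{\phi^1-\phi^0}{\tau_1}=G_H\mu^1,\quad \mu^1=-\varepsilon^2\Delta\phi^1+\lambda\phi^1+\frac{r^1}{\sqrt{E_1^0}}g'(\phi^0),\quad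 r^1-r^0=\frac{1}{2\sqrt{E_1^0}}\int_\Omega g'(\phi^0)(\phi^1-\phi^0)\,dx.$$ The bound $\gamma_{**}(\sigma)$. Let $G(s,z)=\frac{2+4\sigma s-(2\sigma-1)s^{3/2}}{1+s}-\frac{(2\sigma-1)z^{3/2}}{1+z}$. For $\sigma\in(1/2,1]$, $\gamma_{**}(\sigma)$ is the positive root $z$ of $G(z,z)=0$; it is decreasing in $\sigma$, with $\gamma_{**}(1)\approx 4.8645$ and $\gamma_{**}(\sigma)\to+\infty$ as $\sigma\to1/2$; for $\sigma=1/2$ set $\gamma_{**}(1/2)=+\infty$ (no restriction on the ratios). *)

theory Defs
  imports "HOL-Analysis.Analysis"
begin

definition partial_deriv :: "'a::euclidean_space \<Rightarrow> ('a \<Rightarrow> real) \<Rightarrow> 'a \<Rightarrow> real" where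
  "partial_deriv i f x = frechet_derivative f (at x) i"

definition grad :: "('a::euclidean_space \<Rightarrow> real) \<Rightarrow> 'a \<Rightarrow> 'a" where
  "grad f x = (\<Sum>i\<in>Basis. partial_deriv i f x *\<^sub>R i)"

definition laplacian :: "('a::euclidean_space \<Rightarrow> real) \<Rightarrow> 'a \<Rightarrow> real" where
  "laplacian f x = (\<Sum>i\<in>Basis. partial_deriv i (partial_deriv i f) x)"

text \<open>\<open>Ck k U f\<close> says that \<open>f\<close> is of class $C^k$ on \<open>U\<close>; it is meant for open \<open>U\<close>.\<close>

primrec Ck :: "nat \<Rightarrow> 'a::euclidean_space set \<Rightarrow> ('a \<Rightarrow> real) \<Rightarrow> bool" where
  "Ck 0 U f \<longleftrightarrow> continuous_on U f"
| "Ck (Suc k) U f \<longleftrightarrow>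
     (\<forall>x\<in>U. f differentiable (at x)) \<and> (\<forall>i\<in>Basis. Ck k U (partial_deriv i f))"

text \<open>\<open>\<rho>\<close> is a smooth local defining function of \<open>\<Omega>\<close> near \<open>p\<close>, so that
  the boundary is locally a smooth hypersurface with \<open>\<Omega>\<close> on one side of it.\<close>

definition local_defining_function ::
  "'a::euclidean_space set \<Rightarrow> 'a \<Rightarrow> 'a set \<Rightarrow> ('a \<Rightarrow> real) \<Rightarrow> bool" where
  "local_defining_function \<Omega> p U \<rho> \<longleftrightarrow>
     open U \<and> p \<in> U \<and> (\<forall>k. Ck k U \<rho>) \<and> (\<forall>x\<in>U. grad \<rho> x \<noteq> 0) \<and>
     \<Omega> \<inter> U = {x \<in> U. \<rho> x < 0}"

definition smooth_bounded_domain :: "'a::euclidean_space set \<Rightarrow> bool" where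
  "smooth_bounded_domain \<Omega> \<longleftrightarrow>
     open \<Omega> \<and> connected \<Omega> \<and> \<Omega> \<noteq> {} \<and> bounded \<Omega> \<and>
     (\<forall>p\<in>frontier \<Omega>. \<exists>U \<rho>. local_defining_function \<Omega> p U \<rho>)"

text \<open>The normalised gradient at a boundary point does not depend on the choice of the
  local defining function.\<close>

definition outward_normal :: "'a::euclidean_space set \<Rightarrow> 'a \<Rightarrow> 'a" where
  "outward_normal \<Omega> p =
     (THE \<nu>. \<exists>U \<rho>. local_defining_function \<Omega> p U \<rho> \<and> \<nu> = grad \<rho> p /\<^sub>R norm (grad \<rho> p))"

definition normal_deriv :: "'a::euclidean_space set \<Rightarrow> ('a \<Rightarrow> real) \<Rightarrow> 'a \<Rightarrow> real" where
  "normal_deriv \<Omega> f p = grad f p \<bullet> outward_normal \<Omega> p"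

text \<open>The geometry also fixes the boundary condition: periodic on the box with corners
  \<open>a\<close> and \<open>b\<close>, homogeneous Neumann on a smooth domain.\<close>

datatype 'a geometry = Periodic_Box 'a 'a | Neumann_Domain "'a set"

primrec valid_geometry :: "'a::euclidean_space geometry \<Rightarrow> bool" where
  "valid_geometry (Periodic_Box a b) \<longleftrightarrow> (\<forall>i\<in>Basis. a \<bullet> i < b \<bullet> i)"
| "valid_geometry (Neumann_Domain \<Omega>) \<longleftrightarrow> smooth_bounded_domain \<Omega>"

primrec region :: "'a::euclidean_space geometry \<Rightarrow> 'a set" where
  "region (Periodic_Box a b) = box a b"
| "region (Neumann_Domain \<Omega>) = \<Omega>"

primrec boundary_cond :: "'a::euclidean_space geometry \<Rightarrow> ('a \<Rightarrow> real) \<Rightarrow> bool" where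
  "boundary_cond (Periodic_Box a b) f \<longleftrightarrow>
     (\<forall>x. \<forall>i\<in>Basis. f (x + ((b - a) \<bullet> i) *\<^sub>R i) = f x)"
| "boundary_cond (Neumann_Domain \<Omega>) f \<longleftrightarrow> (\<forall>p\<in>frontier \<Omega>. normal_deriv \<Omega> f p = 0)"

text \<open>Class $C^k$ up to the boundary. On a smooth domain $C^k(\overline\Omega)$ consists of
  the restrictions of functions that are $C^k$ near the closure; values away from the closure
  are irrelevant. Periodic functions are viewed as functions on the whole space.\<close>

primrec regular :: "nat \<Rightarrow> 'a::euclidean_space geometry \<Rightarrow> ('a \<Rightarrow> real) \<Rightarrow> bool" where
  "regular k (Periodic_Box a b) f \<longleftrightarrow> Ck k UNIV f"
| "regular k (Neumann_Domain \<Omega>) f \<longleftrightarrow> (\<exists>U. open U \<and> closure \<Omega> \<subseteq> U \<and> Ck k U f)"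

definition l2_inner :: "'a::euclidean_space set \<Rightarrow> ('a \<Rightarrow> real) \<Rightarrow> ('a \<Rightarrow> real) \<Rightarrow> real" where
  "l2_inner \<Omega> u v = (LINT x:\<Omega>|lborel. u x * v x)"

definition l2_norm :: "'a::euclidean_space set \<Rightarrow> ('a \<Rightarrow> real) \<Rightarrow> real" where
  "l2_norm \<Omega> u = sqrt (l2_inner \<Omega> u u)"

definition grad_norm :: "'a::euclidean_space set \<Rightarrow> ('a \<Rightarrow> real) \<Rightarrow> real" where
  "grad_norm \<Omega> u = sqrt (LINT x:\<Omega>|lborel. grad u x \<bullet> grad u x)"

text \<open>\<open>(-\<Delta>)\<inverse> v\<close>: the solution is unique on the region (not outside of it), hence
  \<open>SOME\<close> rather than \<open>THE\<close>.\<close>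

definition inv_neg_laplacian ::
  "'a::euclidean_space geometry \<Rightarrow> ('a \<Rightarrow> real) \<Rightarrow> 'a \<Rightarrow> real" where
  "inv_neg_laplacian D v =
     (SOME w. regular 2 D w \<and> boundary_cond D w \<and>
        (\<forall>x\<in>region D. - laplacian w x = v x) \<and> (LINT x:region D|lborel. w x) = 0)"

definition inv_grad_norm_sq :: "'a::euclidean_space geometry \<Rightarrow> ('a \<Rightarrow> real) \<Rightarrow> real" where
  "inv_grad_norm_sq D v = l2_inner (region D) v (inv_neg_laplacian D v)"

datatype flow = Flow_L2 | Flow_Hm1

primrec flow_op :: "flow \<Rightarrow> ('a::euclidean_space \<Rightarrow> real) \<Rightarrow> 'a \<Rightarrow> real" where
  "flow_op Flow_L2 \<mu> = (\<lambda>x. - \<mu> x)"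
| "flow_op Flow_Hm1 \<mu> = laplacian \<mu>"

primrec flow_order :: "flow \<Rightarrow> nat" where
  "flow_order Flow_L2 = 2"
| "flow_order Flow_Hm1 = 4"

primrec flow_boundary_cond ::
  "flow \<Rightarrow> 'a::euclidean_space geometry \<Rightarrow> ('a \<Rightarrow> real) \<Rightarrow> bool" where
  "flow_boundary_cond Flow_L2 D u \<longleftrightarrow> boundary_cond D u"
| "flow_boundary_cond Flow_Hm1 D u \<longleftrightarrow> boundary_cond D u \<and> boundary_cond D (laplacian u)"

definition g_pot :: "real \<Rightarrow> (real \<Rightarrow> real) \<Rightarrow> real \<Rightarrow> real" where
  "g_pot lam F s = F s - lam / 2 * \<bar>s\<bar>\<^sup>2"

definition E1 ::
  "'a::euclidean_space geometry \<Rightarrow> real \<Rightarrow> (real \<Rightarrow> real) \<Rightarrow> real \<Rightarrow> ('a \<Rightarrow> real) \<Rightarrow> real" where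
  "E1 D lam F C0 u = (LINT x:region D|lborel. g_pot lam F (u x)) + C0"

definition chem_pot ::
  "real \<Rightarrow> real \<Rightarrow> (real \<Rightarrow> real) \<Rightarrow> ('a::euclidean_space \<Rightarrow> real) \<Rightarrow> real \<Rightarrow> ('a \<Rightarrow> real)
    \<Rightarrow> 'a \<Rightarrow> real" where
  "chem_pot eps lam F u c w x =
     - eps\<^sup>2 * laplacian u x + lam * u x + c * deriv (g_pot lam F) (w x)"

definition time_step :: "(nat \<Rightarrow> real) \<Rightarrow> nat \<Rightarrow> real" where
  "time_step t n = t n - t (n - 1)"

definition interp :: "real \<Rightarrow> (nat \<Rightarrow> 'a \<Rightarrow> real) \<Rightarrow> nat \<Rightarrow> 'a \<Rightarrow> real" where
  "interp \<sigma> \<phi> n x = \<sigma> * \<phi> (n + 1) x + (1 - \<sigma>) * \<phi> n x"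

definition extrap :: "real \<Rightarrow> (nat \<Rightarrow> real) \<Rightarrow> (nat \<Rightarrow> 'a \<Rightarrow> real) \<Rightarrow> nat \<Rightarrow> 'a \<Rightarrow> real" where
  "extrap \<sigma> \<gamma> \<phi> n x = \<phi> n x + \<sigma> * \<gamma> (n + 1) * (\<phi> n x - \<phi> (n - 1) x)"

definition F2 ::
  "real \<Rightarrow> (nat \<Rightarrow> real) \<Rightarrow> (nat \<Rightarrow> real) \<Rightarrow> (nat \<Rightarrow> 'a \<Rightarrow> real) \<Rightarrow> nat \<Rightarrow> 'a \<Rightarrow> real" where
  "F2 \<sigma> t \<gamma> \<phi> n x =
     1 / time_step t (n + 1) *
       ((1 + 2 * \<sigma> * \<gamma> (n + 1)) / (1 + \<gamma> (n + 1)) * \<phi> (n + 1) x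
        - (1 + (2 * \<sigma> - 1) * \<gamma> (n + 1)) * \<phi> n x
        + (2 * \<sigma> - 1) * (\<gamma> (n + 1))\<^sup>2 / (1 + \<gamma> (n + 1)) * \<phi> (n - 1) x)"

definition first_step ::
  "'a::euclidean_space geometry \<Rightarrow> flow \<Rightarrow> real \<Rightarrow> real \<Rightarrow> (real \<Rightarrow> real) \<Rightarrow> real
    \<Rightarrow> (nat \<Rightarrow> real) \<Rightarrow> (nat \<Rightarrow> 'a \<Rightarrow> real) \<Rightarrow> (nat \<Rightarrow> real) \<Rightarrow> bool" where
  "first_step D H eps lam F C0 t \<phi> r \<longleftrightarrow>
     (let e = sqrt (E1 D lam F C0 (\<phi> 0));
          \<mu> = chem_pot eps lam F (\<phi> 1) (r 1 / e) (\<phi> 0)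
      in r 0 = e \<and>
         (\<forall>x\<in>region D. (\<phi> 1 x - \<phi> 0 x) / time_step t 1 = flow_op H \<mu> x) \<and>
         r 1 - r 0 =
           1 / (2 * e) * (LINT x:region D|lborel.
             deriv (g_pot lam F) (\<phi> 0 x) * (\<phi> 1 x - \<phi> 0 x)))"

definition vbdf2_step ::
  "'a::euclidean_space geometry \<Rightarrow> flow \<Rightarrow> real \<Rightarrow> real \<Rightarrow> (real \<Rightarrow> real) \<Rightarrow> real
    \<Rightarrow> (real \<Rightarrow> real) \<Rightarrow> real \<Rightarrow> (nat \<Rightarrow> real) \<Rightarrow> (nat \<Rightarrow> real)
    \<Rightarrow> (nat \<Rightarrow> 'a \<Rightarrow> real) \<Rightarrow> (nat \<Rightarrow> real) \<Rightarrow> nat \<Rightarrow> bool" where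
  "vbdf2_step D H eps lam F C0 V \<sigma> t \<gamma> \<phi> r n \<longleftrightarrow>
     (let e = sqrt (E1 D lam F C0 (\<phi> n));
          \<xi> = r (n + 1) / e;
          \<mu> = chem_pot eps lam F (interp \<sigma> \<phi> n) (r (n + 1) / e * V \<xi>) (extrap \<sigma> \<gamma> \<phi> n)
      in (\<forall>x\<in>region D. F2 \<sigma> t \<gamma> \<phi> n x = flow_op H \<mu> x) \<and>
         (r (n + 1) - r n) / time_step t (n + 1) =
           V \<xi> / (2 * e) * (LINT x:region D|lborel.
             deriv (g_pot lam F) (extrap \<sigma> \<gamma> \<phi> n x) *
               ((\<phi> (n + 1) x - \<phi> n x) / time_step t (n + 1))))"

text \<open>Positivity of \<open>E1\<close> is required only at the iterates, which is all the scheme uses.\<close>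

definition vbdf2_solution ::
  "'a::euclidean_space geometry \<Rightarrow> flow \<Rightarrow> real \<Rightarrow> real \<Rightarrow> (real \<Rightarrow> real) \<Rightarrow> real
    \<Rightarrow> (real \<Rightarrow> real) \<Rightarrow> real \<Rightarrow> nat \<Rightarrow> (nat \<Rightarrow> real) \<Rightarrow> (nat \<Rightarrow> real)
    \<Rightarrow> (nat \<Rightarrow> 'a \<Rightarrow> real) \<Rightarrow> (nat \<Rightarrow> real) \<Rightarrow> bool" where
  "vbdf2_solution D H eps lam F C0 V \<sigma> N t \<gamma> \<phi> r \<longleftrightarrow>
     (\<forall>n\<le>N. regular (flow_order H) D (\<phi> n) \<and> flow_boundary_cond H D (\<phi> n) \<and>
             E1 D lam F C0 (\<phi> n) > 0) \<and>
     first_step D H eps lam F C0 t \<phi> r \<and>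
     (\<forall>n. 1 \<le> n \<and> n < N \<longrightarrow> vbdf2_step D H eps lam F C0 V \<sigma> t \<gamma> \<phi> r n)"

definition G_fun :: "real \<Rightarrow> real \<Rightarrow> real \<Rightarrow> real" where
  "G_fun \<sigma> s z =
     (2 + 4 * \<sigma> * s - (2 * \<sigma> - 1) * s powr (3/2)) / (1 + s)
     - (2 * \<sigma> - 1) * z powr (3/2) / (1 + z)"

definition gamma_ss :: "real \<Rightarrow> ereal" where
  "gamma_ss \<sigma> = (if \<sigma> = 1/2 then \<infinity> else ereal (THE z. 0 < z \<and> G_fun \<sigma> z z = 0))"

definition E_mod ::
  "'a::euclidean_space geometry \<Rightarrow> real \<Rightarrow> real \<Rightarrow> (nat \<Rightarrow> 'a \<Rightarrow> real) \<Rightarrow> (nat \<Rightarrow> real)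
    \<Rightarrow> nat \<Rightarrow> real" where
  "E_mod D eps lam \<phi> r n =
     eps\<^sup>2 / 2 * (grad_norm (region D) (\<phi> n))\<^sup>2
     + lam / 2 * (l2_norm (region D) (\<phi> n))\<^sup>2 + \<bar>r n\<bar>\<^sup>2"

primrec increment_norm_sq ::
  "flow \<Rightarrow> 'a::euclidean_space geometry \<Rightarrow> ('a \<Rightarrow> real) \<Rightarrow> real" where
  "increment_norm_sq Flow_L2 D v = (l2_norm (region D) v)\<^sup>2"
| "increment_norm_sq Flow_Hm1 D v = inv_grad_norm_sq D v"

definition E_H ::
  "'a::euclidean_space geometry \<Rightarrow> flow \<Rightarrow> real \<Rightarrow> real \<Rightarrow> real \<Rightarrow> (nat \<Rightarrow> real)
    \<Rightarrow> (nat \<Rightarrow> real) \<Rightarrow> (nat \<Rightarrow> 'a \<Rightarrow> real) \<Rightarrow> (nat \<Rightarrow> real) \<Rightarrow> nat \<Rightarrow> real" where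
  "E_H D H eps lam \<sigma> t \<gamma> \<phi> r n =
     (2 * \<sigma> - 1) * \<gamma> (n + 1) powr (3/2) / (2 + 2 * \<gamma> (n + 1)) *
       (increment_norm_sq H D (\<lambda>x. \<phi> n x - \<phi> (n - 1) x) / time_step t n)
     + E_mod D eps lam \<phi> r n"

end

theory Submission imports Defs begin

text \<open>Testing the scheme with \<open>\<phi>\<^sup>n\<^sup>+\<^sup>1 - \<phi>\<^sup>n\<close> (for \<open>H\<^sup>-\<^sup>1\<close>, with its inverse Laplacian) and Green's identity bounds
  the change of the modified energy by a quadratic form in two consecutive increments, whose mixed
  term is absorbed by a weighted Young inequality; what remains has the sign of \<open>G_fun\<close> at
  consecutive ratios.

  Green's identity only has to be known for fields whose normal component vanishes on the boundary,
  so no surface integral is needed: cut the field off by a function of \<open>\<rho> / \<epsilon>\<close>, where \<open>\<rho>\<close> is a local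
  defining function. The derivative of the cutoff meets only \<open>grad \<rho> \<bullet> F = O(\<rho>)\<close>, so the extra term
  stays bounded and lives on a layer that disappears as \<open>\<epsilon> \<rightarrow> 0\<close>.\<close>

section \<open>Functions of class \<open>C\<^sup>k\<close>\<close>

text \<open>The nonlinear term is never estimated: the same factor \<open>V\<close> multiplies it in
  the chemical potential and in the equation for \<open>r\<close>, so tested with the increment it
  equals \<open>2 * r (n + 1) * (r (n + 1) - r n)\<close> exactly. What remains is quadratic. The
  exponent 3/2 in the energy comes from the Young weight, the square root of the step ratio
  \<gamma>: it splits \<gamma>^2 B, with B the mixed product, into \<gamma>^(3/2) times half the sum
  of \<gamma> Q0 and Q1. Since \<gamma> divided by the new step is 1 over the old step, the Q0 part
  is exactly the increment term of the old energy. The ratios before and after a step are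
  independent, so a condition on the diagonal of \<open>G_fun\<close> must control all pairs; it
  does because one number separates the two terms of \<open>G_fun\<close>. For H^-1 the obstacle is
  that \<open>inv_neg_laplacian\<close> is a choice, about which nothing is known until some
  potential exists; afterwards only Dirichlet forms of potentials occur.\<close>

lemma frechet_derivative_cong_open:
  assumes "open U" "x \<in> U" "\<And>y. y \<in> U \<Longrightarrow> f y = g y"
  shows "frechet_derivative f (at x) = frechet_derivative g (at x)"
proof -
  have "(f has_derivative f') (at x) \<longleftrightarrow> (g has_derivative f') (at x)" for f'
    using assms has_derivative_transform_within_open[of f f' x UNIV U g]
      has_derivative_transform_within_open[of g f' x UNIV U f] by (metis UNIV_I)
  then show ?thesis by (simp add: frechet_derivative_def)
qed

lemma partial_deriv_cong:
  assumes "open U" "x \<in> U" "\<And>y. y \<in> U \<Longrightarrow> f y = g y"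
  shows "partial_deriv i f x = partial_deriv i g x"
  using frechet_derivative_cong_open[OF assms] by (simp add: partial_deriv_def)

lemma Ck_cong:
  assumes "open U" "\<And>x. x \<in> U \<Longrightarrow> f x = g x"
  shows "Ck k U f \<longleftrightarrow> Ck k U g"
  using assms(2)
proof (induction k arbitrary: f g)
  case 0
  then show ?case by (simp cong: continuous_on_cong)
next
  case (Suc k)
  have "f differentiable (at x) \<longleftrightarrow> g differentiable (at x)" if "x \<in> U" for x
    unfolding differentiable_def
    using Suc.prems assms(1) that has_derivative_transform_within_open[of f _ x UNIV U g]
      has_derivative_transform_within_open[of g _ x UNIV U f] by (metis UNIV_I)
  moreover have "Ck k U (partial_deriv i f) \<longleftrightarrow> Ck k U (partial_deriv i g)" for i
    by (rule Suc.IH) (use partial_deriv_cong[OF assms(1)] Suc.prems in blast)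
  ultimately show ?case by simp
qed

lemma Ck_subset: "Ck k U f \<Longrightarrow> W \<subseteq> U \<Longrightarrow> Ck k W f"
  by (induction k arbitrary: f) (auto intro: continuous_on_subset)

lemma Ck_imp_continuous_on: "Ck k U f \<Longrightarrow> continuous_on U f"
  by (cases k) (auto intro!: continuous_at_imp_continuous_on differentiable_imp_continuous_within)

lemma Ck_Suc_imp: "Ck (Suc k) U f \<Longrightarrow> Ck k U f"
  by (induction k arbitrary: f) (simp, auto dest: Ck_imp_continuous_on[of "Suc 0"]
      intro!: continuous_at_imp_continuous_on differentiable_imp_continuous_within)

lemma Ck_mono: "Ck m U f \<Longrightarrow> k \<le> m \<Longrightarrow> Ck k U f"
  by (induction m) (auto simp: le_Suc_eq dest: Ck_Suc_imp simp del: Ck.simps)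

lemma Ck_partial_deriv: "Ck (Suc k) U f \<Longrightarrow> i \<in> Basis \<Longrightarrow> Ck k U (partial_deriv i f)"
  by simp

lemma Ck_differentiable: "Ck k U f \<Longrightarrow> 1 \<le> k \<Longrightarrow> x \<in> U \<Longrightarrow> f differentiable (at x)"
  by (cases k) auto

lemma has_derivative_grad:
  assumes "f differentiable (at x)"
  shows "(f has_derivative (\<lambda>v. grad f x \<bullet> v)) (at x)"
proof -
  have D: "(f has_derivative frechet_derivative f (at x)) (at x)"
    using assms frechet_derivative_works by blast
  have "frechet_derivative f (at x) v = grad f x \<bullet> v" for v
  proof -
    have lin: "linear (frechet_derivative f (at x))"
      using D has_derivative_linear by blast
    have "frechet_derivative f (at x) v = frechet_derivative f (at x) (\<Sum>i\<in>Basis. (v \<bullet> i) *\<^sub>R i)"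
      by (simp add: euclidean_representation)
    also have "\<dots> = (\<Sum>i\<in>Basis. (v \<bullet> i) * partial_deriv i f x)"
      by (simp add: linear_sum[OF lin] linear_cmul[OF lin] partial_deriv_def)
    also have "\<dots> = grad f x \<bullet> v"
      by (simp add: grad_def inner_sum_left inner_commute[of v] mult.commute)
    finally show ?thesis .
  qed
  then have "frechet_derivative f (at x) = (\<lambda>v. grad f x \<bullet> v)" by auto
  then show ?thesis using D by simp
qed

lemma partial_deriv_eqI: "(f has_derivative f') (at x) \<Longrightarrow> partial_deriv i f x = f' i"
  unfolding partial_deriv_def using frechet_derivative_at by metis

lemma grad_inner_Basis: "i \<in> Basis \<Longrightarrow> grad f x \<bullet> i = partial_deriv i f x"
  by (simp add: grad_def inner_sum_left inner_Basis if_distrib cong: if_cong)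

lemma has_derivative_partial:
  "f differentiable (at x) \<Longrightarrow> (f has_derivative (\<lambda>v. \<Sum>i\<in>Basis. partial_deriv i f x * (v \<bullet> i))) (at x)"
  using has_derivative_grad[of f x] unfolding grad_def inner_sum_left inner_scaleR_left
  by (simp add: inner_commute)

lemma grad_eqI: "(f has_derivative (\<lambda>v. w \<bullet> v)) (at x) \<Longrightarrow> grad f x = w"
  by (rule euclidean_eqI) (simp add: grad_inner_Basis partial_deriv_eqI)

lemma continuous_on_grad: "Ck 1 U f \<Longrightarrow> continuous_on U (grad f)"
  unfolding grad_def by (auto intro!: continuous_intros)

lemma partial_deriv_const: "partial_deriv i (\<lambda>x. c) x = 0"
  by (rule partial_deriv_eqI[where f'="\<lambda>_. 0"]) (auto intro!: derivative_eq_intros)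

lemma grad_add:
  assumes "f differentiable (at x)" "g differentiable (at x)"
  shows "grad (\<lambda>y. f y + g y) x = grad f x + grad g x"
  by (rule grad_eqI) (auto simp: inner_add_left
      intro!: derivative_eq_intros assms[THEN has_derivative_grad])

lemma grad_mult:
  assumes "f differentiable (at x)" "g differentiable (at x)"
  shows "grad (\<lambda>y. f y * g y) x = g x *\<^sub>R grad f x + f x *\<^sub>R grad g x"
  by (rule grad_eqI) (auto simp: inner_add_left
      intro!: derivative_eq_intros assms[THEN has_derivative_grad])

lemma grad_const: "grad (\<lambda>x. c) x = 0"
  by (rule grad_eqI) simp

lemma grad_lincomb:
  assumes "f differentiable (at x)" "g differentiable (at x)"
  shows "grad (\<lambda>x. a * f x + b * g x) x = a *\<^sub>R grad f x + b *\<^sub>R grad g x"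
proof -
  have "grad (\<lambda>x. a * f x + b * g x) x = grad (\<lambda>x. a * f x) x + grad (\<lambda>x. b * g x) x"
    using assms by (intro grad_add) (auto intro!: derivative_intros)
  then show ?thesis
    using grad_mult[of "\<lambda>_. a" x f] grad_mult[of "\<lambda>_. b" x g] assms by (simp add: grad_const)
qed

text \<open>\<open>real\<close> has the single basis vector 1, so \<open>partial_deriv 1\<close> is
  the ordinary derivative. Thus \<open>Ck\<close>, made for Euclidean spaces, also measures the
  regularity of \<open>F\<close> and of cutoff profiles.\<close>

lemma partial_deriv_real:
  fixes g :: "real \<Rightarrow> real"
  assumes "g differentiable (at y)"
  shows "(g has_field_derivative partial_deriv 1 g y) (at y)"
proof -
  have "(g has_derivative (\<lambda>v. partial_deriv 1 g y * v)) (at y)"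
    using has_derivative_partial[OF assms] by simp
  then show ?thesis by (simp add: has_field_derivative_def)
qed

lemma grad_compose:
  fixes g :: "real \<Rightarrow> real"
  assumes "f differentiable (at x)" "g differentiable (at (f x))"
  shows "grad (\<lambda>y. g (f y)) x = partial_deriv 1 g (f x) *\<^sub>R grad f x"
proof (rule grad_eqI)
  have "(g has_derivative (\<lambda>v. partial_deriv 1 g (f x) * v)) (at (f x))"
    using partial_deriv_real[OF assms(2)] by (simp add: has_field_derivative_def)
  from has_derivative_compose[OF has_derivative_grad[OF assms(1)] this]
  show "((\<lambda>y. g (f y)) has_derivative (\<lambda>v. (partial_deriv 1 g (f x) *\<^sub>R grad f x) \<bullet> v)) (at x)"
    by simp
qed

lemma partial_deriv_add:
  "f differentiable (at x) \<Longrightarrow> g differentiable (at x) \<Longrightarrow> i \<in> Basis \<Longrightarrow>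
   partial_deriv i (\<lambda>y. f y + g y) x = partial_deriv i f x + partial_deriv i g x"
  by (simp add: grad_add inner_add_left flip: grad_inner_Basis)

lemma partial_deriv_mult:
  "f differentiable (at x) \<Longrightarrow> g differentiable (at x) \<Longrightarrow> i \<in> Basis \<Longrightarrow>
   partial_deriv i (\<lambda>y. f y * g y) x = partial_deriv i f x * g x + f x * partial_deriv i g x"
  by (simp add: grad_mult inner_add_left flip: grad_inner_Basis)

lemma partial_deriv_compose:
  fixes g :: "real \<Rightarrow> real"
  shows "f differentiable (at x) \<Longrightarrow> g differentiable (at (f x)) \<Longrightarrow> i \<in> Basis \<Longrightarrow>
   partial_deriv i (\<lambda>y. g (f y)) x = partial_deriv 1 g (f x) * partial_deriv i f x"
  by (simp add: grad_compose flip: grad_inner_Basis)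

lemma Ck_const: "Ck k U (\<lambda>x. c)"
proof (induction k arbitrary: c)
  case (Suc k)
  have "partial_deriv i (\<lambda>x::'a. c) = (\<lambda>x. 0)" for i by (simp add: partial_deriv_const fun_eq_iff)
  then show ?case using Suc by simp
qed simp

lemma Ck_inner: "Ck k U (\<lambda>x. x \<bullet> w)"
proof (cases k)
  case (Suc m)
  have d: "((\<lambda>x. x \<bullet> w) has_derivative (\<lambda>v. v \<bullet> w)) (at x)" for x
    by (auto intro!: derivative_eq_intros)
  then have "partial_deriv i (\<lambda>x. x \<bullet> w) = (\<lambda>x. i \<bullet> w)" for i
    using partial_deriv_eqI by blast
  moreover have "(\<lambda>x. x \<bullet> w) differentiable (at x)" for x using d differentiableI by blast
  ultimately show ?thesis using Suc by (simp add: Ck_const)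
qed (auto intro!: continuous_intros)

lemma Ck_add: "open U \<Longrightarrow> Ck k U f \<Longrightarrow> Ck k U g \<Longrightarrow> Ck k U (\<lambda>x. f x + g x)"
proof (induction k arbitrary: f g)
  case (Suc k)
  have "Ck k U (partial_deriv i (\<lambda>y. f y + g y))" if "i \<in> Basis" for i
    by (rule Ck_cong[THEN iffD1, OF Suc.prems(1) _ Suc.IH[of "partial_deriv i f" "partial_deriv i g"]])
       (use Suc.prems that in \<open>auto simp: partial_deriv_add\<close>)
  then show ?case using Suc.prems by (auto intro!: derivative_intros)
qed (auto intro!: continuous_intros)

lemma Ck_mult: "open U \<Longrightarrow> Ck k U f \<Longrightarrow> Ck k U g \<Longrightarrow> Ck k U (\<lambda>x. f x * g x)"
proof (induction k arbitrary: f g)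
  case (Suc k)
  have "Ck k U (partial_deriv i (\<lambda>y. f y * g y))" if i: "i \<in> Basis" for i
  proof (rule Ck_cong[THEN iffD1, OF Suc.prems(1)])
    show "Ck k U (\<lambda>x. partial_deriv i f x * g x + f x * partial_deriv i g x)"
      using Suc.prems Suc.prems(2,3)[THEN Ck_Suc_imp] i by (intro Ck_add Suc.IH) auto
  qed (use Suc.prems i in \<open>auto simp: partial_deriv_mult\<close>)
  then show ?case using Suc.prems by (auto intro!: derivative_intros)
qed (auto intro!: continuous_intros)

lemma Ck_cmult: "open U \<Longrightarrow> Ck k U f \<Longrightarrow> Ck k U (\<lambda>x. c * f x)"
  by (intro Ck_mult Ck_const)

lemma Ck_diff: "open U \<Longrightarrow> Ck k U f \<Longrightarrow> Ck k U g \<Longrightarrow> Ck k U (\<lambda>x. f x - g x)"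
  using Ck_add[of U k f "\<lambda>x. -1 * g x"] Ck_cmult[of U k g "-1"] by simp

lemma Ck_sum: "finite I \<Longrightarrow> open U \<Longrightarrow> (\<And>i. i \<in> I \<Longrightarrow> Ck k U (f i)) \<Longrightarrow> Ck k U (\<lambda>x. \<Sum>i\<in>I. f i x)"
proof (induction I rule: finite_induct)
  case empty
  then show ?case using Ck_const by simp
next
  case (insert i I)
  then show ?case by (simp add: Ck_add)
qed

lemma Ck_compose:
  fixes g :: "real \<Rightarrow> real"
  shows "open U \<Longrightarrow> Ck k U f \<Longrightarrow> Ck k UNIV g \<Longrightarrow> Ck k U (\<lambda>x. g (f x))"
proof (induction k arbitrary: f g)
  case (Suc k)
  have "Ck k U (partial_deriv i (\<lambda>y. g (f y)))" if i: "i \<in> Basis" for i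
  proof (rule Ck_cong[THEN iffD1, OF Suc.prems(1)])
    show "Ck k U (\<lambda>x. partial_deriv 1 g (f x) * partial_deriv i f x)"
      using Suc.IH[OF Suc.prems(1) Ck_Suc_imp[OF Suc.prems(2)] Ck_partial_deriv[OF Suc.prems(3), of 1]] i Suc.prems
      by (auto intro: Ck_mult)
  qed (use Suc.prems i in \<open>auto simp: partial_deriv_compose\<close>)
  moreover have "(\<lambda>y. g (f y)) differentiable (at x)" if "x \<in> U" for x
    using Suc.prems(2,3) that by (intro differentiable_compose[of g f x UNIV]) auto
  ultimately show ?case by simp
qed (use continuous_on_compose2[of UNIV _ U] in auto)

lemma Ck_laplacian: "open U \<Longrightarrow> Ck (Suc (Suc k)) U f \<Longrightarrow> Ck k U (laplacian f)"
  unfolding laplacian_def by (rule Ck_sum) auto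

lemma laplacian_add:
  assumes "open U" "Ck 2 U f" "Ck 2 U g" "x \<in> U"
  shows "laplacian (\<lambda>y. f y + g y) x = laplacian f x + laplacian g x"
proof -
  have "partial_deriv i (partial_deriv i (\<lambda>y. f y + g y)) x =
    partial_deriv i (partial_deriv i f) x + partial_deriv i (partial_deriv i g) x" if "i \<in> Basis" for i
  proof -
    have "partial_deriv i (partial_deriv i (\<lambda>y. f y + g y)) x =
       partial_deriv i (\<lambda>y. partial_deriv i f y + partial_deriv i g y) x"
      by (rule partial_deriv_cong[OF assms(1,4)])
        (use assms that in \<open>auto simp: numeral_2_eq_2 intro!: partial_deriv_add\<close>)
    then show ?thesis using assms that by (simp add: numeral_2_eq_2 partial_deriv_add)
  qed
  then show ?thesis by (simp add: laplacian_def sum.distrib)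
qed

lemma laplacian_cmult:
  assumes "open U" "Ck 2 U f" "x \<in> U"
  shows "laplacian (\<lambda>y. c * f y) x = c * laplacian f x"
proof -
  have "partial_deriv i (partial_deriv i (\<lambda>y. c * f y)) x = c * partial_deriv i (partial_deriv i f) x"
    if "i \<in> Basis" for i
  proof -
    have "partial_deriv i (partial_deriv i (\<lambda>y. c * f y)) x = partial_deriv i (\<lambda>y. c * partial_deriv i f y) x"
      by (rule partial_deriv_cong[OF assms(1,3)])
        (use assms that in \<open>auto simp: numeral_2_eq_2 partial_deriv_mult partial_deriv_const\<close>)
    then show ?thesis using assms that by (simp add: numeral_2_eq_2 partial_deriv_mult partial_deriv_const)
  qed
  then show ?thesis by (simp add: laplacian_def sum_distrib_left)
qed

lemma laplacian_const: "laplacian (\<lambda>x. c) x = 0"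
proof -
  have "partial_deriv i (\<lambda>x::'a. c) = (\<lambda>x. 0)" for i by (simp add: partial_deriv_const fun_eq_iff)
  then show ?thesis by (simp add: laplacian_def partial_deriv_const)
qed

lemma Ck_deriv:
  fixes f :: "real \<Rightarrow> real"
  assumes "Ck (Suc k) UNIV f"
  shows "Ck k UNIV (deriv f)"
proof (rule Ck_cong[THEN iffD1, OF open_UNIV])
  show "Ck k UNIV (partial_deriv 1 f)" using assms by simp
  show "partial_deriv 1 f x = deriv f x" for x
    using assms DERIV_imp_deriv[OF partial_deriv_real[of f x]] by simp
qed

lemma Ck_g_pot: "Ck k UNIV F \<Longrightarrow> Ck k UNIV (g_pot lam F)"
  using Ck_diff[of UNIV k F "\<lambda>s. lam / 2 * (s * s)"]
    Ck_cmult[OF open_UNIV Ck_mult[OF open_UNIV Ck_inner[of k UNIV "1::real"] Ck_inner[of k UNIV 1]], of "lam/2"]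
  by (simp add: g_pot_def[abs_def] power2_eq_square)

section \<open>Integrals of derivatives\<close>

lemma DERIV_line:
  assumes "f differentiable (at (x + s *\<^sub>R v))"
  shows "((\<lambda>s. f (x + s *\<^sub>R v)) has_real_derivative grad f (x + s *\<^sub>R v) \<bullet> v) (at s)"
proof -
  have "((\<lambda>s. x + s *\<^sub>R v) has_derivative (\<lambda>h. h *\<^sub>R v)) (at s)"
    by (auto intro!: derivative_eq_intros)
  from has_derivative_compose[OF this has_derivative_grad[OF assms]]
  show ?thesis by (simp add: has_field_derivative_def mult.commute[of _ "grad f _ \<bullet> v"])
qed

lemma line_difference_bound:
  assumes "0 \<le> h" and "\<And>s. 0 \<le> s \<Longrightarrow> s \<le> h \<Longrightarrow> f differentiable (at (x + s *\<^sub>R v))"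
    and "\<And>s. 0 \<le> s \<Longrightarrow> s \<le> h \<Longrightarrow> \<bar>grad f (x + s *\<^sub>R v) \<bullet> v\<bar> \<le> M"
  shows "\<bar>f (x + h *\<^sub>R v) - f x\<bar> \<le> M * h"
proof (cases "h = 0")
  case False
  obtain z where z: "0 < z" "z < h"
    "f (x + h *\<^sub>R v) - f (x + 0 *\<^sub>R v) = (h - 0) * (grad f (x + z *\<^sub>R v) \<bullet> v)"
    using MVT2[of 0 h "\<lambda>s. f (x + s *\<^sub>R v)" "\<lambda>s. grad f (x + s *\<^sub>R v) \<bullet> v"]
      DERIV_line assms False by (metis order_le_less)
  then show ?thesis using assms(1) assms(3)[of z] by (simp add: abs_mult mult.commute mult_left_mono)
qed simp

lemma set_integrable_bounded_open:
  fixes f :: "'a::euclidean_space \<Rightarrow> real"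
  assumes "open S" "bounded S" "continuous_on (closure S) f"
  shows "set_integrable lborel S f"
proof (rule set_integrable_subset)
  show "set_integrable lborel (closure S) f"
    unfolding set_integrable_def
    using borel_integrable_compact[of "closure S" f] assms by (simp add: compact_closure)
qed (use assms in \<open>auto simp: closure_subset\<close>)

lemma set_integral_tendsto_bounded:
  fixes f :: "'a::euclidean_space \<Rightarrow> real"
  assumes S: "open S" "bounded S"
    and cont: "\<And>n. continuous_on S (fs n)" "continuous_on S f"
    and bd: "\<And>n x. x \<in> S \<Longrightarrow> \<bar>fs n x\<bar> \<le> M"
    and lim: "\<And>x. x \<in> S \<Longrightarrow> (\<lambda>n. fs n x) \<longlonglongrightarrow> f x"
  shows "(\<lambda>n. LINT x:S|lborel. fs n x) \<longlonglongrightarrow> (LINT x:S|lborel. f x)"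
  unfolding set_lebesgue_integral_def
proof (rule integral_dominated_convergence)
  show "integrable lborel (\<lambda>x. indicator S x * M)"
    using S emeasure_bounded_finite[OF S(2)] by (intro integrable_mult_left) auto
  show "AE x in lborel. (\<lambda>n. indicator S x *\<^sub>R fs n x) \<longlonglongrightarrow> indicator S x *\<^sub>R f x"
    by (rule AE_I2) (auto split: split_indicator intro: lim)
  show "AE x in lborel. norm (indicator S x *\<^sub>R fs n x) \<le> indicator S x * M" for n
    by (rule AE_I2) (auto split: split_indicator intro: bd)
  show "(\<lambda>x. indicator S x *\<^sub>R f x) \<in> borel_measurable lborel"
    using S cont borel_measurable_continuous_on_indicator[of S f] by simp
  show "(\<lambda>x. indicator S x *\<^sub>R fs n x) \<in> borel_measurable lborel" for n
    using S cont borel_measurable_continuous_on_indicator[of S "fs n"] by simp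
qed

text \<open>The difference quotients in direction \<open>i\<close> have integral 0 by
  \<open>shift\<close> and converge boundedly to the partial derivative, so dominated convergence
  does the work of Fubini and the fundamental theorem. With invariance as the hypothesis, compact
  support and periodicity are covered alike.\<close>

lemma integral_partial_deriv_box_eq_0:
  fixes f :: "'a::euclidean_space \<Rightarrow> real"
  assumes f: "Ck 1 UNIV f" and i: "i \<in> Basis" and L: "0 < L"
    and shift: "\<And>h. 0 < h \<Longrightarrow> h < L \<Longrightarrow>
      (LINT x:box a b|lborel. f (x + h *\<^sub>R i)) = (LINT x:box a b|lborel. f x)"
  shows "(LINT x:box a b|lborel. partial_deriv i f x) = 0"
proof -
  \<comment> \<open>The 2 keeps every step strictly below \<open>L\<close>, even for n = 0.\<close>
  define h where "h n = L / real (n + 2)" for n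
  have h: "0 < h n" "h n < L" for n using L by (auto simp: h_def field_simps add_pos_nonneg)
  have cf: "continuous_on A f" "continuous_on A (partial_deriv i f)" for A
    using Ck_imp_continuous_on[OF f] f i by (auto intro: continuous_on_subset)
  have df: "f differentiable (at x)" for x using f by simp
  define Q where "Q n x = (f (x + h n *\<^sub>R i) - f x) / h n" for n x
  \<comment> \<open>All segments swept by the translations; the mean value theorem needs the
    derivative bounded on them.\<close>
  define C where "C = (\<lambda>(x, s). x + s *\<^sub>R i) ` (cbox a b \<times> {0..L})"
  have "compact C" unfolding C_def
    by (intro compact_continuous_image compact_Times) (auto intro!: continuous_intros simp: case_prod_beta)
  then have "bounded (partial_deriv i f ` C)"
    by (intro compact_imp_bounded compact_continuous_image cf)
  then obtain M where M: "\<And>x. x \<in> C \<Longrightarrow> \<bar>partial_deriv i f x\<bar> \<le> M"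
    unfolding bounded_iff by force
  have "(\<lambda>n. LINT x:box a b|lborel. Q n x) \<longlonglongrightarrow> (LINT x:box a b|lborel. partial_deriv i f x)"
  proof (rule set_integral_tendsto_bounded)
    show "continuous_on (box a b) (Q n)" for n
      unfolding Q_def using h[of n] by (auto intro!: continuous_intros continuous_on_compose2[OF cf(1)[of UNIV]])
    show "\<bar>Q n x\<bar> \<le> M" if "x \<in> box a b" for n x
    proof -
      have "\<bar>f (x + h n *\<^sub>R i) - f x\<bar> \<le> M * h n"
      proof (rule line_difference_bound)
        fix s assume "0 \<le> s" "s \<le> h n"
        then have "x + s *\<^sub>R i \<in> C" using that h[of n] unfolding C_def
          by (intro image_eqI[of _ _ "(x, s)"]) (auto simp: box_subset_cbox[THEN subsetD])
        then show "\<bar>grad f (x + s *\<^sub>R i) \<bullet> i\<bar> \<le> M" using M i by (simp add: grad_inner_Basis)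
      qed (use h[of n] df in auto)
      then show ?thesis using h[of n] by (simp add: Q_def field_simps)
    qed
    show "(\<lambda>n. Q n x) \<longlonglongrightarrow> partial_deriv i f x" for x
    proof -
      have "((\<lambda>s. f (x + s *\<^sub>R i)) has_real_derivative partial_deriv i f x) (at 0)"
        using DERIV_line[of f x 0 i] df i by (simp add: grad_inner_Basis)
      then have "((\<lambda>s. (f (x + s *\<^sub>R i) - f x) / s) \<longlongrightarrow> partial_deriv i f x) (at 0)"
        by (simp add: DERIV_def)
      moreover have "filterlim h (at 0) sequentially"
      proof (rule filterlim_atI)
        have "(\<lambda>n. L * inverse (real (n + 2))) \<longlonglongrightarrow> L * 0"
          by (intro tendsto_intros LIMSEQ_ignore_initial_segment[OF lim_inverse_n])
        then show "h \<longlonglongrightarrow> 0" by (simp add: h_def[abs_def] divide_inverse)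
        show "\<forall>\<^sub>F n in sequentially. h n \<noteq> 0" using h(1) by (auto intro!: always_eventually simp: less_imp_neq[symmetric])
      qed
      ultimately show ?thesis unfolding Q_def by (rule filterlim_compose)
    qed
  qed (use cf in auto)
  moreover have "(LINT x:box a b|lborel. Q n x) = 0" for n
  proof -
    have "set_integrable lborel (box a b) f" "set_integrable lborel (box a b) (\<lambda>x. f (x + h n *\<^sub>R i))"
      by (auto intro!: set_integrable_bounded_open cf bounded_box continuous_intros
          continuous_on_compose2[OF cf(1)[of UNIV]])
    then show ?thesis using shift[OF h] by (simp add: Q_def set_integral_diff)
  qed
  ultimately show ?thesis by (simp add: LIMSEQ_const_iff)
qed

lemma integral_translate:
  fixes f :: "'a::euclidean_space \<Rightarrow> real"
  assumes "f \<in> borel_measurable borel"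
  shows "(LINT x|lborel. f (x + c)) = (LINT x|lborel. f x)"
proof -
  have "(LINT x|distr lborel borel ((+) c). f x) = (LINT x|lborel. f (c + x))"
    by (rule integral_distr) (use assms in auto)
  then show ?thesis by (simp add: lborel_distr_plus add.commute)
qed

text \<open>A large enough box contains the support of every translate by at most 1, so integrals
  over it are integrals over the whole space, which do not see translations.\<close>

lemma integral_partial_deriv_compact_support:
  fixes f :: "'a::euclidean_space \<Rightarrow> real"
  assumes f: "Ck 1 UNIV f" and i: "i \<in> Basis" and K: "compact K" "\<And>x. x \<notin> K \<Longrightarrow> f x = 0"
  shows "(LINT x|lborel. partial_deriv i f x) = 0"
proof -
  have mf: "f \<in> borel_measurable borel"
    using f by (intro borel_measurable_continuous_onI Ck_imp_continuous_on)
  define K' where "K' = (\<lambda>(x, s). x - s *\<^sub>R i) ` (K \<times> {0..1})"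
  have "compact K'" unfolding K'_def using K
    by (intro compact_continuous_image compact_Times) (auto intro!: continuous_intros simp: case_prod_beta)
  then obtain a b where ab: "K' \<subseteq> box a b"
    using bounded_subset_box_symmetric compact_imp_bounded by metis
  have shift: "f (x + h *\<^sub>R i) = 0" if "x \<notin> box a b" "0 \<le> h" "h \<le> 1" for x h
  proof (rule K(2), rule)
    assume "x + h *\<^sub>R i \<in> K"
    then have "x \<in> K'" unfolding K'_def using that
      by (intro image_eqI[of _ _ "(x + h *\<^sub>R i, h)"]) auto
    then show False using ab that by auto
  qed
  have int: "(LINT x:box a b|lborel. f (x + h *\<^sub>R i)) = (LINT x|lborel. f x)" if "0 \<le> h" "h < 1" for h
  proof -
    have "(LINT x:box a b|lborel. f (x + h *\<^sub>R i)) = (LINT x|lborel. f (x + h *\<^sub>R i))"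
      unfolding set_lebesgue_integral_def
      by (rule Bochner_Integration.integral_cong) (use shift that in \<open>auto split: split_indicator\<close>)
    then show ?thesis using integral_translate[OF mf] by simp
  qed
  have "(LINT x:box a b|lborel. partial_deriv i f x) = 0"
    by (rule integral_partial_deriv_box_eq_0[OF f i, of 1]) (use int int[of 0] in auto)
  moreover have "partial_deriv i f x = 0" if "x \<notin> box a b" for x
  proof -
    have "K \<subseteq> K'" unfolding K'_def by (auto intro!: image_eqI[of _ _ "(_, 0)"])
    then have "partial_deriv i f x = partial_deriv i (\<lambda>x. 0) x"
      using K that ab by (intro partial_deriv_cong[of "- K"]) (auto simp: open_Compl compact_imp_closed)
    then show ?thesis by (simp add: partial_deriv_const)
  qed
  ultimately show ?thesis unfolding set_lebesgue_integral_def
    by (subst (asm) Bochner_Integration.integral_cong[OF refl, of _ _ "partial_deriv i f"])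
      (auto split: split_indicator)
qed

text \<open>Needed to trade an open box for a half-open slab, which differs from it by a
  face.\<close>

lemma AE_lborel_hyperplane:
  assumes "i \<in> Basis"
  shows "AE x in lborel. x \<bullet> i \<noteq> (c::real)"
proof -
  have "{x::'a. x \<bullet> i = c} \<in> null_sets lebesgue"
    using negligible_standard_hyperplane[OF assms] negligible_iff_null_sets by blast
  then have "{x::'a. x \<bullet> i = c} \<in> null_sets lborel"
    by (auto simp: null_sets_def)
  then show ?thesis using AE_not_in by fastforce
qed

text \<open>Shifting the box along \<open>i\<close> loses a slab at the face of \<open>a\<close> and
  gains one beyond the face of \<open>b\<close>; these are one period apart, so the integral is
  unchanged.\<close>

lemma integral_partial_deriv_periodic:
  fixes f :: "'a::euclidean_space \<Rightarrow> real"
  assumes f: "Ck 1 UNIV f" and i: "i \<in> Basis" and ab: "a \<bullet> i < b \<bullet> i"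
    and per: "\<And>x. f (x + ((b - a) \<bullet> i) *\<^sub>R i) = f x"
  shows "(LINT x:box a b|lborel. partial_deriv i f x) = 0"
proof (rule integral_partial_deriv_box_eq_0[OF f i])
  define L where "L = (b - a) \<bullet> i"
  show "0 < L" using ab by (simp add: L_def inner_diff_left)
  fix h assume h: "0 < h" "h < L"
  have mf: "f \<in> borel_measurable borel"
    using f by (intro borel_measurable_continuous_onI Ck_imp_continuous_on)
  define P where "P x \<longleftrightarrow> (\<forall>j\<in>Basis - {i}. a \<bullet> j < x \<bullet> j \<and> x \<bullet> j < b \<bullet> j)" for x
  \<comment> \<open>Half-open along \<open>i\<close>, so that consecutive slabs are disjoint and
    their union is again a slab.\<close>
  define S where "S u v = {x. P x \<and> u \<le> x \<bullet> i \<and> x \<bullet> i < v}" for u v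
  have Pshift: "P (x + s *\<^sub>R i) \<longleftrightarrow> P x" for x s
    using i by (auto simp: P_def inner_add_left inner_Basis)
  have S_meas: "S u v \<in> sets borel" for u v
    unfolding S_def P_def by measurable
  have S_int: "set_integrable lborel (S u v) f" for u v
  proof -
    have "S u v \<subseteq> cbox (a + (u - a \<bullet> i) *\<^sub>R i) (b + (v - b \<bullet> i) *\<^sub>R i)"
      using i by (auto simp: S_def P_def mem_box inner_add_left inner_Basis less_imp_le)
    moreover have "set_integrable lborel (cbox c d) f" for c d
      unfolding set_integrable_def using Ck_imp_continuous_on[OF f]
      by (intro borel_integrable_compact) (auto intro: continuous_on_subset)
    ultimately show ?thesis
      using S_meas by (intro set_integrable_subset[of lborel _ f "S u v"]) auto
  qed
  have shiftS: "(LINT x:S u v|lborel. f (x + s *\<^sub>R i)) = (LINT x:S (u + s) (v + s)|lborel. f x)" for u v s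
  proof -
    have "(LINT x|lborel. indicator (S (u+s) (v+s)) x *\<^sub>R f x) =
      (LINT x|lborel. indicator (S (u+s) (v+s)) (x + s *\<^sub>R i) *\<^sub>R f (x + s *\<^sub>R i))"
      using S_meas mf by (intro integral_translate[symmetric]) auto
    also have "\<dots> = (LINT x|lborel. indicator (S u v) x *\<^sub>R f (x + s *\<^sub>R i))"
      using i by (intro Bochner_Integration.integral_cong)
        (auto split: split_indicator simp: S_def Pshift inner_add_left)
    finally show ?thesis by (simp add: set_lebesgue_integral_def)
  qed
  have splitS: "(LINT x:S u w|lborel. f x) = (LINT x:S u v|lborel. f x) + (LINT x:S v w|lborel. f x)"
    if "u \<le> v" "v \<le> w" for u v w
  proof -
    have "S u w = S u v \<union> S v w" "S u v \<inter> S v w = {}" using that by (auto simp: S_def)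
    then show ?thesis using set_integral_Un S_int by metis
  qed
  have boxS: "(LINT x:box a b|lborel. g x) = (LINT x:S (a \<bullet> i) (b \<bullet> i)|lborel. g x)"
    if "g \<in> borel_measurable borel" for g :: "'a \<Rightarrow> real"
  proof (rule set_integral_cong_set)
    have "x \<in> box a b \<longleftrightarrow> x \<in> S (a \<bullet> i) (b \<bullet> i)" if "x \<bullet> i \<noteq> a \<bullet> i" for x
      using that i by (force simp: S_def P_def mem_box)
    then show "AE x in lborel. (x \<in> S (a \<bullet> i) (b \<bullet> i)) = (x \<in> box a b)"
      using AE_lborel_hyperplane[OF i, of "a \<bullet> i"] by (auto elim!: eventually_mono)
  qed (use that S_meas in \<open>auto simp: set_borel_measurable_def\<close>)
  have "(LINT x:box a b|lborel. f (x + h *\<^sub>R i)) = (LINT x:S (a \<bullet> i + h) (b \<bullet> i + h)|lborel. f x)"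
    using mf by (simp add: boxS shiftS)
  also have "\<dots> = (LINT x:S (a \<bullet> i + h) (b \<bullet> i)|lborel. f x) + (LINT x:S (b \<bullet> i) (b \<bullet> i + h)|lborel. f x)"
    using h by (intro splitS) (auto simp: L_def inner_diff_left)
  also have "(LINT x:S (b \<bullet> i) (b \<bullet> i + h)|lborel. f x) = (LINT x:S (a \<bullet> i) (a \<bullet> i + h)|lborel. f (x + L *\<^sub>R i))"
    by (simp add: shiftS L_def inner_diff_left add.commute)
  also have "\<dots> = (LINT x:S (a \<bullet> i) (a \<bullet> i + h)|lborel. f x)" by (simp add: per L_def)
  also have "(LINT x:S (a \<bullet> i + h) (b \<bullet> i)|lborel. f x) + \<dots> = (LINT x:S (a \<bullet> i) (b \<bullet> i)|lborel. f x)"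
    using h splitS[of "a \<bullet> i" "a \<bullet> i + h" "b \<bullet> i"] by (simp add: L_def inner_diff_left)
  finally show "(LINT x:box a b|lborel. f (x + h *\<^sub>R i)) = (LINT x:box a b|lborel. f x)"
    using mf by (simp add: boxS)
qed

section \<open>The divergence theorem for tangential fields\<close>

lemma DERIV_max_square: "((\<lambda>s. (max 0 s)\<^sup>2) has_real_derivative 2 * max 0 s) (at (s::real))"
proof (cases s "0::real" rule: linorder_cases)
  case less
  then show ?thesis
    by - (rule has_field_derivative_transform_within_open[of "\<lambda>_. 0" _ s "{..<0}"], auto)
next
  case greater
  then show ?thesis
    by - (rule has_field_derivative_transform_within_open[of "\<lambda>s. s\<^sup>2" _ s "{0<..}"],
        auto intro!: derivative_eq_intros)
next
  case equal
  have "((\<lambda>h. (max 0 h)\<^sup>2 / h) \<longlongrightarrow> 0) (at (0::real))"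
  proof (rule Lim_null_comparison)
    show "\<forall>\<^sub>F h in at (0::real). norm ((max 0 h)\<^sup>2 / h) \<le> \<bar>h\<bar>"
      by (rule always_eventually) (auto simp: max_def power2_eq_square)
    show "((\<lambda>h. \<bar>h\<bar>) \<longlongrightarrow> 0) (at (0::real))"
      by (rule tendsto_rabs_zero) (rule tendsto_ident_at)
  qed
  then show ?thesis using equal by (simp add: DERIV_def)
qed

lemma Ck1_realI:
  fixes g :: "real \<Rightarrow> real"
  assumes "\<And>x. (g has_real_derivative g' x) (at x)" "continuous_on UNIV g'"
  shows "Ck 1 UNIV g" and "partial_deriv 1 g = g'"
proof -
  show *: "partial_deriv 1 g = g'"
  proof
    show "partial_deriv 1 g x = g' x" for x
      using partial_deriv_eqI[of g "times (g' x)" x 1] assms(1)[of x] by (simp add: has_field_derivative_def)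
  qed
  have "g differentiable (at x)" for x
    using assms(1)[of x] by (auto simp: has_field_derivative_def differentiable_def)
  then show "Ck 1 UNIV g" using * assms(2) by simp
qed

text \<open>A quotient p / (p + q) in which p vanishes for t \<le> 1 and q for t \<ge> 2, never
  both. Only of class C^1 in spite of the name: squared positive parts are simple C^1 ingredients,
  and a cutoff is differentiated once.\<close>

definition smooth_step :: "real \<Rightarrow> real" where
  "smooth_step t = (max 0 (t - 1))\<^sup>2 / ((max 0 (t - 1))\<^sup>2 + (max 0 (2 - t))\<^sup>2)"

lemma smooth_step_denominator: "0 < (max 0 (t - 1))\<^sup>2 + (max 0 (2 - t))\<^sup>2" for t :: real
proof (cases "t < 2")
  case True
  then show ?thesis by (intro add_nonneg_pos) auto
next
  case False
  then show ?thesis by (intro add_pos_nonneg) auto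
qed

lemma smooth_step_eq_0: "t \<le> 1 \<Longrightarrow> smooth_step t = 0"
  by (simp add: smooth_step_def)

lemma smooth_step_eq_1: "2 \<le> t \<Longrightarrow> smooth_step t = 1"
  by (simp add: smooth_step_def)

lemma smooth_step_abs_le_1: "\<bar>smooth_step t\<bar> \<le> 1"
  using smooth_step_denominator[of t] by (simp add: smooth_step_def divide_le_eq)

lemma Ck_smooth_step: "Ck 1 UNIV smooth_step"
proof (rule Ck1_realI(1))
  let ?q = "\<lambda>s::real. (max 0 s)\<^sup>2"
  have q1: "((\<lambda>t. ?q (t - 1)) has_real_derivative 2 * max 0 (t - 1) * 1) (at t)" for t
    by (rule DERIV_chain2[OF DERIV_max_square]) (auto intro!: derivative_eq_intros)
  have q2: "((\<lambda>t. ?q (2 - t)) has_real_derivative 2 * max 0 (2 - t) * (-1)) (at t)" for t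
    by (rule DERIV_chain2[OF DERIV_max_square]) (auto intro!: derivative_eq_intros)
  have nz: "?q (t - 1) + ?q (2 - t) \<noteq> 0" for t
    using smooth_step_denominator[of t] by linarith
  show "(smooth_step has_real_derivative
     (2 * max 0 (t - 1) * 1 * (?q (t - 1) + ?q (2 - t)) -
      ?q (t - 1) * (2 * max 0 (t - 1) * 1 + 2 * max 0 (2 - t) * (-1))) /
     ((?q (t - 1) + ?q (2 - t)) * (?q (t - 1) + ?q (2 - t)))) (at t)" for t
    unfolding smooth_step_def[abs_def] by (rule DERIV_divide[OF q1 DERIV_add[OF q1 q2] nz])
  show "continuous_on UNIV (\<lambda>t. (2 * max 0 (t - 1) * 1 * (?q (t - 1) + ?q (2 - t)) -
      ?q (t - 1) * (2 * max 0 (t - 1) * 1 + 2 * max 0 (2 - t) * (-1))) /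
     ((?q (t - 1) + ?q (2 - t)) * (?q (t - 1) + ?q (2 - t))))"
    using nz by (intro continuous_intros) auto
qed

lemma smooth_step_differentiable: "smooth_step differentiable (at t)"
  using Ck_smooth_step by simp

lemma partial_deriv_smooth_step_eq_0:
  assumes "t < 1 \<or> 2 < t"
  shows "partial_deriv 1 smooth_step t = 0"
  using assms
proof
  assume "t < 1"
  then have "partial_deriv 1 smooth_step t = partial_deriv 1 (\<lambda>_. 0) t"
    by (intro partial_deriv_cong[of "{..<1}"]) (auto simp: smooth_step_eq_0)
  then show ?thesis by (simp add: partial_deriv_const)
next
  assume "2 < t"
  then have "partial_deriv 1 smooth_step t = partial_deriv 1 (\<lambda>_. 1) t"
    by (intro partial_deriv_cong[of "{2<..}"]) (auto simp: smooth_step_eq_1)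
  then show ?thesis by (simp add: partial_deriv_const)
qed

lemma bounded_continuous_on_compact:
  fixes f :: "'a::topological_space \<Rightarrow> real"
  assumes "compact K" "continuous_on K f"
  obtains M where "0 \<le> M" "\<And>x. x \<in> K \<Longrightarrow> \<bar>f x\<bar> \<le> M"
proof -
  have "bounded (f ` K)" using assms compact_continuous_image compact_imp_bounded by blast
  then obtain M where "\<And>x. x \<in> K \<Longrightarrow> \<bar>f x\<bar> \<le> M" unfolding bounded_iff by auto
  then have "\<And>x. x \<in> K \<Longrightarrow> \<bar>f x\<bar> \<le> \<bar>M\<bar>" by (meson abs_ge_self order_trans)
  then show ?thesis using that[of "\<bar>M\<bar>"] by simp
qed

text \<open>Rescaling the argument by c makes the derivative of the cutoff of size c, but derivative
  times argument is invariant under scaling. This product is what remains when the cutoff meets a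
  normal component O(\<rho>), so the bound is uniform in the width of the layer.\<close>

lemma smooth_step_deriv_bound: obtains B where "0 \<le> B" "\<And>t. \<bar>partial_deriv 1 smooth_step t * t\<bar> \<le> B"
proof -
  have "continuous_on {1..2} (\<lambda>t. partial_deriv 1 smooth_step t * t)"
    using Ck_smooth_step by (auto intro!: continuous_intros intro: continuous_on_subset)
  then obtain B where B: "0 \<le> B" "\<And>t. t \<in> {1..2} \<Longrightarrow> \<bar>partial_deriv 1 smooth_step t * t\<bar> \<le> B"
    using bounded_continuous_on_compact[of "{1..2::real}"] by blast
  then have "\<bar>partial_deriv 1 smooth_step t * t\<bar> \<le> B" for t
    using partial_deriv_smooth_step_eq_0[of t] by (cases "t \<in> {1..2}") auto
  then show ?thesis using that B(1) by blast
qed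

section \<open>Divergence of C^1 fields and the boundary layer\<close>

definition divergence :: "('a::euclidean_space \<Rightarrow> 'a) \<Rightarrow> 'a \<Rightarrow> real" where
  "divergence F x = (\<Sum>i\<in>Basis. partial_deriv i (\<lambda>y. F y \<bullet> i) x)"

definition C1_field :: "'a::euclidean_space set \<Rightarrow> ('a \<Rightarrow> 'a) \<Rightarrow> bool" where
  "C1_field U F \<longleftrightarrow> (\<forall>i\<in>Basis. Ck 1 U (\<lambda>x. F x \<bullet> i))"

lemma C1_field_differentiable: "C1_field U F \<Longrightarrow> x \<in> U \<Longrightarrow> i \<in> Basis \<Longrightarrow> (\<lambda>y. F y \<bullet> i) differentiable (at x)"
  by (auto simp: C1_field_def)

lemma continuous_on_divergence: "C1_field U F \<Longrightarrow> continuous_on U (divergence F)"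
  unfolding divergence_def by (auto simp: C1_field_def intro!: continuous_intros)

lemma divergence_cong:
  "open U \<Longrightarrow> x \<in> U \<Longrightarrow> (\<And>y. y \<in> U \<Longrightarrow> F y = G y) \<Longrightarrow> divergence F x = divergence G x"
  unfolding divergence_def by (intro sum.cong partial_deriv_cong[of U]) auto

lemma divergence_zero: "divergence (\<lambda>x. 0) x = 0"
  by (simp add: divergence_def partial_deriv_const)

lemma C1_field_scaleR: "open U \<Longrightarrow> Ck 1 U b \<Longrightarrow> C1_field U F \<Longrightarrow> C1_field U (\<lambda>x. b x *\<^sub>R F x)"
  unfolding C1_field_def using Ck_mult[of U 1 b] by (auto simp del: Ck.simps One_nat_def)

lemma divergence_scaleR:
  assumes "b differentiable (at x)" "C1_field U F" "x \<in> U"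
  shows "divergence (\<lambda>y. b y *\<^sub>R F y) x = grad b x \<bullet> F x + b x * divergence F x"
proof -
  have "divergence (\<lambda>y. b y *\<^sub>R F y) x =
     (\<Sum>i\<in>Basis. partial_deriv i b x * (F x \<bullet> i) + b x * partial_deriv i (\<lambda>y. F y \<bullet> i) x)"
    unfolding divergence_def
    using assms(1) C1_field_differentiable[OF assms(2,3)] by (intro sum.cong) (auto simp: partial_deriv_mult)
  moreover have "grad b x \<bullet> F x = (\<Sum>i\<in>Basis. partial_deriv i b x * (F x \<bullet> i))"
    unfolding grad_def inner_sum_left inner_scaleR_left by (simp add: inner_commute[of _ "F x"])
  ultimately show ?thesis
    by (simp add: sum.distrib sum_distrib_left divergence_def)
qed

lemma Ck_Un: "open U \<Longrightarrow> open W \<Longrightarrow> Ck k U f \<Longrightarrow> Ck k W f \<Longrightarrow> Ck k (U \<union> W) f"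
  by (induction k arbitrary: f) (auto intro: continuous_on_open_Un)

lemma set_lebesgue_integral_sum:
  fixes f :: "'i \<Rightarrow> 'a \<Rightarrow> real"
  assumes "\<And>i. i \<in> I \<Longrightarrow> set_integrable M A (f i)"
  shows "(LINT x:A|M. \<Sum>i\<in>I. f i x) = (\<Sum>i\<in>I. LINT x:A|M. f i x)"
  using assms unfolding set_integrable_def set_lebesgue_integral_def scaleR_sum_right
  by (rule Bochner_Integration.integral_sum)

text \<open>\<open>K\<close> confines the field to one chart \<open>U\<close>, so one \<rho>
  suffices. The cut-off field has compact support inside the domain and extends by zero, so the
  compact support case applies to it; dominated convergence removes the cutoff. The constant \<rho>
  = -1 gives the interior case.\<close>

lemma divergence_integral_cutoff:
  fixes \<Omega> :: "'a::euclidean_space set"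
  assumes \<Omega>: "open \<Omega>" "bounded \<Omega>" and V: "open V" "closure \<Omega> \<subseteq> V" and F: "C1_field V F"
    and U: "open U" "Ck 1 U \<rho>" "\<Omega> \<inter> U = {x \<in> U. \<rho> x < 0}" and K: "compact K" "K \<subseteq> U"
    and F0: "\<And>x. x \<in> \<Omega> \<Longrightarrow> x \<notin> K \<Longrightarrow> F x = 0"
    and bd: "0 \<le> C" "\<And>x. x \<in> \<Omega> \<Longrightarrow> x \<in> K \<Longrightarrow> \<bar>grad \<rho> x \<bullet> F x\<bar> \<le> C * \<bar>\<rho> x\<bar>"
  shows "(LINT x:\<Omega>|lborel. divergence F x) = 0"
proof -
  define c where "c n = real (Suc n)" for n
  have c: "0 < c n" for n by (simp add: c_def)
  define \<eta> where "\<eta> n x = smooth_step (- c n * \<rho> x)" for n x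
  define Fn where "Fn n x = (if x \<in> \<Omega> \<inter> U then \<eta> n x *\<^sub>R F x else 0)" for n x
  \<comment> \<open>The cutoff vanishes where \<rho> > -1 / c n, so this compact set carries the
    support of \<open>Fn n\<close>.\<close>
  define Kn where "Kn n = {x \<in> K. \<rho> x \<le> - 1 / c n}" for n
  have op: "open (\<Omega> \<inter> U)" using \<Omega> U by blast
  have sub: "\<Omega> \<inter> U \<subseteq> V" using V closure_subset by blast
  have cont_\<rho>: "continuous_on U \<rho>" using Ck_imp_continuous_on[OF U(2)] .
  have Kn_compact: "compact (Kn n)" for n
  proof -
    have "closed (K \<inter> \<rho> -` {..- 1 / c n})"
      using K cont_\<rho> by (intro continuous_closed_preimage) (auto intro: continuous_on_subset compact_imp_closed)
    then have "compact (K \<inter> (K \<inter> \<rho> -` {..- 1 / c n}))" using K by blast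
    moreover have "K \<inter> (K \<inter> \<rho> -` {..- 1 / c n}) = Kn n" by (auto simp: Kn_def)
    ultimately show ?thesis by simp
  qed
  have Kn_sub: "Kn n \<subseteq> \<Omega> \<inter> U" for n
  proof -
    have "- 1 / c n < 0" using c[of n] by simp
    then have "\<rho> x < 0" if "x \<in> Kn n" for x using that unfolding Kn_def by (blast intro: order_le_less_trans)
    then show ?thesis unfolding U(3) using K by (auto simp: Kn_def)
  qed
  have Fn_0: "Fn n x = 0" if "x \<notin> Kn n" for n x
  proof (cases "x \<in> \<Omega> \<inter> U \<and> x \<in> K")
    case True
    then have "- 1 / c n < \<rho> x" using that by (auto simp: Kn_def)
    then have "- c n * \<rho> x \<le> 1" using c[of n] by (simp add: field_simps)
    then show ?thesis by (simp add: Fn_def \<eta>_def smooth_step_eq_0)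
  qed (auto simp: Fn_def F0)
  have \<eta>_Ck: "Ck 1 (\<Omega> \<inter> U) (\<eta> n)" for n
    unfolding \<eta>_def[abs_def]
    by (rule Ck_compose[OF op Ck_cmult[OF op Ck_subset[OF U(2)]] Ck_smooth_step]) simp
  have Fn_C1: "C1_field UNIV (Fn n)" for n
    unfolding C1_field_def
  proof
    fix i :: 'a assume i: "i \<in> Basis"
    have opK: "open (- Kn n)" using Kn_compact compact_imp_closed by blast
    have "Ck 1 (\<Omega> \<inter> U) (\<lambda>x. \<eta> n x * (F x \<bullet> i))"
      using F i sub unfolding C1_field_def by (intro Ck_mult[OF op] \<eta>_Ck) (blast intro: Ck_subset)
    then have "Ck 1 (\<Omega> \<inter> U) (\<lambda>x. Fn n x \<bullet> i)"
      by (subst Ck_cong[OF op]) (auto simp: Fn_def)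
    moreover have "Ck 1 (- Kn n) (\<lambda>x. Fn n x \<bullet> i)"
      by (subst Ck_cong[OF opK, of _ "\<lambda>x. 0"]) (simp add: Fn_0, rule Ck_const)
    \<comment> \<open>The product formula is C^1 on one open set and the zero function on the other;
      they cover the space because the support stays inside the first.\<close>
    ultimately have "Ck 1 (\<Omega> \<inter> U \<union> - Kn n) (\<lambda>x. Fn n x \<bullet> i)"
      using op opK by (intro Ck_Un)
    moreover have "\<Omega> \<inter> U \<union> - Kn n = UNIV" using Kn_sub by blast
    ultimately show "Ck 1 UNIV (\<lambda>x. Fn n x \<bullet> i)" by metis
  qed
  have int0: "(LINT x:\<Omega>|lborel. divergence (Fn n) x) = 0" for n
  proof -
    have "(LINT x:\<Omega>|lborel. partial_deriv i (\<lambda>y. Fn n y \<bullet> i) x) = 0" if i: "i \<in> Basis" for i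
    proof -
      have "partial_deriv i (\<lambda>y. Fn n y \<bullet> i) x = 0" if "x \<notin> \<Omega>" for x
      proof -
        have "partial_deriv i (\<lambda>y. Fn n y \<bullet> i) x = partial_deriv i (\<lambda>y. 0) x"
          by (rule partial_deriv_cong[of "- Kn n"])
            (use Fn_0 Kn_sub that compact_imp_closed[OF Kn_compact] in \<open>auto intro: open_Compl\<close>)
        then show ?thesis by (simp add: partial_deriv_const)
      qed
      then have "(LINT x:\<Omega>|lborel. partial_deriv i (\<lambda>y. Fn n y \<bullet> i) x) = (LINT x|lborel. partial_deriv i (\<lambda>y. Fn n y \<bullet> i) x)"
        unfolding set_lebesgue_integral_def by (intro Bochner_Integration.integral_cong) (auto split: split_indicator)
      also have "\<dots> = 0"
        using Fn_C1 i by (intro integral_partial_deriv_compact_support[of _ i "Kn n"])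
          (auto simp: C1_field_def Fn_0 Kn_compact simp del: Ck.simps One_nat_def)
      finally show ?thesis .
    qed
    moreover have "set_integrable lborel \<Omega> (partial_deriv i (\<lambda>y. Fn n y \<bullet> i))" if "i \<in> Basis" for i
    proof -
      have "continuous_on UNIV (partial_deriv i (\<lambda>y. Fn n y \<bullet> i))"
        using Fn_C1 that by (auto simp: C1_field_def)
      then show ?thesis
        using \<Omega> by (intro set_integrable_bounded_open) (auto intro: continuous_on_subset)
    qed
    ultimately show ?thesis
      unfolding divergence_def by (subst set_lebesgue_integral_sum) auto
  qed
  obtain B where B: "0 \<le> B" "\<And>t. \<bar>partial_deriv 1 smooth_step t * t\<bar> \<le> B"
    using smooth_step_deriv_bound by blast
  have cdF: "continuous_on V (divergence F)" using F by (rule continuous_on_divergence)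
  obtain M where M: "0 \<le> M" "\<And>x. x \<in> closure \<Omega> \<Longrightarrow> \<bar>divergence F x\<bar> \<le> M"
    using bounded_continuous_on_compact[of "closure \<Omega>" "divergence F"] cdF V \<Omega>
    by (metis compact_closure continuous_on_subset)
  have div_in: "divergence (Fn n) x =
      partial_deriv 1 smooth_step (- c n * \<rho> x) * (- c n) * (grad \<rho> x \<bullet> F x) + \<eta> n x * divergence F x"
    if x: "x \<in> \<Omega> \<inter> U" for n x
  proof -
    have \<rho>: "\<rho> differentiable (at x)" using U x by auto
    have "divergence (Fn n) x = divergence (\<lambda>y. \<eta> n y *\<^sub>R F y) x"
      using x by (intro divergence_cong[OF op]) (auto simp: Fn_def)
    also have "\<dots> = grad (\<eta> n) x \<bullet> F x + \<eta> n x * divergence F x"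
      using x F sub by (intro divergence_scaleR Ck_differentiable[OF \<eta>_Ck]) auto
    also have "grad (\<eta> n) x = partial_deriv 1 smooth_step (- c n * \<rho> x) *\<^sub>R grad (\<lambda>x. - c n * \<rho> x) x"
      unfolding \<eta>_def[abs_def] using \<rho>
      by (intro grad_compose smooth_step_differentiable) (auto intro!: derivative_intros)
    also have "grad (\<lambda>x. - c n * \<rho> x) x = (- c n) *\<^sub>R grad \<rho> x"
      using grad_mult[of "\<lambda>_. - c n" x \<rho>] \<rho> by (simp add: grad_const)
    finally show ?thesis by simp
  qed
  have div_out: "divergence (Fn n) x = 0" "divergence F x = 0" if x: "x \<in> \<Omega>" "x \<notin> U" for n x
  proof -
    have o: "open (\<Omega> - K)" using \<Omega> K compact_imp_closed by blast
    have "divergence (Fn n) x = divergence (\<lambda>_. 0) x"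
      by (rule divergence_cong[OF o]) (use x K F0 in \<open>auto simp: Fn_def\<close>)
    moreover have "divergence F x = divergence (\<lambda>_. 0) x"
      by (rule divergence_cong[OF o]) (use x K F0 in auto)
    ultimately show "divergence (Fn n) x = 0" "divergence F x = 0" by (auto simp: divergence_zero)
  qed
  have "(\<lambda>n. LINT x:\<Omega>|lborel. divergence (Fn n) x) \<longlonglongrightarrow> (LINT x:\<Omega>|lborel. divergence F x)"
  proof (rule set_integral_tendsto_bounded[OF \<Omega>])
    show "continuous_on \<Omega> (divergence (Fn n))" for n
      using continuous_on_divergence[OF Fn_C1] by (rule continuous_on_subset) simp
    show "continuous_on \<Omega> (divergence F)"
      using cdF by (rule continuous_on_subset) (use V closure_subset in blast)
    show "\<bar>divergence (Fn n) x\<bar> \<le> B * C + M" if x: "x \<in> \<Omega>" for n x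
    proof (cases "x \<in> U")
      case True
      \<comment> \<open>In terms of this scaled depth, the factor \<open>c n\<close> from the cutoff
        and the factor |\<rho>| from \<open>bd\<close> combine to |t|.\<close>
      define t where "t = - c n * \<rho> x"
      have "\<bar>grad \<rho> x \<bullet> F x\<bar> \<le> C * \<bar>\<rho> x\<bar>" using bd F0 x by (cases "x \<in> K") auto
      then have "\<bar>partial_deriv 1 smooth_step t * (- c n) * (grad \<rho> x \<bullet> F x)\<bar> \<le>
          \<bar>partial_deriv 1 smooth_step t\<bar> * c n * (C * \<bar>\<rho> x\<bar>)"
        using c[of n] by (simp add: abs_mult mult_left_mono)
      also have "\<dots> = \<bar>partial_deriv 1 smooth_step t * t\<bar> * C"
        using c[of n] by (simp add: t_def abs_mult)
      also have "\<dots> \<le> B * C" using B(2) bd(1) by (intro mult_right_mono)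
      finally have 1: "\<bar>partial_deriv 1 smooth_step t * (- c n) * (grad \<rho> x \<bullet> F x)\<bar> \<le> B * C" .
      have "\<bar>\<eta> n x\<bar> * \<bar>divergence F x\<bar> \<le> 1 * M"
        using M x closure_subset[of \<Omega>] by (intro mult_mono) (auto simp: \<eta>_def smooth_step_abs_le_1)
      then have 2: "\<bar>\<eta> n x * divergence F x\<bar> \<le> M" by (simp add: abs_mult)
      have "divergence (Fn n) x = partial_deriv 1 smooth_step t * (- c n) * (grad \<rho> x \<bullet> F x) + \<eta> n x * divergence F x"
        using div_in[of x n] x True unfolding t_def by blast
      then show ?thesis using 1 2 by linarith
    next
      case False
      then show ?thesis using div_out(1)[OF x, of n] B bd M by simp
    qed
    show "(\<lambda>n. divergence (Fn n) x) \<longlonglongrightarrow> divergence F x" if x: "x \<in> \<Omega>" for x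
    proof (cases "x \<in> U")
      case True
      then have neg: "\<rho> x < 0" using U(3) x by blast
      \<comment> \<open>A fixed interior point is eventually on the plateau of the cutoff, so the
        sequence is eventually constant there.\<close>
      obtain N where N: "real N > 2 / - \<rho> x" using reals_Archimedean2 by blast
      have "divergence (Fn n) x = divergence F x" if "N \<le> n" for n
      proof -
        have "2 / - \<rho> x < c n" using N that by (simp add: c_def)
        then have "2 < - c n * \<rho> x" using neg by (simp add: field_simps)
        then show ?thesis using div_in[of x n] x True
          by (simp add: partial_deriv_smooth_step_eq_0 \<eta>_def smooth_step_eq_1)
      qed
      then show ?thesis by (intro tendsto_eventually) (auto simp: eventually_sequentially)
    next
      case False
      then show ?thesis using div_out[OF x] by simp
    qed
  qed
  then show ?thesis by (simp add: int0 LIMSEQ_const_iff)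
qed

section \<open>Boundary points, the outward normal and tangential fields\<close>

lemma frontier_level_zero:
  fixes \<Omega> :: "'a::euclidean_space set"
  assumes "open \<Omega>" "p \<in> frontier \<Omega>" "local_defining_function \<Omega> p U \<rho>"
  shows "\<rho> p = 0"
proof -
  have U: "open U" "p \<in> U" "\<And>k. Ck k U \<rho>" "\<Omega> \<inter> U = {x \<in> U. \<rho> x < 0}"
    using assms(3) unfolding local_defining_function_def by blast+
  have cont: "continuous_on U \<rho>" using U(3)[of 0] by simp
  have "p \<notin> \<Omega>" using assms by (simp add: frontier_def interior_open)
  then have "\<not> \<rho> p < 0" using U by blast
  moreover have "\<not> 0 < \<rho> p"
  proof
    assume "0 < \<rho> p"
    have "open (U \<inter> \<rho> -` {0<..})" using U(1) cont by (intro continuous_open_preimage) auto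
    moreover have "p \<in> U \<inter> \<rho> -` {0<..}" using \<open>0 < \<rho> p\<close> U(2) by simp
    moreover have "p \<in> closure \<Omega>" using assms by (simp add: frontier_def)
    ultimately have "(U \<inter> \<rho> -` {0<..}) \<inter> \<Omega> \<noteq> {}"
      using open_Int_closure_eq_empty by blast
    then obtain y where "y \<in> \<Omega> \<inter> U" "0 < \<rho> y" by auto
    then show False unfolding U(4) by simp
  qed
  ultimately show ?thesis by linarith
qed

lemma local_defining_function_differentiable:
  "local_defining_function \<Omega> p U \<rho> \<Longrightarrow> x \<in> U \<Longrightarrow> \<rho> differentiable (at x)"
  unfolding local_defining_function_def by (metis Ck.simps(2))

text \<open>If the unit normals differ, their difference is a direction in which the first function
  decreases and the second increases. A short way along it a point is inside by the first function
  and outside by the second. This makes the \<open>THE\<close> in \<open>outward_normal\<close>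
  denote.\<close>

lemma local_defining_function_grad_unique:
  fixes \<Omega> :: "'a::euclidean_space set"
  assumes "open \<Omega>" "p \<in> frontier \<Omega>"
    and d: "local_defining_function \<Omega> p U1 \<rho>1" "local_defining_function \<Omega> p U2 \<rho>2"
  shows "grad \<rho>1 p /\<^sub>R norm (grad \<rho>1 p) = grad \<rho>2 p /\<^sub>R norm (grad \<rho>2 p)"
proof (rule ccontr)
  define w1 w2 where "w1 = grad \<rho>1 p" and "w2 = grad \<rho>2 p"
  define v where "v = w2 /\<^sub>R norm w2 - w1 /\<^sub>R norm w1"
  assume ne: "grad \<rho>1 p /\<^sub>R norm (grad \<rho>1 p) \<noteq> grad \<rho>2 p /\<^sub>R norm (grad \<rho>2 p)"
  have U: "open U1" "open U2" "p \<in> U1" "p \<in> U2" "\<Omega> \<inter> U1 = {x \<in> U1. \<rho>1 x < 0}"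
      "\<Omega> \<inter> U2 = {x \<in> U2. \<rho>2 x < 0}" "w1 \<noteq> 0" "w2 \<noteq> 0"
    using d unfolding local_defining_function_def w1_def w2_def by blast+
  have zero: "\<rho>1 p = 0" "\<rho>2 p = 0" using frontier_level_zero[OF assms(1,2)] d by auto
  define u1 u2 where "u1 = w1 /\<^sub>R norm w1" and "u2 = w2 /\<^sub>R norm w2"
  have norms: "norm u1 = 1" "norm u2 = 1" using U by (auto simp: u1_def u2_def)
  have "u1 \<noteq> u2" using ne by (simp add: u1_def u2_def w1_def w2_def)
  then have "0 < (u2 - u1) \<bullet> (u2 - u1)" by simp
  also have "\<dots> = 2 - 2 * (u1 \<bullet> u2)"
    using norms by (simp add: inner_diff_left inner_diff_right inner_commute norm_eq_1)
  finally have u: "u1 \<bullet> u2 < 1" by simp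
  have w: "w1 = norm w1 *\<^sub>R u1" "w2 = norm w2 *\<^sub>R u2" using U by (auto simp: u1_def u2_def)
  have v_eq: "v = u2 - u1" by (simp add: v_def u1_def u2_def)
  have "u1 \<bullet> v < 0" "0 < u2 \<bullet> v"
    using u norms by (auto simp: v_eq inner_diff_right inner_commute norm_eq_1)
  then have neg: "w1 \<bullet> v < 0" and pos: "0 < w2 \<bullet> v"
    using U by (subst w, auto simp: mult_less_0_iff zero_less_mult_iff)+
  have der1: "((\<lambda>s. \<rho>1 (p + s *\<^sub>R v)) has_real_derivative w1 \<bullet> v) (at 0)" and der2:
    "((\<lambda>s. \<rho>2 (p + s *\<^sub>R v)) has_real_derivative w2 \<bullet> v) (at 0)"
    using DERIV_line[of \<rho>1 p 0 v] DERIV_line[of \<rho>2 p 0 v] U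
      local_defining_function_differentiable[OF d(1)] local_defining_function_differentiable[OF d(2)]
    by (auto simp: w1_def w2_def)
  obtain d1 where d1: "0 < d1" "\<And>h. 0 < h \<Longrightarrow> h < d1 \<Longrightarrow> \<rho>1 (p + h *\<^sub>R v) < 0"
    using DERIV_neg_dec_right[OF der1 neg] zero by auto
  obtain d2 where d2: "0 < d2" "\<And>h. 0 < h \<Longrightarrow> h < d2 \<Longrightarrow> 0 < \<rho>2 (p + h *\<^sub>R v)"
    using DERIV_pos_inc_right[OF der2 pos] zero by auto
  have "open ((\<lambda>s. p + s *\<^sub>R v) -` (U1 \<inter> U2))"
    using U by (intro open_vimage continuous_intros) auto
  moreover have "0 \<in> (\<lambda>s. p + s *\<^sub>R v) -` (U1 \<inter> U2)" using U by simp
  ultimately obtain e where "0 < e" "\<forall>s. dist s 0 < e \<longrightarrow> s \<in> (\<lambda>s. p + s *\<^sub>R v) -` (U1 \<inter> U2)"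
    unfolding open_dist by blast
  then have e: "0 < e" "\<And>s. \<bar>s\<bar> < e \<Longrightarrow> p + s *\<^sub>R v \<in> U1 \<inter> U2"
    by auto
  define h where "h = min e (min d1 d2) / 2"
  have "0 < h" "h < d1" "h < d2" "h < e" using e d1 d2 by (auto simp: h_def)
  then have "p + h *\<^sub>R v \<in> U1 \<inter> U2" "\<rho>1 (p + h *\<^sub>R v) < 0" "0 < \<rho>2 (p + h *\<^sub>R v)"
    using d1 d2 e by auto
  moreover from this have "\<rho>2 (p + h *\<^sub>R v) < 0" using U(5,6) by blast
  ultimately show False by simp
qed

lemma outward_normal_eq:
  fixes \<Omega> :: "'a::euclidean_space set"
  assumes "open \<Omega>" "p \<in> frontier \<Omega>" "local_defining_function \<Omega> p U \<rho>"
  shows "outward_normal \<Omega> p = grad \<rho> p /\<^sub>R norm (grad \<rho> p)"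
  unfolding outward_normal_def
proof (rule the_equality)
  show "\<exists>U \<rho>'. local_defining_function \<Omega> p U \<rho>' \<and>
      grad \<rho> p /\<^sub>R norm (grad \<rho> p) = grad \<rho>' p /\<^sub>R norm (grad \<rho>' p)"
    using assms by blast
qed (use local_defining_function_grad_unique[OF assms(1,2)] assms(3) in blast)

definition tangential :: "'a::euclidean_space set \<Rightarrow> ('a \<Rightarrow> 'a) \<Rightarrow> bool" where
  "tangential \<Omega> F \<longleftrightarrow> (\<forall>p\<in>frontier \<Omega>. F p \<bullet> outward_normal \<Omega> p = 0)"

text \<open>Near a boundary point, moving along \<open>grad \<rho> p\<close> from \<open>x \<in> \<Omega>\<close> reaches the zero set of
  \<open>\<rho>\<close> within a distance comparable to \<open>\<bar>\<rho> x\<bar>\<close>, and \<open>grad \<rho> \<bullet> F\<close> vanishes there.\<close>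

lemma tangential_normal_component_bound:
  fixes \<Omega> :: "'a::euclidean_space set"
  assumes \<Omega>: "open \<Omega>" "bounded \<Omega>" and p: "p \<in> frontier \<Omega>" and ldf: "local_defining_function \<Omega> p U \<rho>"
  obtains S where "0 < S" "cball p S \<subseteq> U"
    "\<And>V F. open V \<Longrightarrow> closure \<Omega> \<subseteq> V \<Longrightarrow> C1_field V F \<Longrightarrow> tangential \<Omega> F \<Longrightarrow>
      \<exists>C\<ge>0. \<forall>x\<in>\<Omega> \<inter> cball p S. \<bar>grad \<rho> x \<bullet> F x\<bar> \<le> C * \<bar>\<rho> x\<bar>"
proof -
  have U: "open U" "p \<in> U" "\<And>k. Ck k U \<rho>" "\<And>x. x \<in> U \<Longrightarrow> grad \<rho> x \<noteq> 0" "\<Omega> \<inter> U = {x \<in> U. \<rho> x < 0}"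
    using ldf unfolding local_defining_function_def by blast+
  have d\<rho>: "\<rho> differentiable (at x)" if "x \<in> U" for x
    using that local_defining_function_differentiable[OF ldf] by blast
  define w where "w = grad \<rho> p"
  \<comment> \<open>Half the slope of \<rho> at \<open>p\<close> along \<open>w\<close>: by
    continuity a lower bound for the slope on a ball around \<open>p\<close>.\<close>
  define c where "c = (w \<bullet> w) / 2"
  have w: "w \<noteq> 0" using U by (simp add: w_def)
  then have c: "0 < c" "c < w \<bullet> w" by (auto simp: c_def)
  have cont: "continuous_on U (\<lambda>x. grad \<rho> x \<bullet> w)"
    using continuous_on_grad[OF U(3)] by (intro continuous_intros)
  have "open (U \<inter> (\<lambda>x. grad \<rho> x \<bullet> w) -` {c<..})"
    using U cont by (intro continuous_open_preimage) auto
  moreover have "p \<in> U \<inter> (\<lambda>x. grad \<rho> x \<bullet> w) -` {c<..}" using U c by (simp add: w_def)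
  ultimately obtain R where R: "0 < R" "cball p R \<subseteq> U \<inter> (\<lambda>x. grad \<rho> x \<bullet> w) -` {c<..}"
    using open_contains_cball by blast
  then have R_U: "\<And>x. x \<in> cball p R \<Longrightarrow> x \<in> U" and R_c: "\<And>x. x \<in> cball p R \<Longrightarrow> c \<le> grad \<rho> x \<bullet> w"
    by (auto intro: less_imp_le)
  \<comment> \<open>Starting in the half ball and moving along \<open>w\<close> for a time at most
    \<open>T\<close>, one stays in the ball of radius \<open>R\<close>.\<close>
  define S where "S = R / 2"
  define T where "T = S / norm w"
  have S: "0 < S" "S \<le> R" and T: "0 < T" using R w by (auto simp: S_def T_def)
  have line: "x + s *\<^sub>R w \<in> cball p R" if "x \<in> cball p S" "0 \<le> s" "s \<le> T" for x s
  proof -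
    have "dist p (x + s *\<^sub>R w) \<le> dist p x + norm (s *\<^sub>R w)"
      using dist_triangle[of p "x + s *\<^sub>R w" x] by (simp add: dist_norm)
    also have "\<dots> \<le> S + T * norm w"
      using that by (intro add_mono) (auto intro: mult_right_mono)
    also have "\<dots> = R" using w by (simp add: T_def S_def)
    finally show ?thesis by simp
  qed
  have growth: "c * (t - s) \<le> \<rho> (x + t *\<^sub>R w) - \<rho> (x + s *\<^sub>R w)"
    if x: "x \<in> cball p S" and st: "0 \<le> s" "s < t" "t \<le> T" for x s t
  proof -
    have "\<exists>z>s. z < t \<and> \<rho> (x + t *\<^sub>R w) - \<rho> (x + s *\<^sub>R w) = (t - s) * (grad \<rho> (x + z *\<^sub>R w) \<bullet> w)"
      using st by (intro MVT2 DERIV_line d\<rho> R_U line x) auto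
    then obtain z where z: "s < z" "z < t"
      "\<rho> (x + t *\<^sub>R w) - \<rho> (x + s *\<^sub>R w) = (t - s) * (grad \<rho> (x + z *\<^sub>R w) \<bullet> w)" by blast
    have "c \<le> grad \<rho> (x + z *\<^sub>R w) \<bullet> w" using z st by (intro R_c line x) auto
    then show ?thesis using z st by (simp add: mult.commute mult_left_mono)
  qed
  have "\<exists>C\<ge>0. \<forall>x\<in>\<Omega> \<inter> cball p S. \<bar>grad \<rho> x \<bullet> F x\<bar> \<le> C * \<bar>\<rho> x\<bar>"
    if V: "open V" "closure \<Omega> \<subseteq> V" and F: "C1_field V F" and tan: "tangential \<Omega> F" for V F
  proof -
    define G where "G x = (\<Sum>i\<in>Basis. partial_deriv i \<rho> x * (F x \<bullet> i))" for x
    have G_eq: "G x = grad \<rho> x \<bullet> F x" for x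
      unfolding grad_def inner_sum_left inner_scaleR_left G_def by (simp add: inner_commute[of _ "F x"])
    have op: "open (U \<inter> V)" using U V by blast
    have G: "Ck 1 (U \<inter> V) G"
      unfolding G_def[abs_def]
    proof (intro Ck_sum Ck_mult op)
      fix i :: 'a assume i: "i \<in> Basis"
      show "Ck 1 (U \<inter> V) (partial_deriv i \<rho>)"
        using Ck_partial_deriv[OF U(3)[of "Suc 1"] i] by (rule Ck_subset) simp
      have "Ck 1 V (\<lambda>x. F x \<bullet> i)" using F i unfolding C1_field_def by blast
      then show "Ck 1 (U \<inter> V) (\<lambda>x. F x \<bullet> i)" by (rule Ck_subset) simp
    qed simp
    define A where "A = closure \<Omega> \<inter> cball p R"
    have A: "compact A" "A \<subseteq> U \<inter> V"
      using R V \<Omega> by (auto simp: A_def intro!: compact_Int_closed)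
    obtain M where M: "0 \<le> M" "\<And>x. x \<in> A \<Longrightarrow> \<bar>G x\<bar> \<le> M"
      using bounded_continuous_on_compact[OF A(1) continuous_on_subset[OF Ck_imp_continuous_on[OF G] A(2)]]
      by blast
    have "continuous_on A (\<lambda>x. grad G x \<bullet> w)"
      using continuous_on_subset[OF continuous_on_grad[OF G] A(2)] by (intro continuous_intros)
    then obtain L where L: "0 \<le> L" "\<And>x. x \<in> A \<Longrightarrow> \<bar>grad G x \<bullet> w\<bar> \<le> L"
      using bounded_continuous_on_compact[OF A(1)] by blast
    have "\<bar>G x\<bar> \<le> (M / (c * T) + L / c) * \<bar>\<rho> x\<bar>" if x: "x \<in> \<Omega>" "x \<in> cball p S" for x
    proof -
      have xA: "x \<in> A" using x S closure_subset[of \<Omega>] by (auto simp: A_def)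
      have neg: "\<rho> x < 0" using U(5) x R_U S by force
      show ?thesis
      proof (cases "\<rho> (x + T *\<^sub>R w) \<ge> 0")
        \<comment> \<open>If \<rho> is still negative at time \<open>T\<close>, then |\<rho> x| was
          at least c T, and plain boundedness of \<open>G\<close> is enough.\<close>
        case False
        have "c * T \<le> \<bar>\<rho> x\<bar>" using growth[OF x(2), of 0 T] False neg T by simp
        then have "M / (c * T) * (c * T) \<le> M / (c * T) * \<bar>\<rho> x\<bar>"
          using M c T by (intro mult_left_mono) auto
        then have "\<bar>G x\<bar> \<le> M / (c * T) * \<bar>\<rho> x\<bar>" using M(2)[OF xA] c T by simp
        moreover have "0 \<le> L / c * \<bar>\<rho> x\<bar>" using L c by simp
        ultimately show ?thesis by (simp add: distrib_right)
      next
        case True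
        have "continuous_on {0..T} (\<lambda>s. \<rho> (x + s *\<^sub>R w))"
          using DERIV_isCont[OF DERIV_line[OF d\<rho>[OF R_U[OF line[OF x(2)]]]]]
          by (intro continuous_at_imp_continuous_on) simp
        then obtain s where s: "0 \<le> s" "s \<le> T" "\<rho> (x + s *\<^sub>R w) = 0"
          using IVT'[of "\<lambda>s. \<rho> (x + s *\<^sub>R w)" 0 0 T] neg True T by auto
        have "s \<noteq> 0" using s neg by auto
        then have s0: "0 < s" using s by simp
        define y where "y = x + s *\<^sub>R w"
        \<comment> \<open>\<rho> grows along the segment, so the points before its end stay in
          \<Omega>; hence the whole segment lies in \<open>A\<close>, where the bounds were
          taken.\<close>
        have inside: "x + r *\<^sub>R w \<in> \<Omega>" if "0 \<le> r" "r < s" for r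
        proof -
          have "c * (s - r) \<le> - \<rho> (x + r *\<^sub>R w)" using growth[OF x(2), of r s] that s by simp
          moreover have "0 < c * (s - r)" using c that by simp
          ultimately have "\<rho> (x + r *\<^sub>R w) < 0" by linarith
          moreover have "x + r *\<^sub>R w \<in> U" using that s x by (intro R_U line) auto
          ultimately show ?thesis using U(5) by blast
        qed
        have "(\<lambda>r. x + r *\<^sub>R w) ` closure {0..<s} \<subseteq> closure \<Omega>"
          using inside closure_subset[of \<Omega>]
          by (intro image_closure_subset) (auto intro!: continuous_intros)
        then have cl: "x + r *\<^sub>R w \<in> closure \<Omega>" if "0 \<le> r" "r \<le> s" for r
          using that s0 by (auto simp: image_subset_iff)
        have inA: "x + r *\<^sub>R w \<in> A" if "0 \<le> r" "r \<le> s" for r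
          using cl[OF that] line[OF x(2), of r] that s by (simp add: A_def)
        have yU: "y \<in> U" using inA[of s] s0 A by (auto simp: y_def)
        have "y \<notin> {x \<in> U. \<rho> x < 0}" using s by (simp add: y_def)
        then have "y \<notin> \<Omega>" using U(5) yU by blast
        then have y: "y \<in> frontier \<Omega>" using cl[of s] s0 \<Omega> by (simp add: y_def frontier_def interior_open)
        \<comment> \<open>The definition asks of the base point only that it lies in
          \<open>U\<close>, so the same chart serves at \<open>y\<close>.\<close>
        have "local_defining_function \<Omega> y U \<rho>" using ldf yU by (simp add: local_defining_function_def)
        from outward_normal_eq[OF \<Omega>(1) y this]
        have "grad \<rho> y = norm (grad \<rho> y) *\<^sub>R outward_normal \<Omega> y" using U(4)[OF yU] by simp
        from arg_cong[OF this, of "\<lambda>v. F y \<bullet> v"]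
        have "grad \<rho> y \<bullet> F y = norm (grad \<rho> y) * (F y \<bullet> outward_normal \<Omega> y)"
          unfolding inner_scaleR_right by (subst inner_commute)
        then have "G y = 0" using tan y by (simp add: tangential_def G_eq)
        moreover have "\<bar>G (x + s *\<^sub>R w) - G x\<bar> \<le> L * s"
        proof (rule line_difference_bound)
          fix r assume "0 \<le> r" "r \<le> s"
          then have "x + r *\<^sub>R w \<in> A" by (rule inA)
          then show "G differentiable at (x + r *\<^sub>R w)" "\<bar>grad G (x + r *\<^sub>R w) \<bullet> w\<bar> \<le> L"
            using Ck_differentiable[OF G] L(2) A(2) by blast+
        qed (use s0 in simp)
        ultimately have "\<bar>G x\<bar> \<le> L * s" by (simp add: y_def)
        also have "\<dots> \<le> L * (\<bar>\<rho> x\<bar> / c)"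
          using growth[OF x(2), of 0 s] s s0 neg c L by (intro mult_left_mono) (auto simp: field_simps)
        finally have "\<bar>G x\<bar> \<le> L / c * \<bar>\<rho> x\<bar>" by simp
        moreover have "0 \<le> M / (c * T) * \<bar>\<rho> x\<bar>" using M c T by simp
        ultimately show ?thesis by (simp add: distrib_right)
      qed
    qed
    moreover have "0 \<le> M / (c * T) + L / c" using M L c T by simp
    ultimately show ?thesis unfolding G_eq by blast
  qed
  moreover have "cball p S \<subseteq> U" using R S by fastforce
  ultimately show ?thesis using that S(1) by blast
qed

text \<open>The radius depends on the point alone: compactness fixes the balls first, and the field
  is cut into pieces for them afterwards.\<close>

lemma divergence_integral_local:
  fixes \<Omega> :: "'a::euclidean_space set"
  assumes \<Omega>: "smooth_bounded_domain \<Omega>" and p: "p \<in> closure \<Omega>"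
  obtains S where "0 < S" "\<And>V F. open V \<Longrightarrow> closure \<Omega> \<subseteq> V \<Longrightarrow> C1_field V F \<Longrightarrow> tangential \<Omega> F \<Longrightarrow>
      (\<And>x. x \<in> \<Omega> \<Longrightarrow> x \<notin> cball p S \<Longrightarrow> F x = 0) \<Longrightarrow> (LINT x:\<Omega>|lborel. divergence F x) = 0"
proof (cases "p \<in> \<Omega>")
  case True
  have op: "open \<Omega>" "bounded \<Omega>" using \<Omega> by (auto simp: smooth_bounded_domain_def)
  then obtain S where S: "0 < S" "cball p S \<subseteq> \<Omega>" using True open_contains_cball by blast
  \<comment> \<open>An interior point uses the chart \<Omega> itself with the constant function -1,
    whose zero gradient makes the bound trivial.\<close>
  have "(LINT x:\<Omega>|lborel. divergence F x) = 0"
    if F: "open V" "closure \<Omega> \<subseteq> V" "C1_field V F" "tangential \<Omega> F"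
      "\<And>x. x \<in> \<Omega> \<Longrightarrow> x \<notin> cball p S \<Longrightarrow> F x = 0" for V F
    by (rule divergence_integral_cutoff[OF op F(1-3) op(1) Ck_const[of 1 \<Omega> "-1"] _ compact_cball S(2) F(5), of 0])
      (simp_all add: grad_const)
  then show ?thesis by (rule that[OF S(1)])
next
  case False
  have op: "open \<Omega>" "bounded \<Omega>" using \<Omega> by (auto simp: smooth_bounded_domain_def)
  have fr: "p \<in> frontier \<Omega>" using p False op by (simp add: frontier_def interior_open)
  then obtain U \<rho> where ldf: "local_defining_function \<Omega> p U \<rho>"
    using \<Omega> unfolding smooth_bounded_domain_def by blast
  then have U: "open U" "Ck 1 U \<rho>" "\<Omega> \<inter> U = {x \<in> U. \<rho> x < 0}"
    unfolding local_defining_function_def by blast+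
  obtain S where S: "0 < S" "cball p S \<subseteq> U"
    and bd: "\<And>V F. open V \<Longrightarrow> closure \<Omega> \<subseteq> V \<Longrightarrow> C1_field V F \<Longrightarrow> tangential \<Omega> F \<Longrightarrow>
      \<exists>C\<ge>0. \<forall>x\<in>\<Omega> \<inter> cball p S. \<bar>grad \<rho> x \<bullet> F x\<bar> \<le> C * \<bar>\<rho> x\<bar>"
    using tangential_normal_component_bound[OF op fr ldf] by blast
  have "(LINT x:\<Omega>|lborel. divergence F x) = 0"
    if F: "open V" "closure \<Omega> \<subseteq> V" "C1_field V F" "tangential \<Omega> F"
      "\<And>x. x \<in> \<Omega> \<Longrightarrow> x \<notin> cball p S \<Longrightarrow> F x = 0" for V F
  proof -
    obtain C where C: "0 \<le> C" "\<And>x. x \<in> \<Omega> \<Longrightarrow> x \<in> cball p S \<Longrightarrow> \<bar>grad \<rho> x \<bullet> F x\<bar> \<le> C * \<bar>\<rho> x\<bar>"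
      using bd[OF F(1-4)] by blast
    show ?thesis
      by (rule divergence_integral_cutoff[OF op F(1-3) U compact_cball S(2) F(5) C])
  qed
  then show ?thesis by (rule that[OF S(1)])
qed

text \<open>A partition of unity peeled off ball by ball: one cutoff splits the field into a part
  supported in a single ball, settled by the local statement, and a part vanishing on the half ball,
  which leaves one ball fewer. Multiplication by a function keeps a field tangential.\<close>

lemma divergence_theorem_tangential:
  fixes \<Omega> :: "'a::euclidean_space set"
  assumes \<Omega>: "smooth_bounded_domain \<Omega>" and V: "open V" "closure \<Omega> \<subseteq> V"
    and F: "C1_field V F" "tangential \<Omega> F"
  shows "(LINT x:\<Omega>|lborel. divergence F x) = 0"
proof -
  have op: "open \<Omega>" "bounded \<Omega>" using \<Omega> by (auto simp: smooth_bounded_domain_def)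
  define good where "good p S \<longleftrightarrow> 0 < S \<and> (\<forall>F. C1_field V F \<longrightarrow> tangential \<Omega> F \<longrightarrow>
      (\<forall>x\<in>\<Omega>. x \<notin> cball p S \<longrightarrow> F x = 0) \<longrightarrow> (LINT x:\<Omega>|lborel. divergence F x) = 0)" for p S
  have "\<exists>S. good p S" if pc: "p \<in> closure \<Omega>" for p
  proof -
    obtain S where "0 < S" "\<And>V F. open V \<Longrightarrow> closure \<Omega> \<subseteq> V \<Longrightarrow> C1_field V F \<Longrightarrow> tangential \<Omega> F \<Longrightarrow>
      (\<And>x. x \<in> \<Omega> \<Longrightarrow> x \<notin> cball p S \<Longrightarrow> F x = 0) \<Longrightarrow> (LINT x:\<Omega>|lborel. divergence F x) = 0"
      using divergence_integral_local[OF \<Omega> pc] by blast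
    then show ?thesis using V unfolding good_def by blast
  qed
  then obtain S where S: "\<And>p. p \<in> closure \<Omega> \<Longrightarrow> good p (S p)" by metis
  have "compact (closure \<Omega>)" using op by (simp add: compact_closure)
  \<comment> \<open>Half radii leave room for a cutoff between the ball of the cover and the ball
    where the local statement applies.\<close>
  moreover have "closure \<Omega> \<subseteq> (\<Union>p\<in>closure \<Omega>. ball p (S p / 2))"
    using S by (auto simp: good_def intro!: bexI)
  ultimately obtain J where J: "J \<subseteq> closure \<Omega>" "finite J" "closure \<Omega> \<subseteq> (\<Union>p\<in>J. ball p (S p / 2))"
    using compactE_image[of "closure \<Omega>" "closure \<Omega>" "\<lambda>p. ball p (S p / 2)"] by auto
  have intg: "set_integrable lborel \<Omega> (divergence F)" if "C1_field V F" for F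
    using continuous_on_subset[OF continuous_on_divergence[OF that] V(2)] op
    by (intro set_integrable_bounded_open)
  have "(LINT x:\<Omega>|lborel. divergence F x) = 0"
    if "finite J" "J \<subseteq> closure \<Omega>" "C1_field V F" "tangential \<Omega> F"
      "\<And>x. x \<in> \<Omega> \<Longrightarrow> x \<notin> (\<Union>p\<in>J. ball p (S p / 2)) \<Longrightarrow> F x = 0" for J F
    using that
  proof (induction J arbitrary: F rule: finite_induct)
    case empty
    have "divergence F x = 0" if "x \<in> \<Omega>" for x
      using divergence_cong[OF op(1) that, of F "\<lambda>_. 0"] empty by (simp add: divergence_zero)
    then have "(LINT x:\<Omega>|lborel. divergence F x) = (LINT x:\<Omega>|lborel. 0)"
      using op by (intro set_lebesgue_integral_cong) auto
    then show ?case by simp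
  next
    case (insert p J)
    have good: "good p (S p)" using S insert.prems by blast
    then have Sp: "0 < S p" by (simp add: good_def)
    \<comment> \<open>The scaled squared distance is 1 at radius \<open>S p / 2\<close>, where the
      profile is still 0, and 4 at radius \<open>S p\<close>, where it is 1. The square is smooth at
      the centre, unlike the distance.\<close>
    define b where "b x = smooth_step (4 / (S p)\<^sup>2 * ((x - p) \<bullet> (x - p)))" for x
    have b_Ck: "Ck 1 UNIV b"
    proof -
      have "Ck 1 UNIV (\<lambda>x. (x - p) \<bullet> i)" for i :: 'a
        using Ck_diff[OF open_UNIV Ck_inner[of 1 UNIV i] Ck_const[of 1 UNIV "p \<bullet> i"]]
        by (simp add: inner_diff_left)
      then have "Ck 1 UNIV (\<lambda>x. \<Sum>i\<in>Basis. ((x - p) \<bullet> i) * ((x - p) \<bullet> i))"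
        by (intro Ck_sum Ck_mult) (auto simp del: Ck.simps One_nat_def)
      then have "Ck 1 UNIV (\<lambda>x. (x - p) \<bullet> (x - p))"
        by (subst euclidean_inner)
      then show ?thesis unfolding b_def[abs_def]
        by (rule Ck_compose[OF open_UNIV Ck_cmult[OF open_UNIV] Ck_smooth_step])
    qed
    then have b_V: "Ck 1 V b" "Ck 1 V (\<lambda>x. 1 - b x)"
      using Ck_subset[OF b_Ck, of V] Ck_diff[OF V(1) Ck_const[of 1 V 1], of b]
      by (simp_all del: Ck.simps One_nat_def)
    have b_0: "b x = 0" if "x \<in> ball p (S p / 2)" for x
    proof -
      have "norm (x - p) \<le> S p / 2" using that by (simp add: dist_norm norm_minus_commute)
      then have "(norm (x - p))\<^sup>2 \<le> (S p / 2)\<^sup>2" by (intro power_mono) auto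
      then have "4 / (S p)\<^sup>2 * ((x - p) \<bullet> (x - p)) \<le> 1"
        using Sp by (simp add: power2_norm_eq_inner[symmetric] field_simps power2_eq_square)
      then show ?thesis by (simp add: b_def smooth_step_eq_0)
    qed
    have b_1: "b x = 1" if "x \<notin> cball p (S p)" for x
    proof -
      have "S p \<le> norm (x - p)" using that by (simp add: dist_norm norm_minus_commute)
      then have "(S p)\<^sup>2 \<le> (norm (x - p))\<^sup>2" using Sp by (intro power_mono) auto
      then have "4 \<le> 4 / (S p)\<^sup>2 * ((x - p) \<bullet> (x - p))"
        using Sp by (simp add: power2_norm_eq_inner[symmetric] field_simps)
      then show ?thesis by (simp add: b_def smooth_step_eq_1)
    qed
    define F1 where "F1 x = (1 - b x) *\<^sub>R F x" for x
    define F2 where "F2 x = b x *\<^sub>R F x" for x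
    have C1: "C1_field V F1" "C1_field V F2"
      unfolding F1_def[abs_def] F2_def[abs_def] using V b_V insert.prems by (auto intro: C1_field_scaleR)
    have tan: "tangential \<Omega> F1" "tangential \<Omega> F2"
      using insert.prems by (auto simp: tangential_def F1_def F2_def)
    have "(LINT x:\<Omega>|lborel. divergence F1 x) = 0"
      using good C1 tan b_1 unfolding good_def by (auto simp: F1_def)
    moreover have "(LINT x:\<Omega>|lborel. divergence F2 x) = 0"
    proof (rule insert.IH)
      show "F2 x = 0" if "x \<in> \<Omega>" "x \<notin> (\<Union>p\<in>J. ball p (S p / 2))" for x
        using insert.prems(4)[of x] that b_0[of x] by (auto simp: F2_def)
    qed (use insert.prems C1 tan in auto)
    moreover have "divergence F x = divergence F1 x + divergence F2 x" if "x \<in> \<Omega>" for x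
    proof -
      have xV: "x \<in> V" using that V closure_subset by blast
      have "divergence F x = (\<Sum>i\<in>Basis. partial_deriv i (\<lambda>y. F1 y \<bullet> i + F2 y \<bullet> i) x)"
        unfolding divergence_def F1_def F2_def by (simp add: left_diff_distrib)
      also have "\<dots> = divergence F1 x + divergence F2 x"
        using C1_field_differentiable[OF C1(1) xV] C1_field_differentiable[OF C1(2) xV]
        by (simp add: partial_deriv_add divergence_def sum.distrib)
      finally show ?thesis .
    qed
    then have "(LINT x:\<Omega>|lborel. divergence F x) = (LINT x:\<Omega>|lborel. divergence F1 x + divergence F2 x)"
      using op by (intro set_lebesgue_integral_cong) auto
    ultimately show ?case using intg C1 by (simp add: set_integral_add)
  qed
  then show ?thesis using J F closure_subset[of \<Omega>] by blast
qed

section \<open>Green's identity\<close>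

text \<open>The sets on which \<open>regular\<close> asks for class C^k. A periodic function is
  needed on the whole space, so only \<open>UNIV\<close> qualifies there; both geometries then share
  their regularity proofs.\<close>

primrec region_nbhd :: "'a::euclidean_space geometry \<Rightarrow> 'a set \<Rightarrow> bool" where
  "region_nbhd (Periodic_Box a b) U \<longleftrightarrow> U = UNIV"
| "region_nbhd (Neumann_Domain \<Omega>) U \<longleftrightarrow> open U \<and> closure \<Omega> \<subseteq> U"

lemma region_nbhd_open: "region_nbhd D U \<Longrightarrow> open U"
  and region_nbhd_closure: "region_nbhd D U \<Longrightarrow> closure (region D) \<subseteq> U"
  and region_nbhd_Int: "region_nbhd D U \<Longrightarrow> region_nbhd D W \<Longrightarrow> region_nbhd D (U \<inter> W)"
  by (cases D; auto)+

lemma region_nbhd_subset: "region_nbhd D U \<Longrightarrow> region D \<subseteq> U"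
  using region_nbhd_closure closure_subset by blast

lemma regular_iff: "regular k D f \<longleftrightarrow> (\<exists>U. region_nbhd D U \<and> Ck k U f)"
  by (cases D) auto

lemma regular2E:
  assumes "regular k D f" "regular l D g"
  obtains U where "region_nbhd D U" "open U" "closure (region D) \<subseteq> U" "Ck k U f" "Ck l U g"
proof -
  obtain U W where "region_nbhd D U" "Ck k U f" "region_nbhd D W" "Ck l W g"
    using assms unfolding regular_iff by blast
  then show ?thesis
    using that[of "U \<inter> W"] region_nbhd_Int[of D U W] region_nbhd_open[of D "U \<inter> W"]
      region_nbhd_closure[of D "U \<inter> W"]
      Ck_subset[of k U f "U \<inter> W"] Ck_subset[of l W g "U \<inter> W"] by simp
qed

lemma regular_mono: "regular m D f \<Longrightarrow> k \<le> m \<Longrightarrow> regular k D f"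
  unfolding regular_iff using Ck_mono by blast

lemma regular_const: "regular k D (\<lambda>x. c)"
  by (cases D) (auto simp: Ck_const)

lemma regular_add: "regular k D f \<Longrightarrow> regular k D g \<Longrightarrow> regular k D (\<lambda>x. f x + g x)"
  by (erule regular2E, assumption) (auto simp: regular_iff intro: Ck_add)

lemma regular_mult: "regular k D f \<Longrightarrow> regular k D g \<Longrightarrow> regular k D (\<lambda>x. f x * g x)"
  by (erule regular2E, assumption) (auto simp: regular_iff intro: Ck_mult)

lemma regular_cmult: "regular k D f \<Longrightarrow> regular k D (\<lambda>x. c * f x)"
  by (intro regular_mult regular_const)

lemma regular_compose: "regular k D f \<Longrightarrow> Ck k UNIV g \<Longrightarrow> regular k D (\<lambda>x. g (f x))"
  unfolding regular_iff using Ck_compose region_nbhd_open by blast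

lemma regular_laplacian: "regular (Suc (Suc k)) D f \<Longrightarrow> regular k D (laplacian f)"
  unfolding regular_iff using Ck_laplacian region_nbhd_open by blast

lemma regular_grad_inner:
  assumes "regular 1 D u" "regular 1 D v"
  shows "regular 0 D (\<lambda>x. grad u x \<bullet> grad v x)"
proof -
  obtain U where "region_nbhd D U" "Ck 1 U u" "Ck 1 U v" using assms by (rule regular2E)
  then have "region_nbhd D U" "Ck 0 U (\<lambda>x. grad u x \<bullet> grad v x)"
    using continuous_on_grad[of U u] continuous_on_grad[of U v] by (auto intro: continuous_on_inner)
  then show ?thesis unfolding regular_iff by blast
qed

lemma region_open: "valid_geometry D \<Longrightarrow> open (region D)"
  and region_bounded: "valid_geometry D \<Longrightarrow> bounded (region D)"
  and region_nonempty: "valid_geometry D \<Longrightarrow> region D \<noteq> {}"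
  by (cases D; auto simp: smooth_bounded_domain_def open_box bounded_box box_ne_empty)+

lemma regular_set_integrable:
  assumes "valid_geometry D" "regular k D f"
  shows "set_integrable lborel (region D) f"
proof -
  obtain U where U: "region_nbhd D U" "Ck k U f" using assms unfolding regular_iff by blast
  then have "continuous_on (closure (region D)) f"
    using Ck_imp_continuous_on continuous_on_subset region_nbhd_closure by blast
  then show ?thesis using assms region_open region_bounded by (intro set_integrable_bounded_open)
qed

section \<open>Stability of the boundary conditions\<close>

lemma normal_deriv_cong:
  "open U \<Longrightarrow> p \<in> U \<Longrightarrow> (\<And>x. x \<in> U \<Longrightarrow> f x = g x) \<Longrightarrow> normal_deriv \<Omega> f p = normal_deriv \<Omega> g p"
  unfolding normal_deriv_def grad_def using partial_deriv_cong[of U p f g] by simp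

lemma boundary_cond_cong:
  assumes "region_nbhd D U" "\<And>x. x \<in> U \<Longrightarrow> f x = g x" "boundary_cond D f"
  shows "boundary_cond D g"
proof (cases D)
  case (Neumann_Domain \<Omega>)
  then have "normal_deriv \<Omega> g p = normal_deriv \<Omega> f p" if "p \<in> frontier \<Omega>" for p
    using assms that by (intro normal_deriv_cong[of U]) (auto simp: frontier_def)
  then show ?thesis using assms Neumann_Domain by simp
qed (use assms in auto)

text \<open>One criterion for two kinds of boundary condition: the formula for the gradient serves
  the Neumann case, and dependence on the values of \<open>f\<close> and \<open>g\<close> alone
  serves the periodic one.\<close>

lemma boundary_cond_grad:
  assumes "region_nbhd D U" "Ck 1 U f" "Ck 1 U g" "boundary_cond D f" "boundary_cond D g"
    and "\<And>x. x \<in> U \<Longrightarrow> grad h x = a x *\<^sub>R grad f x + b x *\<^sub>R grad g x"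
    and "\<And>x y. f x = f y \<Longrightarrow> g x = g y \<Longrightarrow> h x = h y"
  shows "boundary_cond D h"
proof (cases D)
  case (Periodic_Box l u)
  then have "h (x + ((u - l) \<bullet> i) *\<^sub>R i) = h x" if "i \<in> Basis" for x i
    using assms(4,5) that by (intro assms(7)) auto
  then show ?thesis using Periodic_Box by simp
next
  case (Neumann_Domain \<Omega>)
  then have "normal_deriv \<Omega> h p = 0" if "p \<in> frontier \<Omega>" for p
  proof -
    have "p \<in> U" using assms(1) Neumann_Domain that by (auto simp: frontier_def)
    then show ?thesis using assms(4,5) assms(6)[of p] that Neumann_Domain
      by (simp add: normal_deriv_def inner_add_left)
  qed
  then show ?thesis using Neumann_Domain by simp
qed

lemma boundary_cond_lincomb:
  assumes "regular 1 D f" "regular 1 D g" "boundary_cond D f" "boundary_cond D g"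
  shows "boundary_cond D (\<lambda>x. a * f x + b * g x)"
proof -
  obtain U where U: "region_nbhd D U" "open U" "Ck 1 U f" "Ck 1 U g" using assms(1,2) by (rule regular2E)
  show ?thesis
  proof (rule boundary_cond_grad[OF U(1,3,4) assms(3,4)])
    fix x assume "x \<in> U"
    then have d: "f differentiable (at x)" "g differentiable (at x)"
      using U Ck_differentiable[of 1] by blast+
    then show "grad (\<lambda>x. a * f x + b * g x) x = a *\<^sub>R grad f x + b *\<^sub>R grad g x"
      by (rule grad_lincomb)
  qed simp
qed

lemma boundary_cond_compose:
  assumes "regular 1 D f" "boundary_cond D f" "Ck 1 UNIV g"
  shows "boundary_cond D (\<lambda>x. g (f x))"
proof -
  obtain U where U: "region_nbhd D U" "Ck 1 U f" using assms unfolding regular_iff by blast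
  show ?thesis
  proof (rule boundary_cond_grad[OF U(1,2,2) assms(2,2)])
    show "grad (\<lambda>x. g (f x)) x = partial_deriv 1 g (f x) *\<^sub>R grad f x + 0 *\<^sub>R grad f x" if "x \<in> U" for x
      using grad_compose[of f x g] U(2) assms(3) that by simp
  qed simp
qed

lemma boundary_cond_const: "boundary_cond D (\<lambda>x. c)"
  by (cases D) (auto simp: normal_deriv_def grad_const)

definition bc_regular :: "nat \<Rightarrow> 'a::euclidean_space geometry \<Rightarrow> ('a \<Rightarrow> real) \<Rightarrow> bool" where
  "bc_regular k D f \<longleftrightarrow> regular k D f \<and> boundary_cond D f"

lemma bc_regular_lincomb:
  "1 \<le> k \<Longrightarrow> bc_regular k D f \<Longrightarrow> bc_regular k D g \<Longrightarrow> bc_regular k D (\<lambda>x. a * f x + b * g x)"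
  unfolding bc_regular_def using regular_mono[of k D f 1] regular_mono[of k D g 1]
  by (simp add: regular_add regular_cmult boundary_cond_lincomb)

lemma bc_regular_diff:
  "1 \<le> k \<Longrightarrow> bc_regular k D f \<Longrightarrow> bc_regular k D g \<Longrightarrow> bc_regular k D (\<lambda>x. f x - g x)"
  using bc_regular_lincomb[of k D f g 1 "-1"] by simp

lemma bc_regular_const: "bc_regular k D (\<lambda>x. c)"
  by (simp add: bc_regular_def regular_const boundary_cond_const)

lemma partial_deriv_periodic:
  assumes "\<And>x. v (x + c) = v x" "v differentiable (at (x + c))"
  shows "partial_deriv i v (x + c) = partial_deriv i v x"
proof -
  have "(v has_derivative (\<lambda>h. grad v (x + c) \<bullet> h)) (at (x + c))" using has_derivative_grad[OF assms(2)] .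
  moreover have "((\<lambda>x. x + c) has_derivative (\<lambda>h. h)) (at x)" by (auto intro!: derivative_eq_intros)
  ultimately have "((\<lambda>x. v (x + c)) has_derivative (\<lambda>h. grad v (x + c) \<bullet> h)) (at x)"
    using has_derivative_compose[of "\<lambda>x. x + c" "\<lambda>h. h" x UNIV v] by blast
  then have "partial_deriv i v x = grad v (x + c) \<bullet> i" using assms(1) by (simp add: partial_deriv_eqI)
  then show ?thesis using partial_deriv_eqI[OF has_derivative_grad[OF assms(2)], of i] by simp
qed

section \<open>Integration by parts on both geometries\<close>

definition grad_inner :: "'a::euclidean_space set \<Rightarrow> ('a \<Rightarrow> real) \<Rightarrow> ('a \<Rightarrow> real) \<Rightarrow> real" where
  "grad_inner \<Omega> u v = (LINT x:\<Omega>|lborel. grad u x \<bullet> grad v x)"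

text \<open>Integrates the divergence of \<open>u\<close> times the gradient of \<open>v\<close>.
  This field is tangential when \<open>v\<close> has zero normal derivative, and periodic when
  \<open>u\<close> and \<open>v\<close> are.\<close>

lemma green_identity:
  assumes D: "valid_geometry D" and u: "bc_regular 1 D u" and v: "bc_regular 2 D v"
  shows "l2_inner (region D) u (laplacian v) = - grad_inner (region D) u v"
proof -
  define F where "F x = u x *\<^sub>R grad v x" for x
  obtain U where U: "region_nbhd D U" "open U" "closure (region D) \<subseteq> U" "Ck 1 U u" "Ck 2 U v"
    using u[unfolded bc_regular_def, THEN conjunct1] v[unfolded bc_regular_def, THEN conjunct1]
    by (rule regular2E)
  have v': "Ck 1 U (partial_deriv i v)" if "i \<in> Basis" for i
    using Ck_partial_deriv[of 1 U v i] U that by (simp add: numeral_2_eq_2)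
  have grad_field: "C1_field U (grad v)"
    unfolding C1_field_def by (auto simp: grad_inner_Basis v' simp del: Ck.simps One_nat_def)
  have F: "C1_field U F" unfolding F_def by (rule C1_field_scaleR[OF U(2,4) grad_field])
  have div: "divergence F x = grad u x \<bullet> grad v x + u x * laplacian v x" if "x \<in> U" for x
  proof -
    have "divergence F x = grad u x \<bullet> grad v x + u x * divergence (grad v) x"
      unfolding F_def by (rule divergence_scaleR[OF Ck_differentiable[OF U(4) _ that] grad_field that]) simp
    also have "divergence (grad v) x = laplacian v x"
      by (simp add: divergence_def laplacian_def grad_inner_Basis)
    finally show ?thesis .
  qed
  have zero: "(LINT x:region D|lborel. divergence F x) = 0"
  proof (cases D)
    case (Neumann_Domain \<Omega>)
    have "tangential \<Omega> F"
      using v Neumann_Domain by (auto simp: tangential_def F_def bc_regular_def normal_deriv_def)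
    then show ?thesis
      using divergence_theorem_tangential[of \<Omega> U F] D U F Neumann_Domain by simp
  next
    case (Periodic_Box a b)
    then have UU: "U = UNIV" using U by simp
    have int: "set_integrable lborel (box a b) (partial_deriv i (\<lambda>y. F y \<bullet> i))" if "i \<in> Basis" for i
      using F that UU by (intro set_integrable_bounded_open)
        (auto simp: C1_field_def intro: continuous_on_subset bounded_box)
    have "(LINT x:box a b|lborel. partial_deriv i (\<lambda>y. F y \<bullet> i) x) = 0" if i: "i \<in> Basis" for i
    proof (rule integral_partial_deriv_periodic)
      show "Ck 1 UNIV (\<lambda>y. F y \<bullet> i)" using F i UU unfolding C1_field_def by blast
      show "a \<bullet> i < b \<bullet> i" using D Periodic_Box i by simp
      have per: "u (x + ((b - a) \<bullet> i) *\<^sub>R i) = u x" "v (x + ((b - a) \<bullet> i) *\<^sub>R i) = v x" for x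
        using u v Periodic_Box i by (auto simp: bc_regular_def)
      have "partial_deriv i v (x + ((b - a) \<bullet> i) *\<^sub>R i) = partial_deriv i v x" for x
        using per(2) Ck_differentiable[OF U(5)] UU by (intro partial_deriv_periodic) auto
      then show "F (x + ((b - a) \<bullet> i) *\<^sub>R i) \<bullet> i = F x \<bullet> i" for x
        using per i by (simp add: F_def grad_inner_Basis)
    qed (use i in simp)
    then show ?thesis
      unfolding divergence_def using Periodic_Box int by (subst set_lebesgue_integral_sum) auto
  qed
  have "(LINT x:region D|lborel. divergence F x) =
      (LINT x:region D|lborel. grad u x \<bullet> grad v x + u x * laplacian v x)"
    using region_nbhd_subset[OF U(1)] region_open[OF D]
    by (intro set_lebesgue_integral_cong) (auto simp: div)
  also have "\<dots> = grad_inner (region D) u v + l2_inner (region D) u (laplacian v)"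
    unfolding grad_inner_def l2_inner_def
  proof (rule set_integral_add)
    have "regular 1 D v" "regular 0 D (laplacian v)" "regular 0 D u"
      using u v regular_mono[of _ D] regular_laplacian[of 0 D v] unfolding bc_regular_def
      by (auto simp: numeral_2_eq_2)
    then show "set_integrable lborel (region D) (\<lambda>x. grad u x \<bullet> grad v x)"
        "set_integrable lborel (region D) (\<lambda>x. u x * laplacian v x)"
      using regular_set_integrable[OF D regular_grad_inner] regular_set_integrable[OF D regular_mult] u
      unfolding bc_regular_def by blast+
  qed
  finally show ?thesis using zero by simp
qed

section \<open>The time-step ratio condition\<close>

text \<open>Turns the powers 3/2 into cubes of square roots, so that the later estimates are
  polynomial.\<close>

lemma powr_three_halves: "0 \<le> z \<Longrightarrow> z powr (3/2) = sqrt z ^ 3"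
  by (cases "z = 0") (simp, subst powr_half_sqrt[symmetric], simp, subst powr_power, auto)

lemma G_fun_diagonal_zero_iff:
  fixes \<sigma> z :: real
  assumes "0 < z"
  shows "G_fun \<sigma> z z = 0 \<longleftrightarrow> (2*\<sigma> - 1) * z powr (3/2) = 1 + 2 * \<sigma> * z"
proof -
  have "G_fun \<sigma> z z = 2 * (1 + 2 * \<sigma> * z - (2*\<sigma> - 1) * z powr (3/2)) / (1 + z)"
    using assms by (simp add: G_fun_def diff_divide_distrib[symmetric] algebra_simps)
  then show ?thesis using assms by auto
qed

text \<open>With y = sqrt z and k = 2\<sigma> - 1 the equation is k y^3 = 1 + (k + 1) y^2. Divided
  by y^2 it equates an increasing and a decreasing function, hence has at most one root; the
  \<open>THE\<close> in \<open>gamma_ss\<close> rests on this.\<close>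

lemma gamma_ss_root:
  assumes "1/2 < \<sigma>" "\<sigma> \<le> 1"
  obtains z where "gamma_ss \<sigma> = ereal z" "0 < z" "(2*\<sigma> - 1) * z powr (3/2) = 1 + 2 * \<sigma> * z"
proof -
  define k where "k = 2*\<sigma> - 1"
  have k: "0 < k" "2 * \<sigma> = k + 1" using assms by (auto simp: k_def)
  \<comment> \<open>At 3/k the difference is (27 - k^2 - 9 (k + 1)) / k^2, positive for k \<le> 1;
    the endpoint 2/k would fail at k = 1.\<close>
  have ex: "\<exists>y\<ge>0. y \<le> 3 / k \<and> k * y ^ 3 - (1 + (k+1) * y\<^sup>2) = 0"
  proof (rule IVT')
    have k1: "k \<le> 1" using assms by (simp add: k_def)
    have "k * (3/k)^3 - (1 + (k+1) * (3/k)\<^sup>2) = (27 - k\<^sup>2 - 9 * (k+1)) / k\<^sup>2"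
      using k by (simp add: field_simps power2_eq_square power3_eq_cube)
    moreover have "k\<^sup>2 \<le> 1" using k k1 by (simp add: power_le_one)
    ultimately show "0 \<le> k * (3/k)^3 - (1 + (k+1) * (3/k)\<^sup>2)"
      using k1 by simp
  qed (use k in \<open>auto intro!: continuous_intros\<close>)
  then obtain y where y: "0 \<le> y" "k * y ^ 3 = 1 + (k+1) * y\<^sup>2" by auto
  have y0: "0 < y" using y by (cases "y = 0") auto
  have uniq: "y1 = y2" if "0 < y1" "0 < y2" "k * y1 ^ 3 = 1 + (k+1) * y1\<^sup>2" "k * y2 ^ 3 = 1 + (k+1) * y2\<^sup>2"
    for y1 y2 :: real
  proof -
    have aux: "\<not> a < b" if "0 < a" "0 < b" "k * a ^ 3 = 1 + (k+1) * a\<^sup>2" "k * b ^ 3 = 1 + (k+1) * b\<^sup>2"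
      for a b :: real
    proof
      assume "a < b"
      have "k * a = 1 / a\<^sup>2 + (k + 1)" "k * b = 1 / b\<^sup>2 + (k + 1)"
        using that by (simp_all add: power3_eq_cube power2_eq_square divide_simps)
      moreover have "k * a < k * b" using \<open>a < b\<close> k by simp
      moreover have "1 / b\<^sup>2 < 1 / a\<^sup>2"
        using \<open>a < b\<close> that by (intro divide_strict_left_mono power_strict_mono) auto
      ultimately show False by linarith
    qed
    show ?thesis using aux[OF that(1,2,3,4)] aux[OF that(2,1,4,3)] by linarith
  qed
  have root_iff: "G_fun \<sigma> z z = 0 \<longleftrightarrow> k * sqrt z ^ 3 = 1 + (k+1) * (sqrt z)\<^sup>2" if "0 < z" for z
    unfolding G_fun_diagonal_zero_iff[OF that] k_def[symmetric] k(2) using that by (simp add: powr_three_halves)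
  have "(THE z. 0 < z \<and> G_fun \<sigma> z z = 0) = y\<^sup>2"
  proof (rule the_equality)
    have "sqrt (y\<^sup>2) = y" using y0 by simp
    then show "0 < y\<^sup>2 \<and> G_fun \<sigma> (y\<^sup>2) (y\<^sup>2) = 0" using y0 y(2) root_iff[of "y\<^sup>2"] by auto
    fix z assume z: "0 < z \<and> G_fun \<sigma> z z = 0"
    then have "k * sqrt z ^ 3 = 1 + (k+1) * (sqrt z)\<^sup>2" using root_iff[of z] by blast
    from uniq[OF _ y0 this y(2)] have "sqrt z = y" using z by simp
    moreover have "z = (sqrt z)\<^sup>2" using z by simp
    ultimately show "z = y\<^sup>2" by metis
  qed
  then have "gamma_ss \<sigma> = ereal (y\<^sup>2)" using assms by (simp add: gamma_ss_def)
  moreover have "(2*\<sigma> - 1) * (y\<^sup>2) powr (3/2) = 1 + 2 * \<sigma> * y\<^sup>2"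
    unfolding k_def[symmetric] k(2) using y y0 by (simp add: powr_three_halves)
  ultimately show ?thesis using that[of "y\<^sup>2"] y0 by simp
qed

text \<open>With \<open>b = (1 + 2 \<sigma> \<Gamma>) / (1 + \<Gamma>) \<le> 2\<close>, the numerator minus \<open>b (1 + s)\<close> is concave in \<open>s\<close>,
  nonnegative at \<open>0\<close> and zero at the root \<open>\<Gamma>\<close>; the last term of \<open>G_fun\<close> increases in \<open>z\<close>
  and equals \<open>b\<close> at \<open>\<Gamma>\<close>.\<close>

lemma G_fun_nonneg:
  assumes \<sigma>: "1/2 \<le> \<sigma>" "\<sigma> \<le> 1" and s: "0 < s" "ereal s \<le> gamma_ss \<sigma>" and z: "0 < z" "ereal z \<le> gamma_ss \<sigma>"
  shows "0 \<le> G_fun \<sigma> s z"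
proof (cases "\<sigma> = 1/2")
  case True
  show ?thesis using s unfolding True G_fun_def by simp
next
  case False
  then obtain \<Gamma> where \<Gamma>: "gamma_ss \<sigma> = ereal \<Gamma>" "0 < \<Gamma>" "(2*\<sigma> - 1) * \<Gamma> powr (3/2) = 1 + 2 * \<sigma> * \<Gamma>"
    using gamma_ss_root[of \<sigma>] \<sigma> by auto
  define k where "k = 2*\<sigma> - 1"
  have k: "0 \<le> k" "k \<le> 1" "2 * \<sigma> = k + 1" using \<sigma> by (auto simp: k_def)
  have le: "s \<le> \<Gamma>" "z \<le> \<Gamma>" using s z \<Gamma> by auto
  define b where "b = (1 + (k+1) * \<Gamma>) / (1 + \<Gamma>)"
  have b: "b \<le> 2" "b * (1 + \<Gamma>) = 1 + (k+1) * \<Gamma>"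
  proof -
    have "(k+1) * \<Gamma> \<le> 2 * \<Gamma>" using k \<Gamma>(2) by (intro mult_right_mono) auto
    then have "1 + (k+1) * \<Gamma> \<le> 1 + 2 * \<Gamma>" by (rule add_left_mono)
    also have "\<dots> \<le> 2 * (1 + \<Gamma>)" by simp
    finally have "1 + (k+1) * \<Gamma> \<le> 2 * (1 + \<Gamma>)" .
    then show "b \<le> 2" using \<Gamma>(2) by (simp add: b_def divide_le_eq)
  qed (use \<Gamma> in \<open>simp add: b_def\<close>)
  have root: "k * sqrt \<Gamma> ^ 3 = b * (1 + \<Gamma>)"
    using \<Gamma>(2,3) unfolding k_def[symmetric] k(3) b(2) by (simp add: powr_three_halves)
  have last: "k * z powr (3/2) / (1 + z) \<le> b"
  proof -
    \<comment> \<open>z^(3/2) / (1 + z) is increasing: with p \<le> q for the square roots and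
      denominators cleared, two pairs of monomials are compared.\<close>
    have "sqrt z ^ 3 * (1 + \<Gamma>) \<le> sqrt \<Gamma> ^ 3 * (1 + z)"
    proof -
      define p q where "p = sqrt z" and "q = sqrt \<Gamma>"
      have pq: "0 < p" "p \<le> q" "z = p\<^sup>2" "\<Gamma> = q\<^sup>2" using z le \<Gamma> by (auto simp: p_def q_def)
      have "p ^ 3 \<le> q ^ 3" using pq by (intro power_mono) auto
      moreover have "p ^ 2 * q ^ 2 * p \<le> p ^ 2 * q ^ 2 * q" using pq by (intro mult_left_mono) auto
      ultimately have "p ^ 3 + p ^ 2 * q ^ 2 * p \<le> q ^ 3 + p ^ 2 * q ^ 2 * q" by (rule add_mono)
      moreover have "p ^ 3 * (1 + q ^ 2) = p ^ 3 + p ^ 2 * q ^ 2 * p" "q ^ 3 * (1 + p ^ 2) = q ^ 3 + p ^ 2 * q ^ 2 * q"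
        by (simp_all add: algebra_simps power2_eq_square power3_eq_cube)
      moreover have "sqrt z = p" "sqrt \<Gamma> = q" by (simp_all add: p_def q_def)
      ultimately show ?thesis unfolding pq(3,4) by simp
    qed
    then have "k * (sqrt z ^ 3 * (1 + \<Gamma>)) \<le> k * (sqrt \<Gamma> ^ 3 * (1 + z))"
      using k by (intro mult_left_mono)
    also have "\<dots> = b * (1 + \<Gamma>) * (1 + z)" using root by (simp add: mult.assoc[symmetric])
    finally have "(k * sqrt z ^ 3) * (1 + \<Gamma>) \<le> (b * (1 + z)) * (1 + \<Gamma>)" by (simp add: algebra_simps)
    then have "k * sqrt z ^ 3 \<le> b * (1 + z)" using \<Gamma> by simp
    then show ?thesis using z by (simp add: powr_three_halves divide_le_eq)
  qed
  \<comment> \<open>Concavity in explicit form: s^(3/2) lies below its chord s sqrt \<Gamma>, and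
    after this replacement the right side minus the left, times \<Gamma>, is (2 - b) (\<Gamma> -
    s).\<close>
  have "b * (1 + s) \<le> 2 + 2 * (k+1) * s - k * s powr (3/2)"
  proof -
    have "sqrt s ^ 3 = s * sqrt s" using s by (simp add: power3_eq_cube)
    also have "\<dots> \<le> s * sqrt \<Gamma>" using s le by (intro mult_left_mono) auto
    finally have "k * sqrt s ^ 3 * \<Gamma> \<le> k * (s * sqrt \<Gamma>) * \<Gamma>"
      using k \<Gamma> by (intro mult_right_mono mult_left_mono) auto
    also have "\<dots> = s * (k * sqrt \<Gamma> ^ 3)" using \<Gamma> by (simp add: power3_eq_cube)
    also have "\<dots> = s * (b * (1 + \<Gamma>))" by (simp add: root)
    finally have "k * sqrt s ^ 3 * \<Gamma> \<le> s * (b * (1 + \<Gamma>))" .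
    moreover have "0 \<le> (2 - b) * (\<Gamma> - s)" using b le by simp
    moreover have "s * (b * (1 + \<Gamma>)) = s * (1 + (k+1) * \<Gamma>)" using b by simp
    ultimately have "(b * (1 + s)) * \<Gamma> \<le> (2 + 2 * (k+1) * s - k * sqrt s ^ 3) * \<Gamma>"
      by (simp add: algebra_simps)
    then show ?thesis using \<Gamma> s by (simp add: powr_three_halves)
  qed
  then have "b \<le> (2 + 2 * (k+1) * s - k * s powr (3/2)) / (1 + s)" using s by (simp add: le_divide_eq)
  moreover have \<sigma>s: "4 * \<sigma> * s = 2 * (k+1) * s" by (simp add: k_def)
  ultimately show ?thesis using last unfolding G_fun_def k_def[symmetric] \<sigma>s by simp
qed

text \<open>The numerical core common to both flows: \<open>Q0\<close> and \<open>Q1\<close> are the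
  squared norms of consecutive increments, \<open>B\<close> is their product in the same metric, and
  \<open>e0\<close>, \<open>e1\<close> are the energies without increment term. \<open>B\<close>
  enters through its Young bound, so the metric need not be named.\<close>

lemma weighted_increment_inequality:
  fixes \<sigma> \<tau> \<tau>' g g' Q0 Q1 B e0 e1 :: real
  assumes \<sigma>: "1/2 \<le> \<sigma>" and pos: "0 < \<tau>'" "0 < \<tau>" "g = \<tau> / \<tau>'" "0 < g'"
    and Q: "0 \<le> Q1" "\<And>s. 0 < s \<Longrightarrow> 2 * B \<le> s * Q0 + Q1 / s" and G: "0 \<le> G_fun \<sigma> g g'"
    and e: "e1 - e0 \<le> - ((1 + 2 * \<sigma> * g) / (1 + g) * Q1 - (2 * \<sigma> - 1) * g\<^sup>2 / (1 + g) * B) / \<tau>"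
  shows "(2 * \<sigma> - 1) * g' powr (3/2) / (2 + 2 * g') * (Q1 / \<tau>) + e1
    - ((2 * \<sigma> - 1) * g powr (3/2) / (2 + 2 * g) * (Q0 / \<tau>') + e0) \<le> 0"
proof -
  define q where "q = sqrt g"
  define k where "k = 2 * \<sigma> - 1"
  define P where "P = g' powr (3/2) / (1 + g')"
  have g: "0 < g" using pos by simp
  have q: "0 < q" "g = q\<^sup>2" "g powr (3/2) = q ^ 3" using g by (auto simp: q_def powr_three_halves)
  have k: "0 \<le> k" "2 * \<sigma> = k + 1" using \<sigma> by (auto simp: k_def)
  have \<tau>': "\<tau>' = \<tau> / g" using pos by simp
  have "2 * B \<le> q * Q0 + Q1 / q" using Q q by simp
  then have "q ^ 4 * (2 * B) \<le> q ^ 4 * (q * Q0 + Q1 / q)" using q by (intro mult_left_mono) auto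
  also have "\<dots> = q ^ 3 * (g * Q0 + Q1)"
    using q by (simp add: field_simps power2_eq_square power3_eq_cube power4_eq_xxxx)
  finally have "g\<^sup>2 * B \<le> q ^ 3 * (g * Q0 + Q1) / 2" by (simp add: q(2) power_mult[symmetric])
  then have "k / (1 + g) * (g\<^sup>2 * B) \<le> k / (1 + g) * (q ^ 3 * (g * Q0 + Q1) / 2)"
    using k g by (intro mult_left_mono) auto
  then have B: "k * g\<^sup>2 / (1 + g) * B \<le> k * q ^ 3 / (2 + 2 * g) * (g * Q0 + Q1)"
    using g by (simp add: field_simps)
  have H: "0 \<le> ((2 + 4 * \<sigma> * g - k * q ^ 3) / (1 + g) - k * P) * Q1"
    using mult_nonneg_nonneg[OF G Q(1)] unfolding G_fun_def k_def[symmetric] q(3) P_def by simp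
  then have Gq: "0 \<le> (1 + 2 * \<sigma> * g) / (1 + g) * Q1 - k * q ^ 3 / (2 + 2 * g) * Q1 - k * P / 2 * Q1"
  proof -
    define X Y where "X = (1 + 2 * \<sigma> * g) / (1 + g)" and "Y = q ^ 3 / (1 + g)"
    have "(2 + 4 * \<sigma> * g - k * q ^ 3) / (1 + g) = 2 * X - k * Y"
      by (simp add: X_def Y_def diff_divide_distrib add_divide_distrib)
    with H have "0 \<le> (2 * X - k * Y - k * P) * Q1" by simp
    moreover have Y: "k * q ^ 3 / (2 + 2 * g) = k * Y / 2" using g by (simp add: Y_def field_simps)
    ultimately show ?thesis unfolding X_def[symmetric] Y by (simp add: algebra_simps)
  qed
  have "k * P / 2 * Q1 - (1 + 2 * \<sigma> * g) / (1 + g) * Q1 + k * g\<^sup>2 / (1 + g) * B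
      - k * q ^ 3 / (2 + 2 * g) * (g * Q0) \<le> 0"
    using B Gq by (simp add: distrib_left)
  then have main: "(k * P / 2 * Q1 - (1 + 2 * \<sigma> * g) / (1 + g) * Q1 + k * g\<^sup>2 / (1 + g) * B
      - k * q ^ 3 / (2 + 2 * g) * (g * Q0)) / \<tau> \<le> 0"
    using pos by (simp add: divide_le_0_iff)
  have P: "(2 * \<sigma> - 1) * g' powr (3/2) / (2 + 2 * g') = k * P / 2"
    using pos by (simp add: k_def P_def field_simps)
  \<comment> \<open>This matches the increment term of the old energy with the \<open>Q0\<close>
    part of Young's inequality, so the two cancel exactly.\<close>
  have Q0: "Q0 / \<tau>' = g * Q0 / \<tau>" using \<tau>' by simp
  show ?thesis using main e unfolding P Q0 q(3) unfolding k_def[symmetric]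
    by (simp add: diff_divide_distrib add_divide_distrib)
qed

section \<open>The energy inequality\<close>

text \<open>The surplus is (\<sigma> - 1/2) |a - b|^2.\<close>

lemma inner_midpoint_ge:
  fixes a b :: "'b::real_inner"
  assumes "1/2 \<le> \<sigma>"
  shows "(a \<bullet> a - b \<bullet> b) / 2 \<le> (\<sigma> *\<^sub>R a + (1 - \<sigma>) *\<^sub>R b) \<bullet> (a - b)"
proof -
  have "(\<sigma> *\<^sub>R a + (1 - \<sigma>) *\<^sub>R b) \<bullet> (a - b) = (a \<bullet> a - b \<bullet> b) / 2 + (\<sigma> - 1/2) * ((a - b) \<bullet> (a - b))"
    by (simp add: inner_add_left inner_diff_left inner_diff_right inner_commute[of b a] field_simps)
  then show ?thesis using assms by simp
qed

lemma inner_weighted_le: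
  fixes a b :: "'b::real_inner"
  assumes "0 < s"
  shows "2 * (a \<bullet> b) \<le> s * (a \<bullet> a) + (b \<bullet> b) / s"
proof -
  have "0 \<le> ((s *\<^sub>R a - b) \<bullet> (s *\<^sub>R a - b)) / s" using assms by simp
  also have "\<dots> = s * (a \<bullet> a) + (b \<bullet> b) / s - 2 * (a \<bullet> b)"
    using assms by (simp add: inner_diff_left inner_diff_right inner_commute[of b a] field_simps)
  finally show ?thesis by simp
qed

text \<open>Values in any inner product space: the real line for L^2 norms, the underlying Euclidean
  space for gradients.\<close>

lemma set_integral_inner_midpoint_ge:
  fixes f g :: "'a \<Rightarrow> 'b::real_inner"
  assumes "set_integrable M S (\<lambda>x. f x \<bullet> f x)" "set_integrable M S (\<lambda>x. g x \<bullet> g x)"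
    "set_integrable M S (\<lambda>x. (\<sigma> *\<^sub>R f x + (1 - \<sigma>) *\<^sub>R g x) \<bullet> (f x - g x))" "1/2 \<le> \<sigma>"
  shows "((LINT x:S|M. f x \<bullet> f x) - (LINT x:S|M. g x \<bullet> g x)) / 2
    \<le> (LINT x:S|M. (\<sigma> *\<^sub>R f x + (1 - \<sigma>) *\<^sub>R g x) \<bullet> (f x - g x))"
proof -
  have "((LINT x:S|M. f x \<bullet> f x) - (LINT x:S|M. g x \<bullet> g x)) / 2 = (LINT x:S|M. (f x \<bullet> f x - g x \<bullet> g x) / 2)"
    using assms by (simp add: set_integral_diff)
  also have "\<dots> \<le> (LINT x:S|M. (\<sigma> *\<^sub>R f x + (1 - \<sigma>) *\<^sub>R g x) \<bullet> (f x - g x))"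
    using assms by (intro set_integral_mono inner_midpoint_ge set_integrable_divide set_integral_diff)
  finally show ?thesis .
qed

lemma set_integral_inner_weighted_le:
  fixes f g :: "'a \<Rightarrow> 'b::real_inner"
  assumes "set_integrable M S (\<lambda>x. f x \<bullet> f x)" "set_integrable M S (\<lambda>x. g x \<bullet> g x)"
    "set_integrable M S (\<lambda>x. f x \<bullet> g x)" "0 < s"
  shows "2 * (LINT x:S|M. f x \<bullet> g x) \<le> s * (LINT x:S|M. f x \<bullet> f x) + (LINT x:S|M. g x \<bullet> g x) / s"
proof -
  have "2 * (LINT x:S|M. f x \<bullet> g x) = (LINT x:S|M. 2 * (f x \<bullet> g x))" by simp
  also have "\<dots> \<le> (LINT x:S|M. s * (f x \<bullet> f x) + (g x \<bullet> g x) / s)"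
    using assms by (intro set_integral_mono inner_weighted_le set_integral_add set_integrable_mult_right set_integrable_divide)
  also have "\<dots> = s * (LINT x:S|M. f x \<bullet> f x) + (LINT x:S|M. g x \<bullet> g x) / s"
    using assms by (simp add: set_integral_add)
  finally show ?thesis .
qed

section \<open>Inner products on the region and the tested chemical potential\<close>

lemma l2_inner_commute: "l2_inner S u v = l2_inner S v u"
  by (simp add: l2_inner_def mult.commute)

lemma l2_inner_nonneg: "0 \<le> l2_inner S u u"
  unfolding l2_inner_def set_lebesgue_integral_def by (intro Bochner_Integration.integral_nonneg) simp

lemma grad_inner_commute: "grad_inner S u v = grad_inner S v u"
  by (simp add: grad_inner_def inner_commute)

lemma grad_inner_nonneg: "0 \<le> grad_inner S u u"
  unfolding grad_inner_def set_lebesgue_integral_def by (intro Bochner_Integration.integral_nonneg) simp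

lemma l2_norm_square: "(l2_norm S u)\<^sup>2 = l2_inner S u u"
  by (simp add: l2_norm_def l2_inner_nonneg)

lemma grad_norm_square: "(grad_norm S u)\<^sup>2 = grad_inner S u u"
  using grad_inner_nonneg[of S u] by (simp add: grad_norm_def grad_inner_def)

lemma l2_inner_cong:
  "S \<in> sets lborel \<Longrightarrow> (\<And>x. x \<in> S \<Longrightarrow> u x = u' x) \<Longrightarrow> (\<And>x. x \<in> S \<Longrightarrow> v x = v' x) \<Longrightarrow> l2_inner S u v = l2_inner S u' v'"
  unfolding l2_inner_def by (rule set_lebesgue_integral_cong) auto

lemma regular_0: "regular k D f \<Longrightarrow> regular 0 D f"
  by (erule regular_mono) simp

lemma l2_inner_lincomb_right:
  assumes D: "valid_geometry D" and "regular 0 D u" "regular 0 D v" "regular 0 D w"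
  shows "l2_inner (region D) u (\<lambda>x. a * v x + b * w x) = a * l2_inner (region D) u v + b * l2_inner (region D) u w"
proof -
  have "set_integrable lborel (region D) (\<lambda>x. u x * v x)" "set_integrable lborel (region D) (\<lambda>x. u x * w x)"
    using assms by (auto intro!: regular_set_integrable[of D 0] regular_mult)
  then show ?thesis unfolding l2_inner_def
    by (simp add: distrib_left mult.left_commute[of "u _"] set_integral_add)
qed

lemma region_sets: "valid_geometry D \<Longrightarrow> region D \<in> sets lborel"
  using borel_open[OF region_open] by simp

lemma regular_diff: "regular k D f \<Longrightarrow> regular k D g \<Longrightarrow> regular k D (\<lambda>x. f x - g x)"
  using regular_add[of k D f "\<lambda>x. -1 * g x"] regular_cmult[of k D g "-1"] by simp

lemma l2_inner_midpoint_ge: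
  assumes D: "valid_geometry D" and f: "regular 0 D f" and g: "regular 0 D g" and \<sigma>: "1/2 \<le> \<sigma>"
  shows "(l2_inner (region D) f f - l2_inner (region D) g g) / 2
    \<le> l2_inner (region D) (\<lambda>x. \<sigma> * f x + (1 - \<sigma>) * g x) (\<lambda>x. f x - g x)"
  unfolding l2_inner_def
  using set_integral_inner_midpoint_ge[of lborel "region D" f g \<sigma>] \<sigma> f g
    regular_set_integrable[OF D regular_mult[OF f f]] regular_set_integrable[OF D regular_mult[OF g g]]
    regular_set_integrable[OF D regular_mult[OF regular_add[OF regular_cmult[OF f, of \<sigma>] regular_cmult[OF g, of "1 - \<sigma>"]] regular_diff[OF f g]]]
  by simp

lemma grad_inner_midpoint_ge:
  assumes D: "valid_geometry D" and f: "regular 1 D f" and g: "regular 1 D g" and \<sigma>: "1/2 \<le> \<sigma>"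
  shows "(grad_inner (region D) f f - grad_inner (region D) g g) / 2
    \<le> grad_inner (region D) (\<lambda>x. \<sigma> * f x + (1 - \<sigma>) * g x) (\<lambda>x. f x - g x)"
proof -
  let ?m = "\<lambda>x. \<sigma> * f x + (1 - \<sigma>) * g x" and ?d = "\<lambda>x. f x - g x"
  obtain U where U: "region_nbhd D U" "Ck 1 U f" "Ck 1 U g" using f g by (rule regular2E)
  have eq: "grad ?m x \<bullet> grad ?d x = (\<sigma> *\<^sub>R grad f x + (1 - \<sigma>) *\<^sub>R grad g x) \<bullet> (grad f x - grad g x)"
    if "x \<in> region D" for x
  proof -
    have d: "f differentiable (at x)" "g differentiable (at x)"
      using that U region_nbhd_subset Ck_differentiable[of 1] by blast+
    show ?thesis using grad_lincomb[OF d, of \<sigma> "1 - \<sigma>"] grad_lincomb[OF d, of 1 "-1"] by simp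
  qed
  have "regular 1 D ?m" "regular 1 D ?d" using f g by (auto intro!: regular_add regular_cmult regular_diff)
  then have "set_integrable lborel (region D) (\<lambda>x. grad ?m x \<bullet> grad ?d x)"
    by (intro regular_set_integrable[OF D regular_grad_inner])
  then have "set_integrable lborel (region D) (\<lambda>x. (\<sigma> *\<^sub>R grad f x + (1 - \<sigma>) *\<^sub>R grad g x) \<bullet> (grad f x - grad g x))"
    by (subst (asm) set_integrable_cong[OF refl refl eq])
  then have "(grad_inner (region D) f f - grad_inner (region D) g g) / 2
    \<le> (LINT x:region D|lborel. (\<sigma> *\<^sub>R grad f x + (1 - \<sigma>) *\<^sub>R grad g x) \<bullet> (grad f x - grad g x))"
    unfolding grad_inner_def using \<sigma> f g
    by (intro set_integral_inner_midpoint_ge regular_set_integrable[OF D regular_grad_inner])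
  also have "\<dots> = grad_inner (region D) ?m ?d"
    unfolding grad_inner_def using region_sets[OF D] eq by (intro set_lebesgue_integral_cong) auto
  finally show ?thesis .
qed

text \<open>Green's identity and the midpoint inequality handle the linear terms; the nonlinear
  integral is kept as it stands, since the equation for \<open>r\<close> evaluates it.\<close>

lemma chem_pot_increment_ge:
  assumes D: "valid_geometry D" and f: "bc_regular 2 D f" and g: "bc_regular 2 D g" and w: "regular 0 D w"
    and F: "Ck 1 UNIV F" and lam: "0 \<le> lam" and \<sigma>: "1/2 \<le> \<sigma>"
  shows "eps\<^sup>2 / 2 * (grad_inner (region D) f f - grad_inner (region D) g g)
      + lam / 2 * (l2_inner (region D) f f - l2_inner (region D) g g)
      + c * (LINT x:region D|lborel. deriv (g_pot lam F) (w x) * (f x - g x))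
    \<le> l2_inner (region D) (chem_pot eps lam F (\<lambda>x. \<sigma> * f x + (1 - \<sigma>) * g x) c w) (\<lambda>x. f x - g x)"
proof -
  define u where "u x = \<sigma> * f x + (1 - \<sigma>) * g x" for x
  define d where "d x = f x - g x" for x
  define h where "h x = deriv (g_pot lam F) (w x)" for x
  have reg: "regular 1 D f" "regular 1 D g" "regular 0 D f" "regular 0 D g"
    using f g unfolding bc_regular_def by (auto intro: regular_mono[of 2])
  have u: "bc_regular 2 D u" unfolding u_def[abs_def] using f g by (intro bc_regular_lincomb) auto
  have d: "bc_regular 2 D d" unfolding d_def[abs_def] using f g by (intro bc_regular_diff) auto
  have d1: "bc_regular 1 D d" using d unfolding bc_regular_def by (auto intro: regular_mono[of 2])
  have "Ck 0 UNIV (deriv (g_pot lam F))" using Ck_deriv[of 0] Ck_g_pot[OF F] by simp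
  then have h: "regular 0 D h" unfolding h_def[abs_def] by (rule regular_compose[OF w])
  have ud: "regular 0 D u" "regular 0 D d" "regular 0 D (laplacian u)"
    using u d regular_laplacian[of 0 D u] unfolding bc_regular_def
    by (auto simp: numeral_2_eq_2 intro: regular_0[of "Suc (Suc 0)"])
  have "l2_inner (region D) d (chem_pot eps lam F u c w) =
      l2_inner (region D) d (\<lambda>x. - eps\<^sup>2 * laplacian u x + 1 * (lam * u x + c * h x))"
    by (simp add: chem_pot_def[abs_def] h_def algebra_simps)
  also have "\<dots> = - eps\<^sup>2 * l2_inner (region D) d (laplacian u) + 1 * l2_inner (region D) d (\<lambda>x. lam * u x + c * h x)"
    using ud h by (intro l2_inner_lincomb_right[OF D] regular_add regular_cmult)
  also have "l2_inner (region D) d (\<lambda>x. lam * u x + c * h x) = lam * l2_inner (region D) d u + c * l2_inner (region D) d h"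
    using ud h by (intro l2_inner_lincomb_right[OF D])
  also have "l2_inner (region D) d (laplacian u) = - grad_inner (region D) d u"
    by (rule green_identity[OF D d1 u])
  finally have "l2_inner (region D) (chem_pot eps lam F u c w) d =
      eps\<^sup>2 * grad_inner (region D) u d + lam * l2_inner (region D) u d + c * (LINT x:region D|lborel. h x * d x)"
    by (simp add: l2_inner_commute[of _ d] grad_inner_commute[of _ d]) (simp add: l2_inner_def mult.commute)
  moreover have "eps\<^sup>2 * ((grad_inner (region D) f f - grad_inner (region D) g g) / 2) \<le> eps\<^sup>2 * grad_inner (region D) u d"
    unfolding u_def[abs_def] d_def[abs_def] by (intro mult_left_mono grad_inner_midpoint_ge D reg \<sigma>) simp
  moreover have "lam * ((l2_inner (region D) f f - l2_inner (region D) g g) / 2) \<le> lam * l2_inner (region D) u d"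
    unfolding u_def[abs_def] d_def[abs_def] by (intro mult_left_mono l2_inner_midpoint_ge D reg \<sigma> lam)
  ultimately show ?thesis unfolding u_def[abs_def] d_def[abs_def] h_def[abs_def] by simp
qed

text \<open>The condition inside \<open>inv_neg_laplacian\<close> without the zero mean: the
  potentials that the scheme supplies are built from chemical potentials, whose mean is
  arbitrary.\<close>

definition laplace_potential :: "'a::euclidean_space geometry \<Rightarrow> ('a \<Rightarrow> real) \<Rightarrow> ('a \<Rightarrow> real) \<Rightarrow> bool" where
  "laplace_potential D v w \<longleftrightarrow> bc_regular 2 D w \<and> (\<forall>x\<in>region D. - laplacian w x = v x)"

lemma laplacian_lincomb:
  assumes "open U" "Ck 2 U f" "Ck 2 U g" "x \<in> U"
  shows "laplacian (\<lambda>x. a * f x + b * g x) x = a * laplacian f x + b * laplacian g x"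
proof -
  have "laplacian (\<lambda>x. a * f x + b * g x) x = laplacian (\<lambda>x. a * f x) x + laplacian (\<lambda>x. b * g x) x"
    by (intro laplacian_add[of U] Ck_cmult assms)
  then show ?thesis
    using laplacian_cmult[OF assms(1,2,4), of a] laplacian_cmult[OF assms(1,3,4), of b] by simp
qed

lemma laplace_potential_lincomb:
  assumes "laplace_potential D v w" "laplace_potential D v' w'"
    and "\<And>x. x \<in> region D \<Longrightarrow> u x = a * v x + b * v' x"
  shows "laplace_potential D u (\<lambda>x. a * w x + b * w' x)"
proof -
  have w: "bc_regular 2 D w" "bc_regular 2 D w'" using assms by (auto simp: laplace_potential_def)
  obtain U where U: "region_nbhd D U" "open U" "Ck 2 U w" "Ck 2 U w'"
    using w[unfolded bc_regular_def, THEN conjunct1] by (rule regular2E)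
  have "- laplacian (\<lambda>x. a * w x + b * w' x) x = u x" if "x \<in> region D" for x
  proof -
    have "x \<in> U" using that region_nbhd_subset[OF U(1)] by blast
    moreover have "- laplacian w x = v x" "- laplacian w' x = v' x"
      using assms(1,2) that by (auto simp: laplace_potential_def)
    ultimately show ?thesis using laplacian_lincomb[OF U(2-4), of x a b]
      unfolding assms(3)[OF that] by (simp flip: \<open>- laplacian w x = v x\<close> \<open>- laplacian w' x = v' x\<close>)
  qed
  then show ?thesis unfolding laplace_potential_def using w by (auto intro: bc_regular_lincomb)
qed

lemma measure_region_pos:
  assumes "valid_geometry D"
  shows "0 < measure lborel (region D)"
proof -
  have "\<not> negligible (region D)"
    using open_not_negligible region_open[OF assms] region_nonempty[OF assms] by blast
  then have "emeasure lborel (region D) \<noteq> 0"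
    using region_open[OF assms] by (auto simp: negligible_iff_null_sets null_sets_def)
  moreover have "emeasure lborel (region D) < \<infinity>"
    using emeasure_bounded_finite[OF region_bounded[OF assms]] .
  ultimately show ?thesis by (simp add: measure_def enn2real_positive_iff zero_less_iff_neq_zero)
qed

text \<open>\<open>SOME\<close> yields a potential only if one with zero mean exists; subtracting
  the mean of \<open>w\<close> provides it.\<close>

lemma inv_neg_laplacian_potential:
  assumes D: "valid_geometry D" and w: "laplace_potential D v w"
  shows "laplace_potential D v (inv_neg_laplacian D v)"
proof -
  define c where "c = (LINT x:region D|lborel. w x) / measure lborel (region D)"
  \<comment> \<open>Written as a combination of \<open>w\<close> and the constant -1, a potential of
    0, to fit \<open>laplace_potential_lincomb\<close>.\<close>
  define w0 where "w0 = (\<lambda>x. 1 * w x + c * -1)"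
  have "laplace_potential D (\<lambda>x. 0) (\<lambda>x. -1)"
    by (simp add: laplace_potential_def bc_regular_const laplacian_const)
  from laplace_potential_lincomb[OF w this, of v 1 c]
  have w0: "laplace_potential D v w0" by (simp add: w0_def)
  have "set_integrable lborel (region D) w"
    using w D by (auto simp: laplace_potential_def bc_regular_def intro: regular_set_integrable)
  moreover have "set_integrable lborel (region D) (\<lambda>x. c)"
    using D by (rule regular_set_integrable[of _ 0]) (rule regular_const)
  moreover have "(LINT x:region D|lborel. c) = c * measure lborel (region D)"
    using region_sets[OF D] emeasure_bounded_finite[OF region_bounded[OF D]]
    by (simp add: set_lebesgue_integral_def)
  ultimately have "(LINT x:region D|lborel. w0 x) = 0"
    using measure_region_pos[OF D] by (simp add: w0_def set_integral_diff c_def)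
  with w0 have "\<exists>w. regular 2 D w \<and> boundary_cond D w \<and> (\<forall>x\<in>region D. - laplacian w x = v x)
      \<and> (LINT x:region D|lborel. w x) = 0"
    unfolding laplace_potential_def bc_regular_def by blast
  from someI_ex[OF this] show ?thesis
    unfolding laplace_potential_def bc_regular_def inv_neg_laplacian_def by blast
qed

text \<open>Turns a pairing with \<open>v\<close> into a Dirichlet form. When \<open>u\<close> is
  itself a potential of a second function, the H^-1 product of the two becomes visibly
  symmetric.\<close>

lemma potential_inner:
  assumes D: "valid_geometry D" and w: "laplace_potential D v w" and u: "bc_regular 1 D u"
  shows "l2_inner (region D) u v = grad_inner (region D) u w"
proof -
  have "l2_inner (region D) u v = l2_inner (region D) u (\<lambda>x. -1 * laplacian w x + 0 * u x)"
    using w by (intro l2_inner_cong region_sets[OF D]) (auto simp: laplace_potential_def)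
  also have "\<dots> = -1 * l2_inner (region D) u (laplacian w) + 0 * l2_inner (region D) u u"
    using w u regular_laplacian[of 0 D w] unfolding laplace_potential_def bc_regular_def
    by (intro l2_inner_lincomb_right[OF D]) (auto simp: numeral_2_eq_2 intro: regular_0)
  also have "l2_inner (region D) u (laplacian w) = - grad_inner (region D) u w"
    using w by (intro green_identity[OF D u]) (simp add: laplace_potential_def)
  finally show ?thesis by simp
qed

section \<open>One step of the scheme\<close>

lemma bc_regular_mono: "bc_regular m D f \<Longrightarrow> k \<le> m \<Longrightarrow> bc_regular k D f"
  unfolding bc_regular_def using regular_mono by blast

text \<open>The coefficients of \<open>F2\<close> sum to zero because 1 + 2\<sigma> g + (2\<sigma> -
  1) g^2 factors as (1 + (2\<sigma> - 1) g) (1 + g), so only differences survive.\<close>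

lemma F2_increments:
  assumes "0 < \<gamma> (n + 1)"
  shows "F2 \<sigma> t \<gamma> \<phi> n x =
    ((1 + 2 * \<sigma> * \<gamma> (n + 1)) / (1 + \<gamma> (n + 1)) * (\<phi> (n + 1) x - \<phi> n x)
     - (2 * \<sigma> - 1) * (\<gamma> (n + 1))\<^sup>2 / (1 + \<gamma> (n + 1)) * (\<phi> n x - \<phi> (n - 1) x)) / time_step t (n + 1)"
proof -
  define g where "g = \<gamma> (n + 1)"
  have g: "0 < g" using assms by (simp add: g_def)
  define a b where "a = (1 + 2 * \<sigma> * g) / (1 + g)" and "b = (2 * \<sigma> - 1) * g\<^sup>2 / (1 + g)"
  have "a + b = (1 + 2 * \<sigma> * g + (2 * \<sigma> - 1) * g\<^sup>2) / (1 + g)"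
    by (simp add: a_def b_def add_divide_distrib)
  also have "1 + 2 * \<sigma> * g + (2 * \<sigma> - 1) * g\<^sup>2 = (1 + (2 * \<sigma> - 1) * g) * (1 + g)"
    by (simp add: algebra_simps power2_eq_square)
  finally have ab: "1 + (2 * \<sigma> - 1) * g = a + b" using g by simp
  show ?thesis
    unfolding F2_def g_def[symmetric] a_def[symmetric] b_def[symmetric] ab
    by (simp add: algebra_simps diff_divide_distrib add_divide_distrib)
qed

text \<open>\<open>B\<close> is the product of the two increments in the metric of the flow: the L^2
  product, or the Dirichlet form of their potentials. Only its Young bound and the dissipation
  identity leave the lemma, so the two flows can be treated alike afterwards. \<open>w1\<close> and
  \<open>w0\<close> witness that the chosen inverse Laplacians are potentials.\<close>

lemma flow_dissipation:
  assumes D: "valid_geometry D"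
    and reg: "bc_regular 2 D v1" "bc_regular 2 D v0" "regular 0 D \<mu>"
    and flow: "\<And>x. x \<in> region D \<Longrightarrow> (a * v1 x - b * v0 x) / \<tau> = flow_op H \<mu> x"
    and Hm1: "H = Flow_Hm1 \<Longrightarrow> bc_regular 2 D \<mu>" "H = Flow_Hm1 \<Longrightarrow> laplace_potential D v1 w1"
      "H = Flow_Hm1 \<Longrightarrow> laplace_potential D v0 w0"
  obtains B where "0 \<le> increment_norm_sq H D v1"
    "\<And>s. 0 < s \<Longrightarrow> 2 * B \<le> s * increment_norm_sq H D v0 + increment_norm_sq H D v1 / s"
    "l2_inner (region D) \<mu> v1 = - (a * increment_norm_sq H D v1 - b * B) / \<tau>"
proof (cases H)
  case Flow_L2
  have v: "regular 0 D v1" "regular 0 D v0" using reg by (auto simp: bc_regular_def intro: regular_0[of 2])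
  have "l2_inner (region D) v1 \<mu> = l2_inner (region D) v1 (\<lambda>x. (- a / \<tau>) * v1 x + (b / \<tau>) * v0 x)"
  proof (rule l2_inner_cong[OF region_sets[OF D]])
    show "\<mu> x = (- a / \<tau>) * v1 x + (b / \<tau>) * v0 x" if "x \<in> region D" for x
      using flow[OF that] Flow_L2 by (simp add: diff_divide_distrib)
  qed simp
  also have "\<dots> = (- a / \<tau>) * l2_inner (region D) v1 v1 + (b / \<tau>) * l2_inner (region D) v1 v0"
    by (rule l2_inner_lincomb_right[OF D v(1,1,2)])
  finally have eq: "l2_inner (region D) \<mu> v1 =
      - (a * l2_inner (region D) v1 v1 - b * l2_inner (region D) v0 v1) / \<tau>"
    by (simp add: l2_inner_commute[of _ \<mu> v1] l2_inner_commute[of _ v0 v1] diff_divide_distrib)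
  have "2 * l2_inner (region D) v0 v1 \<le> s * l2_inner (region D) v0 v0 + l2_inner (region D) v1 v1 / s"
    if "0 < s" for s
    using set_integral_inner_weighted_le[of lborel "region D" v0 v1 s] that
      regular_set_integrable[OF D regular_mult[OF v(1) v(1)]] regular_set_integrable[OF D regular_mult[OF v(2) v(2)]]
      regular_set_integrable[OF D regular_mult[OF v(2) v(1)]]
    by (simp add: l2_inner_def)
  then show ?thesis
    using that[of "l2_inner (region D) v0 v1"] eq Flow_L2 l2_inner_nonneg[of "region D" v1] by (simp add: l2_norm_square)
next
  case Flow_Hm1
  define W1 W0 where "W1 = inv_neg_laplacian D v1" and "W0 = inv_neg_laplacian D v0"
  have W: "laplace_potential D v1 W1" "laplace_potential D v0 W0"
    unfolding W1_def W0_def using Hm1 Flow_Hm1 by (auto intro: inv_neg_laplacian_potential[OF D])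
  then have W_reg: "bc_regular 2 D W1" "bc_regular 2 D W0" by (auto simp: laplace_potential_def)
  then have W_reg1: "bc_regular 1 D W1" "bc_regular 1 D W0" by (auto intro: bc_regular_mono[of 2])
  then have W_r: "regular 1 D W1" "regular 1 D W0" by (auto simp: bc_regular_def)
  have \<mu>: "bc_regular 2 D \<mu>" using Hm1 Flow_Hm1 by simp
  have Q: "increment_norm_sq H D v1 = grad_inner (region D) W1 W1"
     "increment_norm_sq H D v0 = grad_inner (region D) W0 W0"
    using potential_inner[OF D W(1) W_reg1(1)] potential_inner[OF D W(2) W_reg1(2)] Flow_Hm1
    by (auto simp: inv_grad_norm_sq_def W1_def W0_def l2_inner_commute)
  \<comment> \<open>Two integrations by parts move the Laplacian from the potential of
    \<open>v1\<close> to \<mu>, where the scheme evaluates it.\<close>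
  have "l2_inner (region D) \<mu> v1 = grad_inner (region D) \<mu> W1"
    by (rule potential_inner[OF D W(1) bc_regular_mono[OF \<mu>]]) simp
  also have "\<dots> = - l2_inner (region D) W1 (laplacian \<mu>)"
    using green_identity[OF D W_reg1(1) \<mu>] by (simp add: grad_inner_commute)
  also have "l2_inner (region D) W1 (laplacian \<mu>) = l2_inner (region D) W1 (\<lambda>x. (a / \<tau>) * v1 x + (- b / \<tau>) * v0 x)"
  proof (rule l2_inner_cong[OF region_sets[OF D]])
    show "laplacian \<mu> x = (a / \<tau>) * v1 x + (- b / \<tau>) * v0 x" if "x \<in> region D" for x
      using flow[OF that] Flow_Hm1 by (simp add: diff_divide_distrib)
  qed simp
  also have "\<dots> = (a / \<tau>) * l2_inner (region D) W1 v1 + (- b / \<tau>) * l2_inner (region D) W1 v0"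
    using reg W_r by (intro l2_inner_lincomb_right[OF D]) (auto simp: bc_regular_def intro: regular_0[of 1] regular_0[of 2])
  also have "l2_inner (region D) W1 v1 = grad_inner (region D) W1 W1"
    by (rule potential_inner[OF D W(1) W_reg1(1)])
  also have "l2_inner (region D) W1 v0 = grad_inner (region D) W0 W1"
    using potential_inner[OF D W(2) W_reg1(1)] by (simp add: grad_inner_commute)
  finally have eq: "l2_inner (region D) \<mu> v1 =
      - (a * grad_inner (region D) W1 W1 - b * grad_inner (region D) W0 W1) / \<tau>"
    by (simp add: diff_divide_distrib)
  have "2 * grad_inner (region D) W0 W1 \<le> s * grad_inner (region D) W0 W0 + grad_inner (region D) W1 W1 / s"
    if "0 < s" for s
    unfolding grad_inner_def using that W_r
    by (intro set_integral_inner_weighted_le regular_set_integrable[OF D regular_grad_inner])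
  then show ?thesis
    using that[of "grad_inner (region D) W0 W1"] eq Q grad_inner_nonneg[of "region D" W1] by simp
qed

section \<open>Admissible potentials from the scheme\<close>

lemma boundary_cond_laplacian_lincomb:
  assumes "regular 4 D f" "regular 4 D g" "boundary_cond D (laplacian f)" "boundary_cond D (laplacian g)"
  shows "boundary_cond D (laplacian (\<lambda>x. a * f x + b * g x))"
proof -
  have four: "(4::nat) = Suc (Suc 2)" by simp
  obtain U where U: "region_nbhd D U" "open U" "Ck 4 U f" "Ck 4 U g" using assms(1,2) by (rule regular2E)
  then have "Ck 2 U f" "Ck 2 U g" using Ck_mono[of 4 U _ 2] by auto
  then have lap: "a * laplacian f x + b * laplacian g x = laplacian (\<lambda>x. a * f x + b * g x) x" if "x \<in> U" for x
    using laplacian_lincomb[OF U(2)] that by simp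
  have "regular 1 D (laplacian f)" "regular 1 D (laplacian g)"
    using assms(1,2) regular_laplacian[of 2 D] unfolding four by (auto intro: regular_mono[of 2])
  from boundary_cond_lincomb[OF this assms(3,4), of a b]
  show ?thesis by (rule boundary_cond_cong[OF U(1), rotated]) (rule lap)
qed

text \<open>In the H^-1 flow \<mu> itself is integrated by parts, so it must inherit the boundary
  condition: from both conditions on \<open>u\<close> and, by the chain rule, from the one on
  \<open>w\<close>. The composed term must be C^2, hence \<open>F\<close> of class C^3, which is
  \<open>flow_order Flow_Hm1 - 1\<close>.\<close>

lemma bc_regular_chem_pot:
  assumes u: "regular 4 D u" "flow_boundary_cond Flow_Hm1 D u" and w: "bc_regular 2 D w" and F: "Ck 3 UNIV F"
  shows "bc_regular 2 D (chem_pot eps lam F u c w)"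
proof -
  have four: "(4::nat) = Suc (Suc 2)" and three: "(3::nat) = Suc 2" by simp_all
  have u2: "bc_regular 2 D u" using u by (auto simp: bc_regular_def intro: regular_mono[of 4])
  have lap: "bc_regular 2 D (laplacian u)"
    using u regular_laplacian[of 2 D u] unfolding bc_regular_def four by simp
  have g: "Ck 2 UNIV (deriv (g_pot lam F))"
    using Ck_deriv[of 2 "g_pot lam F"] Ck_g_pot[OF F] unfolding three by blast
  have "bc_regular 2 D (\<lambda>x. deriv (g_pot lam F) (w x))"
    using w regular_compose[of 2 D w, OF _ g] regular_mono[of 2 D w 1]
      boundary_cond_compose[of D w, OF _ _ Ck_mono[OF g, of 1]]
    unfolding bc_regular_def by simp
  then have "bc_regular 2 D (\<lambda>x. - eps\<^sup>2 * laplacian u x + 1 * (lam * u x + c * deriv (g_pot lam F) (w x)))"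
    using u2 lap by (intro bc_regular_lincomb) auto
  moreover have "chem_pot eps lam F u c w = (\<lambda>x. - eps\<^sup>2 * laplacian u x + 1 * (lam * u x + c * deriv (g_pot lam F) (w x)))"
    by (simp add: chem_pot_def[abs_def] algebra_simps)
  ultimately show ?thesis by simp
qed

lemma vbdf2_interp:
  assumes "regular (flow_order H) D (\<phi> n)" "regular (flow_order H) D (\<phi> (n + 1))"
    "flow_boundary_cond H D (\<phi> n)" "flow_boundary_cond H D (\<phi> (n + 1))"
  shows "regular (flow_order H) D (interp \<sigma> \<phi> n)" "flow_boundary_cond H D (interp \<sigma> \<phi> n)"
proof -
  have eq: "interp \<sigma> \<phi> n = (\<lambda>x. \<sigma> * \<phi> (n + 1) x + (1 - \<sigma>) * \<phi> n x)" by (simp add: interp_def[abs_def])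
  show "regular (flow_order H) D (interp \<sigma> \<phi> n)"
    unfolding eq using assms by (intro regular_add regular_cmult)
  show "flow_boundary_cond H D (interp \<sigma> \<phi> n)"
  proof (cases H)
    case Flow_L2
    then show ?thesis unfolding eq using assms
      by (auto intro!: boundary_cond_lincomb intro: regular_mono[of 2])
  next
    case Flow_Hm1
    then show ?thesis unfolding eq using assms
      by (auto intro!: boundary_cond_lincomb boundary_cond_laplacian_lincomb intro: regular_mono[of 4])
  qed
qed

lemma bc_regular_extrap:
  assumes "bc_regular 2 D (\<phi> n)" "bc_regular 2 D (\<phi> (n - 1))"
  shows "bc_regular 2 D (extrap \<sigma> \<gamma> \<phi> n)"
proof -
  have "extrap \<sigma> \<gamma> \<phi> n = (\<lambda>x. (1 + \<sigma> * \<gamma> (n + 1)) * \<phi> n x + (- \<sigma> * \<gamma> (n + 1)) * \<phi> (n - 1) x)"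
    by (simp add: extrap_def[abs_def] algebra_simps)
  then show ?thesis
    using assms bc_regular_lincomb[of 2 D "\<phi> n" "\<phi> (n - 1)" "1 + \<sigma> * \<gamma> (n + 1)" "- \<sigma> * \<gamma> (n + 1)"] by simp
qed

text \<open>The scheme itself exhibits each increment as the Laplacian of an admissible function, so
  solvability of the Poisson problem is never needed.\<close>

lemma increment_has_potential:
  assumes F: "Ck 3 UNIV F" and sol: "vbdf2_solution D Flow_Hm1 eps lam F C0 V \<sigma> N t \<gamma> \<phi> r"
    and \<sigma>: "1/2 \<le> \<sigma>" and t: "\<And>n. n < N \<Longrightarrow> t n < t (n + 1)"
    and \<gamma>: "\<And>n. 1 \<le> n \<Longrightarrow> n < N \<Longrightarrow> 0 < \<gamma> (n + 1)" and n: "1 \<le> n" "n \<le> N"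
  shows "\<exists>w. laplace_potential D (\<lambda>x. \<phi> n x - \<phi> (n - 1) x) w"
  using n
proof (induction n rule: nat_induct_at_least)
  have reg: "regular 4 D (\<phi> n)" "flow_boundary_cond Flow_Hm1 D (\<phi> n)" if "n \<le> N" for n
    using sol that by (auto simp: vbdf2_solution_def)
  then have reg2: "bc_regular 2 D (\<phi> n)" if "n \<le> N" for n
    using that by (auto simp: bc_regular_def intro: regular_mono[of 4])
  have zero: "laplace_potential D (\<lambda>x. 0) (\<lambda>x. 0)"
    by (simp add: laplace_potential_def bc_regular_const laplacian_const)
  have \<tau>: "0 < time_step t (n + 1)" if "n < N" for n using t[OF that] by (simp add: time_step_def)
  {
    case base
    define \<mu> where "\<mu> = chem_pot eps lam F (\<phi> 1) (r 1 / sqrt (E1 D lam F C0 (\<phi> 0))) (\<phi> 0)"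
    have \<mu>: "bc_regular 2 D \<mu>" unfolding \<mu>_def using reg reg2 F base by (intro bc_regular_chem_pot) auto
    have step: "(\<phi> 1 x - \<phi> 0 x) / time_step t 1 = laplacian \<mu> x" if "x \<in> region D" for x
      using sol that by (simp add: vbdf2_solution_def first_step_def Let_def \<mu>_def)
    have "laplace_potential D (\<lambda>x. - laplacian \<mu> x) \<mu>" using \<mu> by (simp add: laplace_potential_def)
    \<comment> \<open>The first step makes the increment a multiple of the Laplacian of \<mu>; the
      zero potential fills the second slot.\<close>
    from laplace_potential_lincomb[OF this zero, of "\<lambda>x. \<phi> 1 x - \<phi> (1 - 1) x" "- time_step t 1" 0]
    show ?case using step \<tau>[of 0] base by (force simp: field_simps)
  next
    case (Suc n)
    define a where "a = (1 + 2 * \<sigma> * \<gamma> (n + 1)) / (1 + \<gamma> (n + 1))"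
    define b where "b = (2 * \<sigma> - 1) * (\<gamma> (n + 1))\<^sup>2 / (1 + \<gamma> (n + 1))"
    define \<tau> where "\<tau> = time_step t (n + 1)"
    have n: "1 \<le> n" "n < N" using Suc by auto
    have g: "0 < \<gamma> (n + 1)" using \<gamma>[OF n] .
    have a: "0 < a" using g \<sigma> by (simp add: a_def add_pos_pos)
    have \<tau>0: "0 < \<tau>" unfolding \<tau>_def using t[OF n(2)] by (simp add: time_step_def)
    obtain w where w: "laplace_potential D (\<lambda>x. \<phi> n x - \<phi> (n - 1) x) w" using Suc by auto
    define \<mu> where "\<mu> = chem_pot eps lam F (interp \<sigma> \<phi> n)
      (r (n + 1) / sqrt (E1 D lam F C0 (\<phi> n)) * V (r (n + 1) / sqrt (E1 D lam F C0 (\<phi> n)))) (extrap \<sigma> \<gamma> \<phi> n)"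
    have \<mu>: "bc_regular 2 D \<mu>" unfolding \<mu>_def
      using reg reg2 F n vbdf2_interp[of Flow_Hm1 D \<phi> n]
      by (intro bc_regular_chem_pot bc_regular_extrap) auto
    have step: "(a * (\<phi> (n + 1) x - \<phi> n x) - b * (\<phi> n x - \<phi> (n - 1) x)) / \<tau> = laplacian \<mu> x"
      if "x \<in> region D" for x
    proof -
      have "vbdf2_step D Flow_Hm1 eps lam F C0 V \<sigma> t \<gamma> \<phi> r n" using sol n by (simp add: vbdf2_solution_def)
      then have "F2 \<sigma> t \<gamma> \<phi> n x = laplacian \<mu> x" using that by (simp add: vbdf2_step_def Let_def \<mu>_def)
      then show ?thesis unfolding F2_increments[of \<gamma> n, OF g] a_def b_def \<tau>_def .
    qed
    have "laplace_potential D (\<lambda>x. - laplacian \<mu> x) \<mu>" using \<mu> by (simp add: laplace_potential_def)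
    \<comment> \<open>The step solved for the new increment, possible as \<open>a\<close> is
      positive: a Laplacian plus a multiple of the old increment.\<close>
    moreover have "\<phi> (n + 1) x - \<phi> n x = (- \<tau> / a) * (- laplacian \<mu> x) + (b / a) * (\<phi> n x - \<phi> (n - 1) x)"
      if "x \<in> region D" for x
      unfolding step[OF that, symmetric] using a \<tau>0 by (simp add: field_simps)
    ultimately have "laplace_potential D (\<lambda>x. \<phi> (n + 1) x - \<phi> n x) (\<lambda>x. (- \<tau> / a) * \<mu> x + (b / a) * w x)"
      using w by (intro laplace_potential_lincomb)
    then show ?case by auto
  }
qed

lemma vbdf2_step_energy:
  fixes D :: "'a::euclidean_space geometry"
  assumes D: "valid_geometry D" and lam: "0 \<le> lam" and F: "Ck (flow_order H - 1) UNIV F"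
    and \<sigma>: "1/2 \<le> \<sigma>" "\<sigma> \<le> 1" and t: "\<And>n. n < N \<Longrightarrow> t n < t (n + 1)"
    and \<gamma>_eq: "\<And>n. 1 \<le> n \<Longrightarrow> n < N \<Longrightarrow> \<gamma> (n + 1) = time_step t (n + 1) / time_step t n"
    and \<gamma>: "\<And>n. 1 \<le> n \<Longrightarrow> n \<le> N \<Longrightarrow> 0 < \<gamma> (n + 1) \<and> ereal (\<gamma> (n + 1)) \<le> gamma_ss \<sigma>"
    and sol: "vbdf2_solution D H eps lam F C0 V \<sigma> N t \<gamma> \<phi> r" and n: "1 \<le> n" "n < N"
  shows "E_H D H eps lam \<sigma> t \<gamma> \<phi> r (n + 1) - E_H D H eps lam \<sigma> t \<gamma> \<phi> r n \<le> 0"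
proof -
  let ?S = "region D"
  define e where "e = sqrt (E1 D lam F C0 (\<phi> n))"
  define c where "c = r (n + 1) / e * V (r (n + 1) / e)"
  define \<mu> where "\<mu> = chem_pot eps lam F (interp \<sigma> \<phi> n) c (extrap \<sigma> \<gamma> \<phi> n)"
  define v1 v0 where "v1 = (\<lambda>x. \<phi> (n + 1) x - \<phi> n x)" and "v0 = (\<lambda>x. \<phi> n x - \<phi> (n - 1) x)"
  define a where "a = (1 + 2 * \<sigma> * \<gamma> (n + 1)) / (1 + \<gamma> (n + 1))"
  define b where "b = (2 * \<sigma> - 1) * (\<gamma> (n + 1))\<^sup>2 / (1 + \<gamma> (n + 1))"
  define \<tau> where "\<tau> = time_step t (n + 1)"
  define I where "I = (LINT x:?S|lborel. deriv (g_pot lam F) (extrap \<sigma> \<gamma> \<phi> n x) * v1 x)"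
  have \<tau>: "0 < \<tau>" "0 < time_step t n"
    using t[of n] t[of "n - 1"] n by (auto simp: \<tau>_def time_step_def)
  have g: "0 < \<gamma> (n + 1)" using \<gamma>[of n] n by simp
  have order: "2 \<le> flow_order H" by (cases H) auto
  have reg: "regular (flow_order H) D (\<phi> m)" "flow_boundary_cond H D (\<phi> m)" if "m \<le> N" for m
    using sol that by (auto simp: vbdf2_solution_def)
  have bc: "bc_regular 2 D (\<phi> m)" if "m \<le> N" for m
    using reg[OF that] order regular_mono[of "flow_order H" D "\<phi> m" 2]
    by (cases H) (auto simp: bc_regular_def)
  have \<phi>: "bc_regular 2 D (\<phi> (n + 1))" "bc_regular 2 D (\<phi> n)" "bc_regular 2 D (\<phi> (n - 1))"
    using n by (auto intro: bc)
  have v: "bc_regular 2 D v1" "bc_regular 2 D v0"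
    unfolding v1_def v0_def using \<phi> by (auto intro: bc_regular_diff)
  have ext: "bc_regular 2 D (extrap \<sigma> \<gamma> \<phi> n)" using \<phi> by (intro bc_regular_extrap)
  have F1: "Ck 1 UNIV F" using F by (cases H) (auto intro: Ck_mono[of 3] simp del: Ck.simps)
  have step: "vbdf2_step D H eps lam F C0 V \<sigma> t \<gamma> \<phi> r n" using sol n by (simp add: vbdf2_solution_def)
  have flow: "(a * v1 x - b * v0 x) / \<tau> = flow_op H \<mu> x" if "x \<in> ?S" for x
  proof -
    have "F2 \<sigma> t \<gamma> \<phi> n x = flow_op H \<mu> x"
      using step that by (simp add: vbdf2_step_def Let_def \<mu>_def c_def e_def)
    then show ?thesis unfolding F2_increments[of \<gamma> n, OF g] a_def b_def \<tau>_def v1_def v0_def .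
  qed
  have "(r (n + 1) - r n) / \<tau> = V (r (n + 1) / e) / (2 * e) * I / \<tau>"
    using step by (simp add: vbdf2_step_def Let_def e_def I_def v1_def \<tau>_def)
  then have "r (n + 1) - r n = V (r (n + 1) / e) / (2 * e) * I"
    using \<tau>(1) unfolding divide_cancel_right by simp
  \<comment> \<open>The factor \<open>V (r (n + 1) / e) / e\<close> is common to \<open>c\<close>
    and to the equation for \<open>r\<close>, so the nonlinear integral becomes an expression in
    \<open>r\<close> alone.\<close>
  then have cI: "c * I = 2 * r (n + 1) * (r (n + 1) - r n)" by (simp add: c_def)
  have "2 * r (n + 1) * (r (n + 1) - r n) = (r (n + 1))\<^sup>2 - (r n)\<^sup>2 + (r (n + 1) - r n)\<^sup>2"
    by (simp add: power2_eq_square algebra_simps)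
  then have r: "(r (n + 1))\<^sup>2 - (r n)\<^sup>2 \<le> c * I" unfolding cI by simp
  have "interp \<sigma> \<phi> n = (\<lambda>x. \<sigma> * \<phi> (n + 1) x + (1 - \<sigma>) * \<phi> n x)" by (simp add: interp_def[abs_def])
  then have "eps\<^sup>2 / 2 * (grad_inner ?S (\<phi> (n + 1)) (\<phi> (n + 1)) - grad_inner ?S (\<phi> n) (\<phi> n))
      + lam / 2 * (l2_inner ?S (\<phi> (n + 1)) (\<phi> (n + 1)) - l2_inner ?S (\<phi> n) (\<phi> n)) + c * I
    \<le> l2_inner ?S \<mu> v1"
    using chem_pot_increment_ge[OF D \<phi>(1,2) _ F1 lam \<sigma>(1), of "extrap \<sigma> \<gamma> \<phi> n" eps c] ext
    by (simp add: \<mu>_def v1_def I_def bc_regular_def regular_0[of 2])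
  then have E: "E_mod D eps lam \<phi> r (n + 1) - E_mod D eps lam \<phi> r n \<le> l2_inner ?S \<mu> v1"
    using r by (simp add: E_mod_def l2_norm_square grad_norm_square algebra_simps)
  have \<mu>_reg: "regular 0 D \<mu>"
  proof -
    have "bc_regular 2 D (interp \<sigma> \<phi> n)"
      using \<phi> unfolding interp_def[abs_def] by (intro bc_regular_lincomb) auto
    then have "regular 0 D (interp \<sigma> \<phi> n)" "regular 0 D (laplacian (interp \<sigma> \<phi> n))"
      using regular_laplacian[of 0 D "interp \<sigma> \<phi> n"] regular_0[of 2 D "interp \<sigma> \<phi> n"]
      by (auto simp: bc_regular_def numeral_2_eq_2)
    moreover have "regular 0 D (\<lambda>x. deriv (g_pot lam F) (extrap \<sigma> \<gamma> \<phi> n x))"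
      using ext regular_compose[of 0 D "extrap \<sigma> \<gamma> \<phi> n", OF _ Ck_deriv[of 0 "g_pot lam F"]] Ck_g_pot[OF F1]
        regular_0[of 2 D "extrap \<sigma> \<gamma> \<phi> n"] by (simp add: bc_regular_def)
    ultimately show ?thesis
      unfolding \<mu>_def chem_pot_def[abs_def] by (intro regular_add regular_cmult)
  qed
  obtain w1 w0 where w: "H = Flow_Hm1 \<Longrightarrow> laplace_potential D v1 w1" "H = Flow_Hm1 \<Longrightarrow> laplace_potential D v0 w0"
  proof (cases H)
    case Flow_Hm1
    then have "\<exists>w. laplace_potential D (\<lambda>x. \<phi> m x - \<phi> (m - 1) x) w" if "1 \<le> m" "m \<le> N" for m
      using F sol t \<sigma> \<gamma> that by (intro increment_has_potential[where N=N]) auto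
    from this[of "n + 1"] this[of n] show ?thesis using n that by (auto simp: v1_def v0_def)
  qed (use that in simp)
  have \<mu>_Hm1: "bc_regular 2 D \<mu>" if "H = Flow_Hm1"
    unfolding \<mu>_def using reg ext F that n vbdf2_interp[of H D \<phi> n]
    by (intro bc_regular_chem_pot) auto
  obtain B where B: "0 \<le> increment_norm_sq H D v1"
    "\<And>s. 0 < s \<Longrightarrow> 2 * B \<le> s * increment_norm_sq H D v0 + increment_norm_sq H D v1 / s"
    "l2_inner ?S \<mu> v1 = - (a * increment_norm_sq H D v1 - b * B) / \<tau>"
    using flow_dissipation[OF D v \<mu>_reg flow \<mu>_Hm1 w] by blast
  \<comment> \<open>For n = N - 1 the second ratio is \<open>\<gamma> (N + 1)\<close>, beyond the
    mesh; this is why the bounds on \<gamma> reach that index.\<close>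
  have "0 \<le> G_fun \<sigma> (\<gamma> (n + 1)) (\<gamma> (n + 2))"
    using \<gamma>[of n] \<gamma>[of "n + 1"] n \<sigma> by (intro G_fun_nonneg) auto
  from weighted_increment_inequality[OF \<sigma>(1) \<tau>(2,1) _ _ B(1,2) this E[unfolded B(3) a_def b_def]]
  show ?thesis
    using \<gamma>_eq[OF n] \<gamma>[of "n + 1"] n by (simp add: E_H_def v1_def v0_def \<tau>_def)
qed

theorem theorem2p2:
  fixes D :: "'a::euclidean_space geometry"
    and H :: flow
    and eps lam C0 \<sigma> :: real
    and F V :: "real \<Rightarrow> real"
    and N :: nat
    and t \<gamma> r :: "nat \<Rightarrow> real"
    and \<phi> :: "nat \<Rightarrow> 'a \<Rightarrow> real"
  assumes "DIM('a) \<in> {1, 2, 3}"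
    and "valid_geometry D"
    and "eps > 0" and "lam \<ge> 0" and "C0 > 0"
    and "Ck (flow_order H - 1) UNIV F"
    and "Ck 2 UNIV V" and "V 1 = 1" and "deriv V 1 = -1"
    and "1/2 \<le> \<sigma>" and "\<sigma> \<le> 1"
    and "N \<ge> 1" and "t 0 = 0" and "\<forall>n<N. t n < t (n + 1)"
    and "\<forall>n. 1 \<le> n \<and> n < N \<longrightarrow> \<gamma> (n + 1) = time_step t (n + 1) / time_step t n"
    and "\<forall>n. 1 \<le> n \<and> n \<le> N \<longrightarrow> 0 < \<gamma> (n + 1) \<and> ereal (\<gamma> (n + 1)) \<le> gamma_ss \<sigma>"
    and "vbdf2_solution D H eps lam F C0 V \<sigma> N t \<gamma> \<phi> r"
  shows "\<forall>n. 1 \<le> n \<and> n < N \<longrightarrow>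
           E_H D H eps lam \<sigma> t \<gamma> \<phi> r (n + 1) - E_H D H eps lam \<sigma> t \<gamma> \<phi> r n \<le> 0"
  using assms vbdf2_step_energy[of D lam H F \<sigma> N t \<gamma> eps C0 V \<phi> r] by blast

end
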